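(* Let $0<\lambda\le\Lambda$ with $\omega:=\Lambda/\lambda\ge 4$, and fix a target volume $V>0$. For each admissible pair $\gamma\in\Gamma_\omega:=\left[\frac{2}{\sqrt\omega},\frac{\sqrt\omega}{2}\right]$, $a\in(-\pi,\pi)$, let $\widetilde\Omega^{\omega}_{\gamma,a}:=\left(V/|\Omega^\omega_{\gamma,a}|\right)^{1/3}\Omega^\omega_{\gamma,a}$ be the scaling of $\Omega^{\omega}_{\gamma,a}$ to volume $V$. Then the principal positive half-eigenvalue $\mu_1^+(\widetilde\Omega^{\omega}_{\gamma,a})$ of the Pucci operator $\mathcal M^+_{\lambda,\Lambda}$ is uniquely minimized, over all admissible pairs $(\gamma,a)$, at $(\gamma,a)=(1,0)$; that is, $\mu_1^+(\widetilde\Omega^{\omega}_{1,0})<\mu_1^+(\widetilde\Omega^{\omega}_{\gamma,a})$ for every admissible $(\gamma,a)\ne(1,0)$. Equivalently, the scale-invariant quantity $|\Omega^{\omega}_{\gamma,a}|^{2/3}\,\mu_1^+(\Omega^{\omega}_{\gamma,a})$ is uniquely minimized at $(\gamma,a)=(1,0)$.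
   Context: Pucci operator: for a symmetric $n\times n$ matrix $X$ with eigenvalues $e_1,\dots,e_n$, $\mathcal M^+_{\lambda,\Lambda}(X)=\Lambda\sum_{e_i>0}e_i+\lambda\sum_{e_i<0}e_i$. For a bounded domain $\Omega$, the principal positive half-eigenvalue is $\mu_1^+(\Omega)=\sup\{\mu\in\mathbb R:\exists\,\phi>0\text{ in }\Omega,\ \mathcal M^+_{\lambda,\Lambda}(D^2\phi)+\mu\phi\le 0\text{ in }\Omega\}$, where $\phi$ is continuous and the inequality is in the viscosity sense. $|\cdot|$ denotes Lebesgue measure. The domains $\Omega^\omega_\gamma\subset\mathbb R^3$. Let $\alpha=\pi/2$. In the first octant $\{x,y,z\ge0\}$ define seven closed pieces: $[\mathrm C]=\{0\le x,y,z\le\alpha\}$; $[\mathrm Z]=\{0\le x,y\le\alpha,\ \alpha\le z\le\alpha+\sqrt\omega\arcsin(\frac{\gamma}{\sqrt\omega}(\cos x+\cos y))\}$; $[\mathrm X]=\{0\le y,z\le\alpha,\ \alpha\le x\le\alpha+\sqrt\omega\arcsin(\frac{\gamma\cos y+\cos z}{\gamma\sqrt\omega})\}$; $[\mathrm Y]=\{0\le x,z\le\alpha,\ \alpha\le y\le\alpha+\sqrt\omega\arcsin(\frac{\gamma\cos x+\cos z}{\gamma\sqrt\omega})\}$; $[\mathrm{ZX}]=\{\alpha\le x\le\alpha+\sqrt\omega\arcsin(\frac1{\sqrt\omega}),\ \alpha\le z\le\alpha+\sqrt\omega\arcsin(\frac{\gamma}{\sqrt\omega}),\ 0\le\theta\le1,\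 0\le y\le\arccos\theta\}$ with $\theta=\sqrt\omega\sin(\frac{x-\alpha}{\sqrt\omega})+\frac{\sqrt\omega}{\gamma}\sin(\frac{z-\alpha}{\sqrt\omega})$; $[\mathrm{XY}]=\{\alpha\le x,y\le\alpha+\sqrt\omega\arcsin(\frac1{\gamma\sqrt\omega}),\ 0\le\theta\le1,\ 0\le z\le\arccos\theta\}$ with $\theta=\gamma\sqrt\omega\sin(\frac{x-\alpha}{\sqrt\omega})+\gamma\sqrt\omega\sin(\frac{y-\alpha}{\sqrt\omega})$; $[\mathrm{YZ}]=\{\alpha\le y\le\alpha+\sqrt\omega\arcsin(\frac1{\sqrt\omega}),\ \alpha\le z\le\alpha+\sqrt\omega\arcsin(\frac{\gamma}{\sqrt\omega}),\ 0\le\theta\le1,\ 0\le x\le\arccos\theta\}$ with $\theta=\sqrt\omega\sin(\frac{y-\alpha}{\sqrt\omega})+\frac{\sqrt\omega}{\gamma}\sin(\frac{z-\alpha}{\sqrt\omega})$. (For $\gamma\in\Gamma_\omega$ all inverse trigonometric expressions, on principal branches, are well defined.) Let $K$ be the union of the seven pieces. $\Omega^\omega_\gamma$ is the interior of the reflected union $\{(\sigma_1x,\sigma_2y,\sigma_3z):(x,y,z)\in K,\ \sigma_i\in\{-1,1\}\}$. Sheared domains: for $|a|<\pi$ let $s(a)=\sqrt{1-(a/\pi)^2}$ and $C_a=\begin{pmatrix}s(a)&0&0\\ a/\pi&1&0\\ 0&0&s(a)\end{pmatrix}$. Then $\Omega^\omega_{\gamma,a}:=C_a(\Omega^\omega_\gamma)$;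 in particular $\Omega^\omega_{\gamma,0}=\Omega^\omega_\gamma$. *)

theory Defs
  imports "HOL-Analysis.Analysis" "HOL-Computational_Algebra.Polynomial"
begin

definition char_polynomial :: "real ^ 'n ^ 'n \<Rightarrow> real poly" where
  "char_polynomial X = det (mat [:0, 1:] - (\<chi> i j. [:X $ i $ j:]))"

text \<open>The real eigenvalues, repeated according to (algebraic) multiplicity; for a symmetric
  matrix this multiset has \<open>CARD('n)\<close> elements.\<close>

definition eigenvalues :: "real ^ 'n ^ 'n \<Rightarrow> real multiset" where
  "eigenvalues X = proots (char_polynomial X)"

definition pucci_sup :: "real \<Rightarrow> real \<Rightarrow> real ^ 'n ^ 'n \<Rightarrow> real" where
  "pucci_sup lam Lam X =
     Lam * (\<Sum>e\<in>#filter_mset (\<lambda>e. e > 0) (eigenvalues X). e)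
     + lam * (\<Sum>e\<in>#filter_mset (\<lambda>e. e < 0) (eigenvalues X). e)"

text \<open>\<open>\<psi>\<close> is of class $C^2$ on the open set \<open>U\<close>, with gradient \<open>g\<close> and Hessian \<open>H\<close>
  (the latter is then automatically symmetric on \<open>U\<close>).\<close>

definition C2_with_hessian ::
  "(real ^ 'n) set \<Rightarrow> (real ^ 'n \<Rightarrow> real) \<Rightarrow> (real ^ 'n \<Rightarrow> real ^ 'n) \<Rightarrow>
    (real ^ 'n \<Rightarrow> real ^ 'n ^ 'n) \<Rightarrow> bool" where
  "C2_with_hessian U \<psi> g H \<longleftrightarrow> open U \<and>
     (\<forall>x\<in>U. (\<psi> has_derivative (\<lambda>h. g x \<bullet> h)) (at x)) \<and>
     (\<forall>x\<in>U. (g has_derivative (\<lambda>h. H x *v h)) (at x)) \<and>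
     continuous_on U H"

text \<open>The inequality $\mathcal{M}^+_{\lambda,\Lambda}(D^2\phi) + \mu\phi \le 0$ in the open set
  \<open>\<Omega>\<close> in the viscosity sense: it holds at \<open>x0\<close> with the Hessian of \<open>\<psi>\<close> in place of that of
  \<open>\<phi>\<close>, whenever \<open>\<psi>\<close> is $C^2$ near \<open>x0\<close> and \<open>\<phi> - \<psi>\<close> has a local minimum at \<open>x0\<close>.\<close>

definition pucci_supersolution ::
  "real \<Rightarrow> real \<Rightarrow> real \<Rightarrow> (real ^ 'n) set \<Rightarrow> (real ^ 'n \<Rightarrow> real) \<Rightarrow> bool" where
  "pucci_supersolution lam Lam \<mu> \<Omega> \<phi> \<longleftrightarrow>
     (\<forall>U \<psi> g H. \<forall>x0\<in>U.
        U \<subseteq> \<Omega> \<and> C2_with_hessian U \<psi> g H \<and> (\<forall>x\<in>U. \<phi> x0 - \<psi> x0 \<le> \<phi> x - \<psi> x) \<longrightarrow>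
        pucci_sup lam Lam (H x0) + \<mu> * \<phi> x0 \<le> 0)"

definition half_eigenvalue :: "real \<Rightarrow> real \<Rightarrow> (real ^ 'n) set \<Rightarrow> real" where
  "half_eigenvalue lam Lam \<Omega> =
     Sup {\<mu>. \<exists>\<phi>. continuous_on \<Omega> \<phi> \<and> (\<forall>x\<in>\<Omega>. \<phi> x > 0) \<and>
                 pucci_supersolution lam Lam \<mu> \<Omega> \<phi>}"

definition piece_C :: "(real ^ 3) set" where
  "piece_C = {vector [x, y, z] | x y z.
     0 \<le> x \<and> x \<le> pi/2 \<and> 0 \<le> y \<and> y \<le> pi/2 \<and> 0 \<le> z \<and> z \<le> pi/2}"

definition piece_Z :: "real \<Rightarrow> real \<Rightarrow> (real ^ 3) set" where
  "piece_Z \<omega> \<gamma> = {vector [x, y, z] | x y z.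
     0 \<le> x \<and> x \<le> pi/2 \<and> 0 \<le> y \<and> y \<le> pi/2 \<and>
     pi/2 \<le> z \<and> z \<le> pi/2 + sqrt \<omega> * arcsin (\<gamma> / sqrt \<omega> * (cos x + cos y))}"

definition piece_X :: "real \<Rightarrow> real \<Rightarrow> (real ^ 3) set" where
  "piece_X \<omega> \<gamma> = {vector [x, y, z] | x y z.
     0 \<le> y \<and> y \<le> pi/2 \<and> 0 \<le> z \<and> z \<le> pi/2 \<and>
     pi/2 \<le> x \<and> x \<le> pi/2 + sqrt \<omega> * arcsin ((\<gamma> * cos y + cos z) / (\<gamma> * sqrt \<omega>))}"

definition piece_Y :: "real \<Rightarrow> real \<Rightarrow> (real ^ 3) set" where
  "piece_Y \<omega> \<gamma> = {vector [x, y, z] | x y z.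
     0 \<le> x \<and> x \<le> pi/2 \<and> 0 \<le> z \<and> z \<le> pi/2 \<and>
     pi/2 \<le> y \<and> y \<le> pi/2 + sqrt \<omega> * arcsin ((\<gamma> * cos x + cos z) / (\<gamma> * sqrt \<omega>))}"

definition piece_ZX :: "real \<Rightarrow> real \<Rightarrow> (real ^ 3) set" where
  "piece_ZX \<omega> \<gamma> = {vector [x, y, z] | x y z.
     pi/2 \<le> x \<and> x \<le> pi/2 + sqrt \<omega> * arcsin (1 / sqrt \<omega>) \<and>
     pi/2 \<le> z \<and> z \<le> pi/2 + sqrt \<omega> * arcsin (\<gamma> / sqrt \<omega>) \<and>
     (let \<theta> = sqrt \<omega> * sin ((x - pi/2) / sqrt \<omega>) + sqrt \<omega> / \<gamma> * sin ((z - pi/2) / sqrt \<omega>)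
      in 0 \<le> \<theta> \<and> \<theta> \<le> 1 \<and> 0 \<le> y \<and> y \<le> arccos \<theta>)}"

definition piece_XY :: "real \<Rightarrow> real \<Rightarrow> (real ^ 3) set" where
  "piece_XY \<omega> \<gamma> = {vector [x, y, z] | x y z.
     pi/2 \<le> x \<and> x \<le> pi/2 + sqrt \<omega> * arcsin (1 / (\<gamma> * sqrt \<omega>)) \<and>
     pi/2 \<le> y \<and> y \<le> pi/2 + sqrt \<omega> * arcsin (1 / (\<gamma> * sqrt \<omega>)) \<and>
     (let \<theta> = \<gamma> * sqrt \<omega> * sin ((x - pi/2) / sqrt \<omega>) + \<gamma> * sqrt \<omega> * sin ((y - pi/2) / sqrt \<omega>)
      in 0 \<le> \<theta> \<and> \<theta> \<le> 1 \<and> 0 \<le> z \<and> z \<le> arccos \<theta>)}"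

definition piece_YZ :: "real \<Rightarrow> real \<Rightarrow> (real ^ 3) set" where
  "piece_YZ \<omega> \<gamma> = {vector [x, y, z] | x y z.
     pi/2 \<le> y \<and> y \<le> pi/2 + sqrt \<omega> * arcsin (1 / sqrt \<omega>) \<and>
     pi/2 \<le> z \<and> z \<le> pi/2 + sqrt \<omega> * arcsin (\<gamma> / sqrt \<omega>) \<and>
     (let \<theta> = sqrt \<omega> * sin ((y - pi/2) / sqrt \<omega>) + sqrt \<omega> / \<gamma> * sin ((z - pi/2) / sqrt \<omega>)
      in 0 \<le> \<theta> \<and> \<theta> \<le> 1 \<and> 0 \<le> x \<and> x \<le> arccos \<theta>)}"

definition octant_union :: "real \<Rightarrow> real \<Rightarrow> (real ^ 3) set" where
  "octant_union \<omega> \<gamma> = piece_C \<union> piece_Z \<omega> \<gamma> \<union> piece_X \<omega> \<gamma> \<union> piece_Y \<omega> \<gamma> \<union>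
     piece_ZX \<omega> \<gamma> \<union> piece_XY \<omega> \<gamma> \<union> piece_YZ \<omega> \<gamma>"

definition Omega0 :: "real \<Rightarrow> real \<Rightarrow> (real ^ 3) set" where
  "Omega0 \<omega> \<gamma> = interior {vector [\<sigma>1 * p $ 1, \<sigma>2 * p $ 2, \<sigma>3 * p $ 3] | p \<sigma>1 \<sigma>2 \<sigma>3.
     p \<in> octant_union \<omega> \<gamma> \<and> \<sigma>1 \<in> {-1, 1} \<and> \<sigma>2 \<in> {-1, 1} \<and> \<sigma>3 \<in> {-1, 1}}"

definition shear_factor :: "real \<Rightarrow> real" where
  "shear_factor a = sqrt (1 - (a / pi)\<^sup>2)"

definition shear_matrix :: "real \<Rightarrow> real ^ 3 ^ 3" where
  "shear_matrix a = vector
     [vector [shear_factor a, 0, 0],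
      vector [a / pi, 1, 0],
      vector [0, 0, shear_factor a]]"

definition Omega :: "real \<Rightarrow> real \<Rightarrow> real \<Rightarrow> (real ^ 3) set" where
  "Omega \<omega> \<gamma> a = (\<lambda>p. shear_matrix a *v p) ` Omega0 \<omega> \<gamma>"

definition Omega_scaled :: "real \<Rightarrow> real \<Rightarrow> real \<Rightarrow> real \<Rightarrow> (real ^ 3) set" where
  "Omega_scaled V \<omega> \<gamma> a =
     (\<lambda>p. (V / measure lebesgue (Omega \<omega> \<gamma> a)) powr (1/3) *\<^sub>R p) ` Omega \<omega> \<gamma> a"

definition admissible :: "real \<Rightarrow> (real \<times> real) set" where
  "admissible \<omega> = {2 / sqrt \<omega> .. sqrt \<omega> / 2} \<times> {-pi <..< pi}"

end

theory Submission
  imports Defs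
begin

text \<open>
  Let \<open>F\<close> be the even \<open>C\<^sup>2\<close> function equal to \<open>cos t\<close> for \<open>\<bar>t\<bar> \<le> \<pi>/2\<close> and continued by
  \<open>- \<surd>\<omega> sin ((\<bar>t\<bar> - \<pi>/2) / \<surd>\<omega>)\<close>. The domain for \<open>(\<gamma>, 0)\<close> is the set where
  \<open>u = \<gamma> F(x) + \<gamma> F(y) + F(z)\<close> is positive, and \<open>u\<close> is an eigenfunction with eigenvalue \<open>\<lambda>\<close>.
  The rows of the inverse shear all have squared length \<open>1 / s(a)\<^sup>2\<close>, so subadditivity of the Pucci
  operator makes the sheared \<open>u\<close> a supersolution with constant \<open>\<lambda> / s(a)\<^sup>2\<close>; at \<open>(1, 0)\<close> the value
  \<open>\<lambda>\<close> is attained because shrunken copies of \<open>u\<close> touch any supersolution from below.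
  As the shear multiplies volume by \<open>s(a)\<^sup>2\<close>, the claim reduces to the minimality of the volume
  at \<open>\<gamma> = 1\<close>. Symmetrising over the three positions of the distinguished
  coordinate, this follows pointwise: from convexity of \<open>arcsin\<close> where exactly one coordinate exceeds
  \<open>\<pi>/2\<close>, and from the arithmetic-geometric mean inequality for the densities where two do.
\<close>

section \<open>Pucci operators and the spectral theorem\<close>

text \<open>The second derivative of F changes branch exactly where its sign changes, and there the
  Pucci constant jumps from lam to Lam = \<omega> lam; this cancels the factor 1/\<omega> of the
  outer branch, so that every summand c F with c > 0 solves the same one-dimensional equation. Write
  s for \<open>shear_factor a\<close> and M \<gamma> for the volume at a = 0. The eigenvalue bound
  gains s^(-2) while the volume factor loses only s^(4/3), so the scale-invariant quantity at
  (\<gamma>, a) is at least lam (M \<gamma> / s)^(2/3), and the inequality to prove is s M 1 < M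
  \<gamma>. Taken singly, the pieces of the domain move in opposite directions as \<gamma> varies,
  so they have to be compared in groups of three. With the values of F as coordinates, u > 0 becomes
  a linear inequality and Lebesgue measure an arcsine law. Dividing u by the weight of the
  coordinate that is alone on its branch turns the three positions into the weight pairs (\<gamma>,
  \<gamma>), (1, 1/\<gamma>), (1/\<gamma>, 1). Each slot then sees \<gamma>, 1 and 1/\<gamma> once:
  their product is 1 and their mean is at least 1. The range of \<gamma>, with \<omega> \<ge> 4,
  says that all three are at most \<open>sqrt \<omega> / 2\<close>.\<close>

lemma self_adjoint_eigenvector:
  fixes f :: "'a::euclidean_space \<Rightarrow> 'a"
  assumes "linear f" and sa: "\<And>x y. f x \<bullet> y = x \<bullet> f y"
    and S: "subspace S" "S \<noteq> {0}" and inv: "\<And>x. x \<in> S \<Longrightarrow> f x \<in> S"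
  obtains v e where "v \<in> S" "norm v = 1" "f v = e *\<^sub>R v"
proof -
  interpret f: linear f by fact
  have cont: "continuous_on X f" for X
    using linear_continuous_on linear_linear assms(1) by blast
  let ?C = "sphere 0 1 \<inter> S"
  have "compact ?C"
    using closed_subspace[OF S(1)] by (simp add: compact_Int_closed)
  moreover obtain x where x: "x \<in> S" "x \<noteq> 0" using S subspace_0 by blast
  then have "(1 / norm x) *\<^sub>R x \<in> ?C" using S(1) by (auto simp: subspace_scale)
  then have "?C \<noteq> {}" by blast
  moreover have "continuous_on ?C (\<lambda>x. f x \<bullet> x)" by (intro continuous_intros cont)
  \<comment> \<open>The eigenvector is a maximiser of the Rayleigh quotient on the unit sphere of
    \<open>S\<close>; its residual \<open>w\<close> will be shown to vanish.\<close>
  ultimately obtain v where v: "v \<in> ?C" and max: "\<And>y. y \<in> ?C \<Longrightarrow> f y \<bullet> y \<le> f v \<bullet> v"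
    using continuous_attains_sup[of ?C "\<lambda>x. f x \<bullet> x"] by blast
  define e where "e = f v \<bullet> v"
  have vS: "v \<in> S" and nv: "v \<bullet> v = 1" "norm v = 1" using v by (auto simp: norm_eq_1)
  have max': "f y \<bullet> y \<le> e * (y \<bullet> y)" if "y \<in> S" for y
  proof (cases "y = 0")
    case False
    then have "(1 / norm y) *\<^sub>R y \<in> ?C" using S(1) that by (auto simp: subspace_scale)
    from max[OF this] have "(f y \<bullet> y) / (norm y)\<^sup>2 \<le> e"
      by (simp add: f.scaleR e_def power2_eq_square)
    then show ?thesis using False by (simp add: divide_le_eq power2_norm_eq_inner)
  qed (simp add: f.zero)
  define w where "w = f v - e *\<^sub>R v"
  have wS: "w \<in> S" unfolding w_def using S(1) vS inv by (simp add: subspace_diff subspace_scale)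
  have wv: "w \<bullet> v = 0" by (simp add: w_def inner_diff_left nv e_def)
  have fvw: "f v \<bullet> w = w \<bullet> w"
    using wv by (simp add: w_def inner_diff_left inner_diff_right inner_commute)
  \<comment> \<open>Maximality tested at v + t w: the terms of order zero cancel, and a term linear
    in t remains against a quadratic one, which is impossible for small t > 0 unless w = 0.\<close>
  have key: "2 * t * (w \<bullet> w) \<le> t\<^sup>2 * (e * (w \<bullet> w) - f w \<bullet> w)" for t
  proof -
    have "v + t *\<^sub>R w \<in> S" using S(1) vS wS by (simp add: subspace_add subspace_scale)
    from max'[OF this] have "f (v + t *\<^sub>R w) \<bullet> (v + t *\<^sub>R w) \<le> e * ((v + t *\<^sub>R w) \<bullet> (v + t *\<^sub>R w))" .
    moreover have "f w \<bullet> v = w \<bullet> w" using sa fvw by (metis inner_commute)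
    ultimately show ?thesis using wv nv fvw
      by (simp add: f.add f.scaleR inner_add_left inner_add_right e_def[symmetric]
          inner_commute[of v w] algebra_simps power2_eq_square)
  qed
  have "w \<bullet> w = 0"
  proof (rule ccontr)
    assume "w \<bullet> w \<noteq> 0"
    then have pos: "w \<bullet> w > 0" by (simp add: inner_gt_zero_iff)
    define c where "c = e * (w \<bullet> w) - f w \<bullet> w"
    have "2 * t * (w \<bullet> w) \<le> t\<^sup>2 * c" for t using key unfolding c_def .
    then have q: "2 * t * (w \<bullet> w) \<le> t * (t * c)" for t by (simp add: power2_eq_square mult.assoc)
    \<comment> \<open>Small enough that t c \<le> w . w, which contradicts 2 (w . w) \<le> t c; the
      summand 1 keeps the denominator positive when c = 0.\<close>
    define t where "t = (w \<bullet> w) / (\<bar>c\<bar> + 1)"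
    have t: "t > 0" "t * (\<bar>c\<bar> + 1) = w \<bullet> w" using pos by (auto simp: t_def)
    have "2 * (w \<bullet> w) \<le> t * c" using q[of t] t(1) by (simp add: mult.assoc mult.left_commute[of 2])
    moreover have "t * c \<le> t * (\<bar>c\<bar> + 1)" using t(1) by (intro mult_left_mono) auto
    ultimately show False using t(2) pos by linarith
  qed
  then have "f v = e *\<^sub>R v" by (simp add: w_def)
  with vS nv show ?thesis using that by blast
qed

text \<open>Stated for invariant subspaces because the induction on dimension passes from
  \<open>S\<close> to the orthogonal complement of an eigenvector in \<open>S\<close>, which is
  again invariant by self-adjointness.\<close>

lemma self_adjoint_orthonormal_eigenbasis_subspace:
  fixes f :: "'a::euclidean_space \<Rightarrow> 'a"
  assumes "linear f" and sa: "\<And>x y. f x \<bullet> y = x \<bullet> f y"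
    and "subspace S" "\<And>x. x \<in> S \<Longrightarrow> f x \<in> S"
  shows "\<exists>B. B \<subseteq> S \<and> pairwise orthogonal B \<and> (\<forall>b\<in>B. norm b = 1 \<and> (\<exists>e. f b = e *\<^sub>R b)) \<and> span B = S"
  using assms(3,4)
proof (induction "dim S" arbitrary: S rule: less_induct)
  case less
  show ?case
  proof (cases "S = {0}")
    case True
    then show ?thesis by (intro exI[of _ "{}"]) auto
  next
    case False
    obtain v e where v: "v \<in> S" "norm v = 1" "f v = e *\<^sub>R v"
      using self_adjoint_eigenvector[OF assms(1) sa less.prems(1) False less.prems(2)] by blast
    define T where "T = S \<inter> {x. v \<bullet> x = 0}"
    have T: "subspace T" unfolding T_def
      using less.prems(1) subspace_hyperplane by (rule subspace_inter)
    have "v \<notin> T" using v by (auto simp: T_def)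
    then have "T \<subset> S" using v(1) unfolding T_def by blast
    then have "dim T < dim S"
      using dim_psubset[of T S] T less.prems(1) by (metis span_eq_iff)
    moreover have "f x \<in> T" if "x \<in> T" for x
      using that less.prems(2) sa[of v x] v by (auto simp: T_def)
    ultimately obtain B where B: "B \<subseteq> T" "pairwise orthogonal B"
      "\<forall>b\<in>B. norm b = 1 \<and> (\<exists>e. f b = e *\<^sub>R b)" "span B = T"
      using less.hyps[of T] T by blast
    have "span (insert v B) = S"
    proof
      show "span (insert v B) \<subseteq> S"
        using B(1) v(1) less.prems(1) by (intro span_minimal) (auto simp: T_def)
      show "S \<subseteq> span (insert v B)"
      proof
        fix x assume "x \<in> S"
        have "v \<bullet> (x - (v \<bullet> x) *\<^sub>R v) = 0" using v(2) by (simp add: inner_diff_right norm_eq_1)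
        then have "x - (v \<bullet> x) *\<^sub>R v \<in> span B" using \<open>x \<in> S\<close> v(1) less.prems(1) B(4)
          by (auto simp: T_def subspace_diff subspace_scale)
        then show "x \<in> span (insert v B)" unfolding span_insert by blast
      qed
    qed
    moreover have "pairwise orthogonal (insert v B)"
      using B(1,2) unfolding pairwise_insert by (auto simp: T_def orthogonal_def inner_commute)
    ultimately show ?thesis using B v \<open>T \<subset> S\<close> by (intro exI[of _ "insert v B"]) blast
  qed
qed

text \<open>Indexing the basis by the type \<open>'n\<close> itself lets the eigenvectors serve as
  the columns or rows of a square orthogonal matrix.\<close>

lemma symmetric_matrix_orthonormal_eigenbasis:
  fixes A :: "real^'n^'n"
  assumes "transpose A = A"
  obtains w :: "'n \<Rightarrow> real^'n" and e :: "'n \<Rightarrow> real"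
  where "\<And>i j. w i \<bullet> w j = (if i = j then 1 else 0)" "\<And>i. A *v w i = e i *\<^sub>R w i"
proof -
  have sa: "(A *v x) \<bullet> y = x \<bullet> (A *v y)" for x y
    using dot_lmul_matrix[of x A y] assms by (metis transpose_matrix_vector)
  obtain B where B: "pairwise orthogonal B"
      "\<forall>b\<in>B. norm b = 1 \<and> (\<exists>e. A *v b = e *\<^sub>R b)" "span B = UNIV"
    using self_adjoint_orthonormal_eigenbasis_subspace[of "(*v) A" UNIV] sa by auto
  have "0 \<notin> B" using B(2) by auto
  then have ind: "independent B" using B(1) pairwise_orthogonal_independent by blast
  then have "card B = CARD('n)" "finite B"
    using B(3) by (metis dim_UNIV dim_span_eq_card_independent DIM_cart DIM_real mult.right_neutral)
      (simp add: ind independent_imp_finite)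
  then obtain w where w: "bij_betw w (UNIV :: 'n set) B"
    using finite_same_card_bij[of "UNIV :: 'n set" B] by auto
  have wB: "w i \<in> B" for i using w by (auto simp: bij_betw_def)
  have "w i \<bullet> w j = (if i = j then 1 else 0)" for i j
  proof (cases "i = j")
    case True then show ?thesis using B(2) wB by (simp add: norm_eq_1)
  next
    case False
    then have "w i \<noteq> w j" using w by (auto simp: bij_betw_def inj_def)
    then show ?thesis using B(1) wB False by (auto simp: pairwise_def orthogonal_def)
  qed
  moreover have "\<forall>i. \<exists>e. A *v w i = e *\<^sub>R w i" using B(2) wB by blast
  then obtain e where "\<forall>i. A *v w i = e i *\<^sub>R w i" using choice[of "\<lambda>i e. A *v w i = e *\<^sub>R w i"] by blast
  ultimately show ?thesis using that by blast
qed

text \<open>Applied to the embedding of constants into polynomials, so that a diagonalisation over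
  the reals can be transported to the polynomial matrix in \<open>char_polynomial\<close>.\<close>

lemma matrix_map_mult:
  fixes A B :: "'a::comm_ring_1 ^'n^'n" and h :: "'a \<Rightarrow> 'b::comm_ring_1"
  assumes "\<And>x y. h (x + y) = h x + h y" "\<And>x y. h (x * y) = h x * h y" "h 0 = 0"
  shows "map_matrix h (A ** B) = map_matrix h A ** map_matrix h B"
proof -
  have "h (sum g I) = (\<Sum>i\<in>I. h (g i))" if "finite I" for g and I :: "'n set"
    using that by induction (auto simp: assms)
  then show ?thesis by (simp add: vec_eq_iff map_matrix_def matrix_matrix_mult_def assms)
qed

text \<open>The bridge from the algebraic definition by roots to the geometric one: conjugating by
  the orthogonal matrix of eigenvectors preserves the characteristic determinant and makes it a
  product of linear factors.\<close>

lemma eigenvalues_of_orthonormal_eigenbasis: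
  fixes A :: "real^'n^'n"
    and w :: "'n \<Rightarrow> real^'n"
  assumes on: "\<And>i j. w i \<bullet> w j = (if i = j then 1 else 0)" and ev: "\<And>i. A *v w i = e i *\<^sub>R w i"
  shows "eigenvalues A = image_mset e (mset_set UNIV)"
proof -
  define c :: "real \<Rightarrow> real poly" where "c x = [:x:]" for x
  define Q :: "real^'n^'n" where "Q = (\<chi> i j. w j $ i)"
  define D :: "real^'n^'n" where "D = (\<chi> i j. if i = j then e i else 0)"
  define X :: "real poly^'n^'n" where "X = mat [:0, 1:]"
  have hom: "map_matrix c (P ** R) = map_matrix c P ** map_matrix c R" for P R :: "real^'n^'n"
    by (rule matrix_map_mult) (auto simp: c_def)
  have "transpose Q ** Q = mat 1"
    using on by (simp add: vec_eq_iff Q_def transpose_def matrix_matrix_mult_def mat_def inner_vec_def)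
  then have QQ: "orthogonal_matrix Q" by (simp add: orthogonal_matrix)
  have AQ: "A ** Q = Q ** D"
  proof -
    have "(\<Sum>k\<in>UNIV. A $ i $ k * w j $ k) = w j $ i * e j" for i j
      using ev[of j] by (simp add: vec_eq_iff matrix_vector_mult_def mult.commute)
    then show ?thesis
      by (simp add: vec_eq_iff matrix_matrix_mult_def Q_def D_def if_distrib cong: if_cong)
  qed
  let ?M = "map_matrix c"
  \<comment> \<open>\<open>X\<close> is a scalar matrix, so it commutes with the lifted change of
    basis.\<close>
  have XM: "X ** P = P ** X" for P :: "real poly^'n^'n"
    by (simp add: vec_eq_iff matrix_matrix_mult_def X_def mat_def if_distrib mult.commute
        flip: if_distribR cong: if_cong) (simp add: if_distrib if_distribR cong: if_cong)
  have id: "?M (transpose Q) ** ?M Q = mat 1"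
    unfolding hom[symmetric] using QQ
    by (simp add: orthogonal_matrix_def vec_eq_iff map_matrix_def mat_def c_def)
  have diff: "(P - R) ** S = P ** S - R ** S" "S ** (P - R) = S ** P - S ** R" for P R S :: "real poly^'n^'n"
    by (simp_all add: vec_eq_iff matrix_matrix_mult_def algebra_simps sum_subtractf)
  have "(X - ?M A) ** ?M Q = ?M Q ** (X - ?M D)"
    unfolding diff using AQ XM[of "?M Q"] hom[of A Q] hom[of Q D] by simp
  then have "?M (transpose Q) ** ((X - ?M A) ** ?M Q) = X - ?M D"
    by (simp add: matrix_mul_assoc id)
  from this[symmetric] have "det (X - ?M D) = det (?M (transpose Q)) * det (?M Q) * det (X - ?M A)"
    by (simp only: det_mul mult_ac)
  also have "\<dots> = det (X - ?M A)"
    using arg_cong[OF id, of det] by (simp only: det_mul det_I mult_1)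
  finally have "char_polynomial A = det (X - ?M D)"
    by (simp add: char_polynomial_def X_def map_matrix_def c_def)
  also have "\<dots> = (\<Prod>i\<in>UNIV. (X - ?M D) $ i $ i)"
    by (rule det_diagonal) (simp add: X_def D_def mat_def map_matrix_def c_def)
  also have "\<dots> = (\<Prod>i\<in>UNIV. [:- e i, 1:])"
    by (simp add: X_def D_def mat_def map_matrix_def c_def)
  finally have "eigenvalues A = proots (\<Prod>i\<in>UNIV. [:- e i, 1:])" by (simp add: eigenvalues_def)
  also have "\<dots> = (\<Sum>i\<in>UNIV. proots [:- e i, 1:])" by (rule proots_prod) simp
  also have "\<dots> = (\<Sum>i\<in>UNIV. {# e i #})" by simp
  also have "\<dots> = image_mset e (mset_set UNIV)"
    by (subst sum_unfold_sum_mset) (simp add: image_mset.compositionality flip: sum_unfold_sum_mset)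
  finally show ?thesis .
qed

section \<open>The Pucci operator in an eigenbasis, and its subadditivity\<close>

text \<open>The Pucci operator on 1 x 1 matrices; at zero both branches agree.\<close>

definition pucci_weight :: "real \<Rightarrow> real \<Rightarrow> real \<Rightarrow> real" where
  "pucci_weight lam Lam e = (if e > 0 then Lam * e else lam * e)"

lemma pucci_sup_of_orthonormal_eigenbasis:
  fixes A :: "real^'n^'n"
    and w :: "'n \<Rightarrow> real^'n"
  assumes "\<And>i j. w i \<bullet> w j = (if i = j then 1 else 0)" "\<And>i. A *v w i = e i *\<^sub>R w i"
  shows "pucci_sup lam Lam A = (\<Sum>i\<in>UNIV. pucci_weight lam Lam (e i))"
proof -
  have "Lam * (\<Sum>x\<in>#filter_mset (\<lambda>x. x > 0) M. x) + lam * (\<Sum>x\<in>#filter_mset (\<lambda>x. x < 0) M. x)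
     = (\<Sum>x\<in>#M. pucci_weight lam Lam x)" for M :: "real multiset"
    by (induction M) (auto simp: pucci_weight_def algebra_simps)
  then show ?thesis
    unfolding pucci_sup_def eigenvalues_of_orthonormal_eigenbasis[OF assms]
    by (simp add: image_mset.compositionality comp_def sum_unfold_sum_mset)
qed

lemma pucci_sup_diagonal:
  fixes A :: "real^'n^'n"
  assumes "\<And>i j. A $ i $ j = (if i = j then d i else 0)"
  shows "pucci_sup lam Lam A = (\<Sum>i\<in>UNIV. pucci_weight lam Lam (d i))"
proof (rule pucci_sup_of_orthonormal_eigenbasis)
  show "axis i (1::real) \<bullet> axis j 1 = (if i = j then 1 else 0)" for i j :: 'n
    by (simp add: inner_axis_axis)
  show "A *v axis i 1 = d i *\<^sub>R axis i 1" for i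
    by (simp add: matrix_vector_mult_basis) (simp add: column_def vec_eq_iff assms axis_def)
qed

text \<open>Monotonicity and subadditivity in one: H is bounded, as a quadratic form, by a sum of
  rank-one forms d n n^T, and the Pucci value of such a form is |n|^2 times the weight of d. The
  vectors are left general because the rows of the inverse shear are not orthogonal when a is
  nonzero.\<close>

lemma pucci_sup_le_rank_one_sum:
  fixes H :: "real^'n^'n"
  assumes lam: "0 \<le> lam" "lam \<le> Lam" and sym: "transpose H = H" and "finite K"
    and le: "\<And>x. x \<bullet> (H *v x) \<le> (\<Sum>k\<in>K. d k * (n k \<bullet> x)\<^sup>2)"
  shows "pucci_sup lam Lam H \<le> (\<Sum>k\<in>K. (n k \<bullet> n k) * pucci_weight lam Lam (d k))"
proof -
  obtain w :: "'n \<Rightarrow> real^'n" and e where on: "\<And>i j. w i \<bullet> w j = (if i = j then 1 else 0)"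
    and ev: "\<And>i. H *v w i = e i *\<^sub>R w i"
    using symmetric_matrix_orthonormal_eigenbasis[OF sym] by blast
  \<comment> \<open>At \<open>H\<close> the operator is the linear functional with these
    coefficients on the eigenbasis of \<open>H\<close>. Since they lie between lam and Lam, Parseval
    bounds the same functional on each rank-one form by the Pucci value of that form.\<close>
  define c where "c i = (if e i > 0 then Lam else lam)" for i
  have c: "lam \<le> c i" "c i \<le> Lam" "0 \<le> c i" for i using lam by (auto simp: c_def)
  have parseval: "(\<Sum>i\<in>UNIV. (v \<bullet> w i)\<^sup>2) = v \<bullet> v" for v
  proof -
    define Q :: "real^'n^'n" where "Q = (\<chi> i. w i)"
    have "Q ** transpose Q = mat 1"
      using on by (simp add: vec_eq_iff Q_def transpose_def matrix_matrix_mult_def mat_def inner_vec_def)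
    then have "orthogonal_matrix Q"
      by (simp add: orthogonal_matrix_def matrix_left_right_inverse)
    then have "orthogonal_transformation ((*v) Q)"
      by (simp add: orthogonal_transformation_matrix)
    then have "(Q *v v) \<bullet> (Q *v v) = v \<bullet> v"
      by (simp add: orthogonal_transformation_def)
    moreover have "(Q *v v) $ i = v \<bullet> w i" for i
      by (simp add: matrix_vector_mult_def Q_def inner_vec_def mult.commute)
    ultimately show ?thesis by (simp add: inner_vec_def power2_eq_square)
  qed
  have "pucci_sup lam Lam H = (\<Sum>i\<in>UNIV. c i * (w i \<bullet> (H *v w i)))"
    by (simp add: pucci_sup_of_orthonormal_eigenbasis[OF on ev] pucci_weight_def c_def ev on if_distrib if_distribR cong: if_cong)
  also have "\<dots> \<le> (\<Sum>i\<in>UNIV. c i * (\<Sum>k\<in>K. d k * (n k \<bullet> w i)\<^sup>2))"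
    by (intro sum_mono mult_left_mono le c)
  also have "\<dots> = (\<Sum>k\<in>K. d k * (\<Sum>i\<in>UNIV. c i * (n k \<bullet> w i)\<^sup>2))"
    unfolding sum_distrib_left by (subst sum.swap) (simp add: mult.left_commute)
  also have "\<dots> \<le> (\<Sum>k\<in>K. (n k \<bullet> n k) * pucci_weight lam Lam (d k))"
  proof (rule sum_mono)
    fix k
    have "(\<Sum>i\<in>UNIV. c i * (n k \<bullet> w i)\<^sup>2) \<le> (\<Sum>i\<in>UNIV. Lam * (n k \<bullet> w i)\<^sup>2)"
      "(\<Sum>i\<in>UNIV. lam * (n k \<bullet> w i)\<^sup>2) \<le> (\<Sum>i\<in>UNIV. c i * (n k \<bullet> w i)\<^sup>2)"
      using c by (auto intro!: sum_mono mult_right_mono)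
    then have b: "(\<Sum>i\<in>UNIV. c i * (n k \<bullet> w i)\<^sup>2) \<le> Lam * (n k \<bullet> n k)"
      "lam * (n k \<bullet> n k) \<le> (\<Sum>i\<in>UNIV. c i * (n k \<bullet> w i)\<^sup>2)"
      by (simp_all add: parseval flip: sum_distrib_left)
    show "d k * (\<Sum>i\<in>UNIV. c i * (n k \<bullet> w i)\<^sup>2) \<le> (n k \<bullet> n k) * pucci_weight lam Lam (d k)"
    proof (cases "d k > 0")
      case True
      then show ?thesis using mult_left_mono[OF b(1), of "d k"] by (simp add: pucci_weight_def ac_simps)
    next
      case False
      then show ?thesis using mult_left_mono_neg[OF b(2), of "d k"] by (simp add: pucci_weight_def ac_simps)
    qed
  qed
  finally show ?thesis .
qed

section \<open>Second-order calculus\<close>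

text \<open>The mean value theorem applied first along u to a difference of two parallel sides, then
  along v to the gradient; \<open>p\<close> below parametrises the parallelogram with sides s u and
  s v.\<close>

lemma C2_second_difference:
  assumes C2: "C2_with_hessian U f g H" and U: "ball x r \<subseteq> U" and s: "\<bar>s\<bar> * (norm u + norm v) < r"
  obtains \<xi> where "dist \<xi> x \<le> \<bar>s\<bar> * (norm u + norm v)"
    "f (x + s *\<^sub>R u + s *\<^sub>R v) - f (x + s *\<^sub>R u) - f (x + s *\<^sub>R v) + f x = s\<^sup>2 * ((H \<xi> *v v) \<bullet> u)"
proof -
  have bd: "norm ((\<tau> * s) *\<^sub>R u + (\<rho> * s) *\<^sub>R v) \<le> \<bar>s\<bar> * (norm u + norm v)"
    if "0 \<le> \<tau>" "\<tau> \<le> 1" "0 \<le> \<rho>" "\<rho> \<le> 1" for \<tau> \<rho> :: real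
  proof -
    have "norm ((\<tau> * s) *\<^sub>R u + (\<rho> * s) *\<^sub>R v) \<le> \<tau> * (\<bar>s\<bar> * norm u) + \<rho> * (\<bar>s\<bar> * norm v)"
      using that by (intro order_trans[OF norm_triangle_ineq]) (simp add: abs_mult)
    also have "\<dots> \<le> 1 * (\<bar>s\<bar> * norm u) + 1 * (\<bar>s\<bar> * norm v)"
      using that by (intro add_mono mult_right_mono) auto
    finally show ?thesis by (simp add: algebra_simps)
  qed
  have inU: "x + ((\<tau> * s) *\<^sub>R u + (\<rho> * s) *\<^sub>R v) \<in> U"
    if "0 \<le> \<tau>" "\<tau> \<le> 1" "0 \<le> \<rho>" "\<rho> \<le> 1" for \<tau> \<rho> :: real
  proof -
    have dist_shift: "dist x (x + w) = norm w" for w by (simp add: dist_norm)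
    have "x + ((\<tau> * s) *\<^sub>R u + (\<rho> * s) *\<^sub>R v) \<in> ball x r"
      using bd[OF that] s unfolding mem_ball dist_shift by linarith
    then show ?thesis using U by blast
  qed
  have f: "(f has_derivative (\<lambda>h. g y \<bullet> h)) (at y)" if "y \<in> U" for y
    using C2 that by (auto simp: C2_with_hessian_def)
  have g: "(g has_derivative (\<lambda>h. H y *v h)) (at y)" if "y \<in> U" for y
    using C2 that by (auto simp: C2_with_hessian_def)
  define p where "p \<tau> \<rho> = x + ((\<tau> * s) *\<^sub>R u + (\<rho> * s) *\<^sub>R v)" for \<tau> \<rho>
  have d1: "((\<lambda>\<tau>. f (p \<tau> \<rho>)) has_real_derivative s * (g (p \<tau> \<rho>) \<bullet> u)) (at \<tau>)"
    if "0 \<le> \<tau>" "\<tau> \<le> 1" "0 \<le> \<rho>" "\<rho> \<le> 1" for \<tau> \<rho>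
  proof -
    have "((\<lambda>\<tau>. p \<tau> \<rho>) has_derivative (\<lambda>h. (h * s) *\<^sub>R u)) (at \<tau>)"
      unfolding p_def by (auto intro!: derivative_eq_intros)
    from has_derivative_compose[OF this f] inU[OF that] show ?thesis
      by (simp add: p_def has_field_derivative_def ac_simps mult_commute_abs)
  qed
  have d2: "((\<lambda>\<rho>. g (p \<tau> \<rho>) \<bullet> u) has_real_derivative s * ((H (p \<tau> \<rho>) *v v) \<bullet> u)) (at \<rho>)"
    if "0 \<le> \<tau>" "\<tau> \<le> 1" "0 \<le> \<rho>" "\<rho> \<le> 1" for \<tau> \<rho>
  proof -
    have "((\<lambda>\<rho>. p \<tau> \<rho>) has_derivative (\<lambda>h. (h * s) *\<^sub>R v)) (at \<rho>)"
      unfolding p_def by (auto intro!: derivative_eq_intros)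
    from has_derivative_inner_left[OF has_derivative_compose[OF this g], of u] inU[OF that]
    show ?thesis
      by (simp add: p_def has_field_derivative_def matrix_vector_mult_scaleR ac_simps mult_commute_abs)
  qed
  obtain \<tau> where \<tau>: "0 < \<tau>" "\<tau> < 1"
    "(f (p 1 1) - f (p 1 0)) - (f (p 0 1) - f (p 0 0)) = s * (g (p \<tau> 1) \<bullet> u) - s * (g (p \<tau> 0) \<bullet> u)"
  proof -
    have "((\<lambda>\<tau>. f (p \<tau> 1) - f (p \<tau> 0)) has_real_derivative s * (g (p \<tau> 1) \<bullet> u) - s * (g (p \<tau> 0) \<bullet> u)) (at \<tau>)"
      if "0 \<le> \<tau>" "\<tau> \<le> 1" for \<tau>
      by (intro DERIV_diff d1) (use that in auto)
    from MVT2[OF zero_less_one this] show ?thesis using that by auto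
  qed
  obtain \<rho> where \<rho>: "0 < \<rho>" "\<rho> < 1" "g (p \<tau> 1) \<bullet> u - g (p \<tau> 0) \<bullet> u = s * ((H (p \<tau> \<rho>) *v v) \<bullet> u)"
    using MVT2[of 0 1 "\<lambda>\<rho>. g (p \<tau> \<rho>) \<bullet> u" "\<lambda>\<rho>. s * ((H (p \<tau> \<rho>) *v v) \<bullet> u)"] d2 \<tau>
    by auto
  show ?thesis
  proof
    show "dist (p \<tau> \<rho>) x \<le> \<bar>s\<bar> * (norm u + norm v)"
      using bd[of \<tau> \<rho>] \<tau> \<rho> by (simp add: p_def dist_norm)
    have "(f (p 1 1) - f (p 1 0)) - (f (p 0 1) - f (p 0 0)) = s * (g (p \<tau> 1) \<bullet> u - g (p \<tau> 0) \<bullet> u)"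
      using \<tau>(3) by (simp add: algebra_simps)
    also have "\<dots> = s\<^sup>2 * ((H (p \<tau> \<rho>) *v v) \<bullet> u)" unfolding \<rho>(3) by (simp add: power2_eq_square)
    finally show "f (x + s *\<^sub>R u + s *\<^sub>R v) - f (x + s *\<^sub>R u) - f (x + s *\<^sub>R v) + f x = s\<^sup>2 * ((H (p \<tau> \<rho>) *v v) \<bullet> u)"
      by (simp add: p_def add.assoc)
  qed
qed

text \<open>Schwarz's theorem: the second difference is unchanged when u and v are exchanged, so
  both mixed forms have the same limit. \<open>C2_with_hessian\<close> does not record symmetry, but
  the spectral theorem for the Hessian of a test function requires it.\<close>

lemma C2_hessian_symmetric:
  fixes H :: "real^'n \<Rightarrow> real^'n^'n"
  assumes C2: "C2_with_hessian U f g H" and "x \<in> U"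
  shows "transpose (H x) = H x"
proof -
  have "open U" and cont: "continuous_on U H" using C2 by (auto simp: C2_with_hessian_def)
  then obtain r where r: "r > 0" "ball x r \<subseteq> U" using \<open>x \<in> U\<close> openE by blast
  have "(H x *v v) \<bullet> u = (H x *v u) \<bullet> v" for u v
  proof -
    define N where "N = norm u + norm v + 1"
    have N: "N > 0" "norm u + norm v < N" unfolding N_def by (auto intro: add_nonneg_pos)
    have "isCont H x" using cont \<open>open U\<close> \<open>x \<in> U\<close> by (simp add: continuous_on_eq_continuous_at)
    \<comment> \<open>The shift by 2 gives |s k| N = r / (k + 2) < r already at k = 0, so that all
      the parallelograms stay in the ball.\<close>
    define s where "s k = r / N / (real k + 2)" for k
    have s: "s k \<noteq> 0" "\<bar>s k\<bar> * (norm u + norm v) < r" "\<bar>s k\<bar> * (norm v + norm u) < r" for k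
    proof -
      show "s k \<noteq> 0" using r N by (simp add: s_def)
      have "\<bar>s k\<bar> * (norm u + norm v) \<le> \<bar>s k\<bar> * N" using N by (intro mult_left_mono) auto
      also have "\<dots> < r" using r N by (simp add: s_def divide_less_eq)
      finally show "\<bar>s k\<bar> * (norm u + norm v) < r" "\<bar>s k\<bar> * (norm v + norm u) < r"
        by (simp_all add: add.commute)
    qed
    have "\<exists>\<xi> \<eta>. dist \<xi> x \<le> \<bar>s k\<bar> * (norm u + norm v) \<and> dist \<eta> x \<le> \<bar>s k\<bar> * (norm u + norm v) \<and>
        (H \<xi> *v v) \<bullet> u = (H \<eta> *v u) \<bullet> v" for k
    proof -
      obtain \<xi> where \<xi>: "dist \<xi> x \<le> \<bar>s k\<bar> * (norm u + norm v)"
        "f (x + s k *\<^sub>R u + s k *\<^sub>R v) - f (x + s k *\<^sub>R u) - f (x + s k *\<^sub>R v) + f x = (s k)\<^sup>2 * ((H \<xi> *v v) \<bullet> u)"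
        using C2_second_difference[OF C2 r(2) s(2)] by blast
      obtain \<eta> where \<eta>: "dist \<eta> x \<le> \<bar>s k\<bar> * (norm v + norm u)"
        "f (x + s k *\<^sub>R v + s k *\<^sub>R u) - f (x + s k *\<^sub>R v) - f (x + s k *\<^sub>R u) + f x = (s k)\<^sup>2 * ((H \<eta> *v u) \<bullet> v)"
        using C2_second_difference[OF C2 r(2) s(3)] by blast
      have "x + s k *\<^sub>R v + s k *\<^sub>R u = x + s k *\<^sub>R u + s k *\<^sub>R v" by (simp add: add_ac)
      then have "f (x + s k *\<^sub>R v + s k *\<^sub>R u) = f (x + s k *\<^sub>R u + s k *\<^sub>R v)" by (rule arg_cong)
      with \<eta>(2) \<xi>(2) have "(s k)\<^sup>2 * ((H \<xi> *v v) \<bullet> u) = (s k)\<^sup>2 * ((H \<eta> *v u) \<bullet> v)" by linarith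
      then have "(H \<xi> *v v) \<bullet> u = (H \<eta> *v u) \<bullet> v" using s(1)[of k] by simp
      then show ?thesis using \<xi>(1) \<eta>(1) by (auto simp: add.commute)
    qed
    then obtain \<xi> \<eta> where *: "\<And>k. dist (\<xi> k) x \<le> \<bar>s k\<bar> * (norm u + norm v)"
      "\<And>k. dist (\<eta> k) x \<le> \<bar>s k\<bar> * (norm u + norm v)" "\<And>k. (H (\<xi> k) *v v) \<bullet> u = (H (\<eta> k) *v u) \<bullet> v"
      by metis
    have "(\<lambda>k. r / N * inverse (real (k + 2))) \<longlonglongrightarrow> r / N * 0"
      by (intro tendsto_mult_left LIMSEQ_ignore_initial_segment lim_inverse_n)
    then have "s \<longlonglongrightarrow> 0" by (simp add: s_def[abs_def] field_simps)
    then have s0: "(\<lambda>k. \<bar>s k\<bar> * (norm u + norm v)) \<longlonglongrightarrow> 0"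
      by (intro tendsto_mult_left_zero tendsto_rabs_zero)
    have lim: "\<zeta> \<longlonglongrightarrow> x" if "\<And>k. dist (\<zeta> k) x \<le> \<bar>s k\<bar> * (norm u + norm v)" for \<zeta>
      unfolding tendsto_dist_iff[of \<zeta>] by (rule real_tendsto_sandwich[OF _ _ tendsto_const s0]) (auto simp: that)
    have H: "(\<lambda>k. (H (\<zeta> k) *v p) \<bullet> q) \<longlonglongrightarrow> (H x *v p) \<bullet> q" if "\<zeta> \<longlonglongrightarrow> x" for \<zeta> p q
      using isCont_tendsto_compose[OF \<open>isCont H x\<close> that]
      by (auto simp: matrix_vector_mult_def inner_vec_def intro!: tendsto_intros)
    show ?thesis using H[OF lim[OF *(1)], of v u] H[OF lim[OF *(2)], of u v] *(3)
      by (simp add: LIMSEQ_unique)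
  qed
  from this[of "axis i 1" "axis j 1" for i j] show ?thesis
    by (simp add: vec_eq_iff transpose_def matrix_vector_mult_basis inner_axis column_def)
qed

text \<open>On a line through the minimum the first derivative vanishes; were the second negative,
  the first would be negative just to the right and f would drop below its minimum.\<close>

lemma C2_local_min_hessian_nonneg:
  fixes H :: "real^'n \<Rightarrow> real^'n^'n"
  assumes C2: "C2_with_hessian U f g H" and "x \<in> U" and min: "\<And>y. y \<in> U \<Longrightarrow> f x \<le> f y"
  shows "0 \<le> d \<bullet> (H x *v d)"
proof (rule ccontr)
  assume neg: "\<not> ?thesis"
  then have "d \<noteq> 0" by auto
  have "open U" using C2 by (auto simp: C2_with_hessian_def)
  then obtain r where r: "r > 0" "ball x r \<subseteq> U" using \<open>x \<in> U\<close> openE by blast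
  define \<epsilon> where "\<epsilon> = r / norm d"
  have \<epsilon>: "\<epsilon> > 0" using r \<open>d \<noteq> 0\<close> by (simp add: \<epsilon>_def)
  have inU: "x + t *\<^sub>R d \<in> U" if "\<bar>t\<bar> < \<epsilon>" for t
  proof -
    have "x + t *\<^sub>R d \<in> ball x r" using that \<open>d \<noteq> 0\<close> by (simp add: dist_norm \<epsilon>_def less_divide_eq)
    then show ?thesis using r by blast
  qed
  have line: "((\<lambda>t. x + t *\<^sub>R d) has_derivative (\<lambda>h. h *\<^sub>R d)) (at t)" for t
    by (auto intro!: derivative_eq_intros)
  have f: "((\<lambda>t. f (x + t *\<^sub>R d)) has_real_derivative g (x + t *\<^sub>R d) \<bullet> d) (at t)" if "\<bar>t\<bar> < \<epsilon>" for t
  proof -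
    have "(f has_derivative (\<lambda>h. g (x + t *\<^sub>R d) \<bullet> h)) (at (x + t *\<^sub>R d))"
      using C2 inU[OF that] by (auto simp: C2_with_hessian_def)
    from has_derivative_compose[OF line this] show ?thesis
      by (simp add: has_field_derivative_def mult_commute_abs)
  qed
  have g: "((\<lambda>t. g (x + t *\<^sub>R d) \<bullet> d) has_real_derivative d \<bullet> (H x *v d)) (at 0)"
  proof -
    have "(g has_derivative (\<lambda>h. H x *v h)) (at (x + 0 *\<^sub>R d))"
      using C2 \<open>x \<in> U\<close> by (auto simp: C2_with_hessian_def)
    from has_derivative_inner_left[OF has_derivative_compose[OF line this], of d] show ?thesis
      by (simp add: has_field_derivative_def matrix_vector_mult_scaleR mult_commute_abs inner_commute)
  qed
  have g0: "g (x + 0 *\<^sub>R d) \<bullet> d = 0"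
  proof (rule DERIV_local_min[OF f \<epsilon>])
    show "\<forall>t. \<bar>0 - t\<bar> < \<epsilon> \<longrightarrow> f (x + 0 *\<^sub>R d) \<le> f (x + t *\<^sub>R d)" using inU min by simp
  qed (use \<epsilon> in auto)
  obtain \<delta> where \<delta>: "\<delta> > 0" "\<And>h. 0 < h \<Longrightarrow> h < \<delta> \<Longrightarrow> g (x + h *\<^sub>R d) \<bullet> d < 0"
    using DERIV_neg_dec_right[OF g] neg g0 by auto
  define t where "t = min \<delta> \<epsilon> / 2"
  have t: "0 < t" "t < \<delta>" "t < \<epsilon>" using \<delta>(1) \<epsilon> by (auto simp: t_def)
  have "f (x + t *\<^sub>R d) < f (x + 0 *\<^sub>R d)"
  proof (rule DERIV_neg_imp_decreasing_open[OF t(1)])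
    fix y assume "0 < y" "y < t"
    then show "\<exists>D. ((\<lambda>t. f (x + t *\<^sub>R d)) has_real_derivative D) (at y) \<and> D < 0"
      using f[of y] \<delta>(2)[of y] t by (intro exI[of _ "g (x + y *\<^sub>R d) \<bullet> d"]) auto
  next
    show "continuous_on {0..t} (\<lambda>t. f (x + t *\<^sub>R d))"
      using t by (intro continuous_at_imp_continuous_on ballI DERIV_isCont[OF f]) auto
  qed
  then show False using min[OF inU[of t]] t by simp
qed

lemma C2_with_hessian_diff:
  assumes "C2_with_hessian U f g H" "C2_with_hessian V f' g' H'"
  shows "C2_with_hessian (U \<inter> V) (\<lambda>x. f x - f' x) (\<lambda>x. g x - g' x) (\<lambda>x. H x - H' x)"
  using assms unfolding C2_with_hessian_def
  by (auto intro!: derivative_eq_intros continuous_intros simp: inner_diff_left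
      matrix_vector_mult_diff_rdistrib elim: continuous_on_subset)

lemma C2_with_hessian_subset:
  "C2_with_hessian U f g H \<Longrightarrow> open V \<Longrightarrow> V \<subseteq> U \<Longrightarrow> C2_with_hessian V f g H"
  unfolding C2_with_hessian_def by (meson continuous_on_subset subsetD)

text \<open>One formula for both uses: with x0 = 0 and the rows of the inverse shear it
  differentiates the transformed eigenfunction, with multiples of the coordinate axes a homothetic
  copy centred at x0.\<close>

lemma C2_with_hessian_ridge_sum:
  fixes n :: "'n \<Rightarrow> real^'n"
  assumes F: "\<And>t. (F has_real_derivative F1 t) (at t)" "\<And>t. (F1 has_real_derivative F2 t) (at t)"
    and F2: "continuous_on UNIV F2"
  shows "C2_with_hessian UNIV (\<lambda>x. \<Sum>k\<in>UNIV. c k * F (n k \<bullet> (x - x0)))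
    (\<lambda>x. \<Sum>k\<in>UNIV. (c k * F1 (n k \<bullet> (x - x0))) *\<^sub>R n k)
    (\<lambda>x. \<chi> i j. \<Sum>k\<in>UNIV. c k * F2 (n k \<bullet> (x - x0)) * (n k $ i * n k $ j))"
proof -
  have lin: "((\<lambda>x. n k \<bullet> (x - x0)) has_derivative (\<lambda>h. n k \<bullet> h)) (at x)" for k x
    by (auto intro!: derivative_eq_intros)
  have D: "((\<lambda>x. G (n k \<bullet> (x - x0))) has_derivative (\<lambda>h. G' (n k \<bullet> (x - x0)) * (n k \<bullet> h))) (at x)"
    if "\<And>t. (G has_real_derivative G' t) (at t)" for G G' k x
    using has_derivative_compose[OF lin that[unfolded has_field_derivative_def]] by simp
  have "((\<lambda>x. \<Sum>k\<in>UNIV. c k * F (n k \<bullet> (x - x0))) has_derivative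
      (\<lambda>h. (\<Sum>k\<in>UNIV. (c k * F1 (n k \<bullet> (x - x0))) *\<^sub>R n k) \<bullet> h)) (at x)" for x
    by (auto intro!: derivative_eq_intros D[OF F(1)] simp: inner_sum_left mult_ac)
  moreover have "((\<lambda>x. \<Sum>k\<in>UNIV. (c k * F1 (n k \<bullet> (x - x0))) *\<^sub>R n k) has_derivative
      (\<lambda>h. (\<chi> i j. \<Sum>k\<in>UNIV. c k * F2 (n k \<bullet> (x - x0)) * (n k $ i * n k $ j)) *v h)) (at x)" for x
  proof -
    have "(\<chi> i j. \<Sum>k\<in>UNIV. c k * F2 (n k \<bullet> (x - x0)) * (n k $ i * n k $ j)) *v h
        = (\<Sum>k\<in>UNIV. (c k * (F2 (n k \<bullet> (x - x0)) * (n k \<bullet> h))) *\<^sub>R n k)" for h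
      unfolding vec_eq_iff
      by (simp add: matrix_vector_mult_def inner_vec_def sum_distrib_left sum_distrib_right)
        (subst sum.swap, simp add: mult_ac)
    then show ?thesis by (auto intro!: derivative_eq_intros D[OF F(2)])
  qed
  moreover have "continuous_on UNIV (\<lambda>x. \<chi> i j. \<Sum>k\<in>UNIV. c k * F2 (n k \<bullet> (x - x0)) * (n k $ i * n k $ j))"
    by (intro continuous_on_vec_lambda continuous_intros continuous_on_compose2[OF F2]) auto
  ultimately show ?thesis by (simp add: C2_with_hessian_def)
qed

text \<open>The ridge sum is itself C^2, so at a touching point the Hessian of the test function
  lies below that of the ridge sum, which is a combination of rank-one forms;
  \<open>pucci_sup_le_rank_one_sum\<close> then applies.\<close>

lemma ridge_sum_supersolution:
  fixes n :: "'n \<Rightarrow> real^'n"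
  assumes F: "\<And>t. (F has_real_derivative F1 t) (at t)" "\<And>t. (F1 has_real_derivative F2 t) (at t)"
    and F2: "continuous_on UNIV F2" and lam: "0 \<le> lam" "lam \<le> Lam"
    and ineq: "\<And>x. x \<in> \<Omega> \<Longrightarrow>
      (\<Sum>k\<in>UNIV. (n k \<bullet> n k) * pucci_weight lam Lam (c k * F2 (n k \<bullet> x)))
       + \<mu> * (\<Sum>k\<in>UNIV. c k * F (n k \<bullet> x)) \<le> 0"
  shows "pucci_supersolution lam Lam \<mu> \<Omega> (\<lambda>x. \<Sum>k\<in>UNIV. c k * F (n k \<bullet> x))"
  unfolding pucci_supersolution_def
proof (intro allI ballI impI; elim conjE)
  fix U \<psi> g H x0
  assume x0: "x0 \<in> U" "U \<subseteq> \<Omega>" and C2: "C2_with_hessian U \<psi> g H"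
    and min: "\<forall>x\<in>U. (\<Sum>k\<in>UNIV. c k * F (n k \<bullet> x0)) - \<psi> x0 \<le> (\<Sum>k\<in>UNIV. c k * F (n k \<bullet> x)) - \<psi> x"
  let ?D = "\<lambda>x. \<chi> i j. \<Sum>k\<in>UNIV. c k * F2 (n k \<bullet> x) * (n k $ i * n k $ j)"
  note C2' = C2_with_hessian_diff[OF C2_with_hessian_ridge_sum[OF F F2, of c n 0] C2]
  have "pucci_sup lam Lam (H x0) \<le> (\<Sum>k\<in>UNIV. (n k \<bullet> n k) * pucci_weight lam Lam (c k * F2 (n k \<bullet> x0)))"
  proof (rule pucci_sup_le_rank_one_sum[OF lam C2_hessian_symmetric[OF C2 x0(1)]])
    fix x
    have "0 \<le> x \<bullet> ((?D x0 - H x0) *v x)"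
      using C2_local_min_hessian_nonneg[OF C2', of x0 x] x0(1) min by simp
    then have "x \<bullet> (H x0 *v x) \<le> x \<bullet> (?D x0 *v x)"
      by (simp add: matrix_vector_mult_diff_rdistrib inner_diff_right)
    also have "\<dots> = (\<Sum>i\<in>UNIV. \<Sum>j\<in>UNIV. \<Sum>k\<in>UNIV. c k * F2 (n k \<bullet> x0) * ((n k $ i * x $ i) * (n k $ j * x $ j)))"
      by (simp add: inner_vec_def matrix_vector_mult_def sum_distrib_left sum_distrib_right mult_ac)
    also have "\<dots> = (\<Sum>k\<in>UNIV. \<Sum>i\<in>UNIV. \<Sum>j\<in>UNIV. c k * F2 (n k \<bullet> x0) * ((n k $ i * x $ i) * (n k $ j * x $ j)))"
      by (subst sum.swap[of _ UNIV UNIV, symmetric], subst (2) sum.swap, rule refl)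
    also have "\<dots> = (\<Sum>k\<in>UNIV. c k * F2 (n k \<bullet> x0) * (n k \<bullet> x)\<^sup>2)"
    proof -
      have "(n k \<bullet> x)\<^sup>2 = (\<Sum>i\<in>UNIV. \<Sum>j\<in>UNIV. (n k $ i * x $ i) * (n k $ j * x $ j))" for k
        by (simp add: inner_vec_def power2_eq_square sum_product)
      then show ?thesis by (simp add: sum_distrib_left)
    qed
    finally show "x \<bullet> (H x0 *v x) \<le> (\<Sum>k\<in>UNIV. c k * F2 (n k \<bullet> x0) * (n k \<bullet> x)\<^sup>2)" .
  qed simp
  then show "pucci_sup lam Lam (H x0) + \<mu> * (\<Sum>k\<in>UNIV. c k * F (n k \<bullet> x0)) \<le> 0"
    using ineq[of x0] x0 by auto
qed

section \<open>The explicit profile and the domains\<close>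

text \<open>At the joint the two one-sided difference quotients have the same limit. Nested use
  covers both joints of \<open>profile\<close> and of \<open>profile'\<close>.\<close>

lemma has_real_derivative_glue:
  assumes f: "\<And>x. (f has_real_derivative f' x) (at x)" and g: "\<And>x. (g has_real_derivative g' x) (at x)"
    and eq: "f c = g c" "f' c = g' c"
  shows "((\<lambda>x. if x \<le> c then f x else g x) has_real_derivative (if x \<le> c then f' x else g' x)) (at (x::real))"
    (is "(?h has_real_derivative _) _")
proof -
  consider "x < c" | "x > c" | "x = c" by linarith
  then show ?thesis
  proof cases
    case 1
    have "(?h has_real_derivative f' x) (at x)"
      by (rule has_field_derivative_transform_within_open[OF f, of "{..<c}"]) (use 1 in auto)
    then show ?thesis using 1 by simp
  next
    case 2
    have "(?h has_real_derivative g' x) (at x)"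
      by (rule has_field_derivative_transform_within_open[OF g, of "{c<..}"]) (use 2 in auto)
    then show ?thesis using 2 by simp
  next
    case 3
    have "(?h has_real_derivative f' c) (at c)"
      unfolding has_field_derivative_iff
    proof (rule filterlim_split_at)
      have "((\<lambda>y. (f y - f c) / (y - c)) \<longlongrightarrow> f' c) (at_left c)"
        using f[of c] by (simp add: has_field_derivative_iff filterlim_at_split)
      then show "((\<lambda>y. (?h y - ?h c) / (y - c)) \<longlongrightarrow> f' c) (at_left c)"
        by (rule Lim_transform_eventually) (auto simp: eventually_at_filter)
      have "((\<lambda>y. (g y - g c) / (y - c)) \<longlongrightarrow> f' c) (at_right c)"
        using g[of c] eq by (simp add: has_field_derivative_iff filterlim_at_split)
      then show "((\<lambda>y. (?h y - ?h c) / (y - c)) \<longlongrightarrow> f' c) (at_right c)"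
        by (rule Lim_transform_eventually) (auto simp: eventually_at_filter eq)
    qed
    then show ?thesis using 3 by simp
  qed
qed

section \<open>The one-dimensional profile\<close>

text \<open>The nested tests with \<open>\<le>\<close> give exactly the shape of the gluing rule, at
  \<open>pi/2\<close> and at \<open>- (pi/2)\<close>.\<close>

definition profile :: "real \<Rightarrow> real \<Rightarrow> real" where
  "profile \<omega> t = (if t \<le> pi/2 then if t \<le> - (pi/2) then - sqrt \<omega> * sin ((- t - pi/2) / sqrt \<omega>) else cos t
     else - sqrt \<omega> * sin ((t - pi/2) / sqrt \<omega>))"

definition profile' :: "real \<Rightarrow> real \<Rightarrow> real" where
  "profile' \<omega> t = (if t \<le> pi/2 then if t \<le> - (pi/2) then cos ((- t - pi/2) / sqrt \<omega>) else - sin t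
     else - cos ((t - pi/2) / sqrt \<omega>))"

definition profile'' :: "real \<Rightarrow> real \<Rightarrow> real" where
  "profile'' \<omega> t = (if t \<le> pi/2 then if t \<le> - (pi/2) then sin ((- t - pi/2) / sqrt \<omega>) / sqrt \<omega> else - cos t
     else sin ((t - pi/2) / sqrt \<omega>) / sqrt \<omega>)"

text \<open>The point where the outer sine reaches 1 and the profile its minimum
  \<open>- sqrt \<omega>\<close>. Beyond it the sine turns back and the weighted sum would become
  positive again, so the domain is the positivity set inside this box only.\<close>

definition profile_end :: "real \<Rightarrow> real" where
  "profile_end \<omega> = pi/2 + sqrt \<omega> * (pi/2)"

lemma pi_not_le_0: "pi \<le> 0 \<longleftrightarrow> False"
  by (simp add: not_le)

lemma DERIV_profile:
  assumes "\<omega> > 0"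
  shows "(profile \<omega> has_real_derivative profile' \<omega> t) (at t)"
proof -
  define r where "r = sqrt \<omega>"
  have "r > 0" using assms by (simp add: r_def)
  then show ?thesis unfolding profile_def[abs_def] profile'_def r_def[symmetric]
    by (intro has_real_derivative_glue) (auto intro!: derivative_eq_intros simp: pi_not_le_0)
qed

lemma DERIV_profile':
  assumes "\<omega> > 0"
  shows "(profile' \<omega> has_real_derivative profile'' \<omega> t) (at t)"
proof -
  define r where "r = sqrt \<omega>"
  have "r > 0" using assms by (simp add: r_def)
  then show ?thesis unfolding profile'_def[abs_def] profile''_def r_def[symmetric]
    by (intro has_real_derivative_glue) (auto intro!: derivative_eq_intros simp: pi_not_le_0)
qed

lemma continuous_on_profile'':
  assumes "\<omega> > 0"
  shows "continuous_on UNIV (profile'' \<omega>)"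
proof -
  have glue: "continuous_on UNIV (\<lambda>t. if t \<le> c then f t else g t)"
    if "continuous_on UNIV f" "continuous_on UNIV g" "f c = g c" for f g :: "real \<Rightarrow> real" and c
    using that by (intro continuous_on_cases_le) (auto intro: continuous_on_subset)
  show ?thesis unfolding profile''_def[abs_def]
    using assms by (intro glue continuous_intros) (auto simp: pi_not_le_0)
qed

lemma continuous_on_profile: "\<omega> > 0 \<Longrightarrow> continuous_on S (profile \<omega>)"
  by (meson DERIV_profile DERIV_isCont continuous_at_imp_continuous_on)

lemma profile_inner:
  assumes "\<bar>t\<bar> \<le> pi/2"
  shows "profile \<omega> t = cos t"
proof (cases "t = - (pi/2)")
  case False
  then have "t \<le> pi/2" "\<not> t \<le> - (pi/2)" using assms by linarith+
  then show ?thesis unfolding profile_def by simp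
qed (simp add: profile_def pi_not_le_0)

lemma profile_outer: "pi/2 \<le> t \<Longrightarrow> profile \<omega> t = - sqrt \<omega> * sin ((t - pi/2) / sqrt \<omega>)"
proof (cases "t = pi/2")
  case True
  have "profile \<omega> (pi/2) = 0" by (subst profile_inner) simp_all
  then show ?thesis unfolding True by simp
next
  case False
  assume "pi/2 \<le> t"
  with False have "\<not> t \<le> pi/2" by linarith
  then show ?thesis unfolding profile_def by simp
qed

lemma profile_minus: "profile \<omega> (- t) = profile \<omega> t"
proof -
  have "profile \<omega> (- t) = profile \<omega> t" if "t > pi/2" for t
  proof -
    have "- t \<le> - (pi/2)" "- t \<le> pi/2" using that pi_gt_zero by linarith+
    then show ?thesis using that unfolding profile_def by simp
  qed
  from this[of t] this[of "- t"] show ?thesis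
    by (cases "\<bar>t\<bar> \<le> pi/2") (simp add: profile_inner, metis abs_if minus_minus not_le)
qed

lemma profile_abs: "profile \<omega> \<bar>t\<bar> = profile \<omega> t"
  by (simp add: abs_if profile_minus)

lemma profile_zero: "profile \<omega> 0 = 1"
  by (simp add: profile_inner)

lemma profile_strict_decreasing:
  assumes "\<omega> > 0" "0 \<le> s" "s < t" "t \<le> profile_end \<omega>"
  shows "profile \<omega> t < profile \<omega> s"
proof (rule DERIV_neg_imp_decreasing_open[OF assms(3)])
  fix x assume x: "s < x" "x < t"
  have "profile' \<omega> x < 0"
  proof (cases "x \<le> pi/2")
    case True
    then have "sin x > 0" using x assms(2) by (intro sin_gt_zero) auto
    then show ?thesis using True x assms(2) by (simp add: profile'_def)
  next
    case False
    have "(x - pi/2) / sqrt \<omega> < pi/2"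
      using x assms by (simp add: profile_end_def divide_less_eq mult.commute)
    then have "cos ((x - pi/2) / sqrt \<omega>) > 0"
      using False assms(1) by (intro cos_gt_zero_pi) (auto simp: less_le_trans[of _ 0])
    then show ?thesis using False by (simp add: profile'_def)
  qed
  then show "\<exists>y. (profile \<omega> has_real_derivative y) (at x) \<and> y < 0"
    using DERIV_profile[OF assms(1)] by blast
qed (rule continuous_on_profile[OF assms(1)])

lemma profile_decreasing:
  assumes "\<omega> > 0" "\<bar>s\<bar> \<le> \<bar>t\<bar>" "\<bar>t\<bar> \<le> profile_end \<omega>"
  shows "profile \<omega> t \<le> profile \<omega> s"
proof (cases "\<bar>s\<bar> = \<bar>t\<bar>")
  case True
  then show ?thesis by (metis order_refl profile_abs)
next
  case False
  then show ?thesis using profile_strict_decreasing[of \<omega> "\<bar>s\<bar>" "\<bar>t\<bar>"] assms by (simp add: profile_abs)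
qed

lemma profile_le_1:
  assumes "\<omega> > 0" "\<bar>t\<bar> \<le> profile_end \<omega>"
  shows "profile \<omega> t \<le> 1"
  using profile_decreasing[of \<omega> 0 t] assms by (simp add: profile_zero)

lemma profile_at_end:
  assumes "\<omega> > 0" shows "profile \<omega> (profile_end \<omega>) = - sqrt \<omega>"
  using assms by (simp add: profile_end_def profile_outer)

text \<open>On the inner branch F'' = -F \<le> 0 is weighted with lam; on the outer branch F'' = -F
  / \<omega> \<ge> 0 is weighted with Lam = \<omega> lam. Both products equal - lam F.\<close>

lemma pucci_weight_profile:
  assumes "\<omega> > 0" "Lam = \<omega> * lam" "c > 0" "\<bar>t\<bar> \<le> profile_end \<omega>"
  shows "pucci_weight lam Lam (c * profile'' \<omega> t) = - lam * c * profile \<omega> t"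
proof (cases "\<bar>t\<bar> \<le> pi/2")
  case True
  then have "profile'' \<omega> t = - cos t"
    by (cases "t = - (pi/2)") (auto simp: profile''_def)
  moreover have "c * cos t \<ge> 0" using True assms(3) by (intro mult_nonneg_nonneg cos_ge_zero) auto
  ultimately show ?thesis using True
    by (simp add: pucci_weight_def profile_inner not_less)
next
  case False
  define s where "s = sin ((\<bar>t\<bar> - pi/2) / sqrt \<omega>)"
  have F: "profile'' \<omega> t = s / sqrt \<omega>" "profile \<omega> t = - sqrt \<omega> * s"
  proof -
    show "profile \<omega> t = - sqrt \<omega> * s"
      using False profile_outer[of "\<bar>t\<bar>" \<omega>] by (simp add: s_def profile_abs)
    have "t \<le> - (pi/2) \<and> t \<le> pi/2 \<and> \<bar>t\<bar> = - t \<or> \<not> t \<le> pi/2 \<and> \<bar>t\<bar> = t"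
      using False pi_gt_zero by linarith
    then show "profile'' \<omega> t = s / sqrt \<omega>" by (auto simp: s_def profile''_def)
  qed
  have "(\<bar>t\<bar> - pi/2) / sqrt \<omega> \<le> pi/2"
    using assms by (simp add: profile_end_def divide_le_eq mult.commute)
  moreover have "0 \<le> (\<bar>t\<bar> - pi/2) / sqrt \<omega>" using False assms(1) by simp
  ultimately have "s \<ge> 0" unfolding s_def using pi_gt_zero by (intro sin_ge_zero) linarith+
  have "\<omega> / sqrt \<omega> = sqrt \<omega>" using assms(1) by (simp add: real_div_sqrt)
  then have "\<omega> * lam * (c * (s / sqrt \<omega>)) = lam * c * (sqrt \<omega> * s)"
    by (metis (no_types, opaque_lifting) mult.assoc mult.commute times_divide_eq_left)
  moreover have "c * (s / sqrt \<omega>) > 0 \<or> s = 0" using \<open>s \<ge> 0\<close> assms by (auto simp: less_le)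
  ultimately show ?thesis unfolding F pucci_weight_def by (auto simp: assms(2))
qed

section \<open>The domain as a positivity set\<close>

definition profile_sum :: "real \<Rightarrow> real \<Rightarrow> real^3 \<Rightarrow> real" where
  "profile_sum \<omega> \<gamma> p = \<gamma> * profile \<omega> (p $ 1) + \<gamma> * profile \<omega> (p $ 2) + profile \<omega> (p $ 3)"

definition closed_domain :: "real \<Rightarrow> real \<Rightarrow> (real^3) set" where
  "closed_domain \<omega> \<gamma> = {p. (\<forall>i. \<bar>p $ i\<bar> \<le> profile_end \<omega>) \<and> 0 \<le> profile_sum \<omega> \<gamma> p}"

lemma mem_vector_3_Collect: "p \<in> {vector [x, y, z] :: real^3 | x y z. P x y z} \<longleftrightarrow> P (p $ 1) (p $ 2) (p $ 3)"
proof -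
  have "p = vector [p $ 1, p $ 2, p $ 3]" by (simp add: vec_eq_iff forall_3)
  then show ?thesis by (smt (verit) mem_Collect_eq vector_3)
qed

text \<open>Inverts the outer branch, so that each arcsine bound in the pieces becomes a linear
  inequality between profile values.\<close>

lemma le_arcsin_scaled_iff:
  assumes "\<omega> > 0" "pi/2 \<le> t" "t \<le> profile_end \<omega>" "0 \<le> q" "q \<le> 1"
  shows "t \<le> pi/2 + sqrt \<omega> * arcsin q \<longleftrightarrow> - profile \<omega> t \<le> sqrt \<omega> * q"
proof -
  have "(t - pi/2) / sqrt \<omega> \<le> pi/2"
    using assms by (simp add: profile_end_def divide_le_eq mult.commute)
  moreover have "0 \<le> (t - pi/2) / sqrt \<omega>" using assms by simp
  then have "- (pi/2) \<le> (t - pi/2) / sqrt \<omega>" using pi_half_ge_zero by linarith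
  ultimately have "(t - pi/2) / sqrt \<omega> \<le> arcsin q \<longleftrightarrow> sin ((t - pi/2) / sqrt \<omega>) \<le> q"
    using assms by (intro le_arcsin_iff) auto
  moreover have "t \<le> pi/2 + sqrt \<omega> * arcsin q \<longleftrightarrow> (t - pi/2) / sqrt \<omega> \<le> arcsin q"
    using assms(1) by (simp add: divide_le_eq mult.commute algebra_simps)
  ultimately show ?thesis using assms(1,2) by (simp add: profile_outer)
qed

lemma arcsin_scaled_le_end: "\<omega> > 0 \<Longrightarrow> 0 \<le> q \<Longrightarrow> q \<le> 1 \<Longrightarrow> t \<le> pi/2 + sqrt \<omega> * arcsin q \<Longrightarrow> t \<le> profile_end \<omega>"
  using arcsin_ubound[of q] unfolding profile_end_def
  by (smt (verit) mult_left_mono real_sqrt_gt_zero)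

text \<open>These bounds say that \<gamma>, 1/\<gamma> and 1 are at most
  \<open>sqrt \<omega> / 2\<close>; hence a combination of two numbers from [0, 1] with any two of
  these weights stays within [0, \<open>sqrt \<omega>\<close>], the range of the outer
  branch.\<close>

locale gamma_range =
  fixes \<omega> \<gamma> :: real
  assumes \<omega>: "\<omega> \<ge> 4" and \<gamma>: "2 / sqrt \<omega> \<le> \<gamma>" "\<gamma> \<le> sqrt \<omega> / 2"
begin

lemma sqrt_\<omega>: "sqrt \<omega> \<ge> 2" using \<omega> real_le_rsqrt[of 2 \<omega>] by simp

lemma sqrt_\<omega>_pos: "sqrt \<omega> > 0" using sqrt_\<omega> by linarith

lemma \<gamma>_pos: "\<gamma> > 0" using \<gamma>(1) sqrt_\<omega> by (smt (verit) divide_pos_pos)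

lemma \<gamma>_bounds: "\<gamma> / sqrt \<omega> \<le> 1/2" "1 / (\<gamma> * sqrt \<omega>) \<le> 1/2" "0 \<le> \<gamma> / sqrt \<omega>" "0 \<le> 1 / (\<gamma> * sqrt \<omega>)"
  "1 / sqrt \<omega> \<le> 1/2" "0 \<le> 1 / sqrt \<omega>"
proof -
  note r = sqrt_\<omega>_pos
  have "2 \<le> \<gamma> * sqrt \<omega>" using \<gamma>(1) r by (simp add: pos_divide_le_eq)
  then show "1 / (\<gamma> * sqrt \<omega>) \<le> 1/2" "0 \<le> 1 / (\<gamma> * sqrt \<omega>)" by (simp_all add: divide_le_eq)
  show "\<gamma> / sqrt \<omega> \<le> 1/2" "0 \<le> \<gamma> / sqrt \<omega>" "1 / sqrt \<omega> \<le> 1/2" "0 \<le> 1 / sqrt \<omega>"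
    using \<gamma> r sqrt_\<omega> \<gamma>_pos by (simp_all add: pos_divide_le_eq)
qed

lemma outer_bounds:
  assumes "pi/2 \<le> t" "t \<le> profile_end \<omega>"
  shows "profile \<omega> t \<le> 0" "profile \<omega> t = 0 \<Longrightarrow> t = pi/2"
proof -
  have 0: "profile \<omega> (pi/2) = 0" by (subst profile_inner) simp_all
  have "t = pi/2 \<or> profile \<omega> t < 0"
    using profile_strict_decreasing[of \<omega> "pi/2" t] assms \<omega> pi_half_ge_zero unfolding 0 by linarith
  then show "profile \<omega> t \<le> 0" "profile \<omega> t = 0 \<Longrightarrow> t = pi/2" using 0 by (metis order.order_iff_strict, metis less_irrefl)
qed

lemma inner_bounds:
  assumes "0 \<le> t" "t \<le> pi/2"
  shows "0 \<le> profile \<omega> t" "profile \<omega> t \<le> 1" "profile \<omega> t = cos t" "t \<le> profile_end \<omega>"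
proof -
  show "profile \<omega> t = cos t" using assms by (simp add: profile_inner)
  then show "0 \<le> profile \<omega> t" "profile \<omega> t \<le> 1" using assms cos_ge_zero by auto
  show "t \<le> profile_end \<omega>" using assms sqrt_\<omega> unfolding profile_end_def
    by (smt (verit) mult_nonneg_nonneg pi_half_ge_zero)
qed

abbreviation "F \<equiv> profile \<omega>"

lemma \<omega>_pos: "\<omega> > 0" using \<omega> by simp

lemma piece_C_iff: "p \<in> piece_C \<longleftrightarrow> (\<forall>i. 0 \<le> p $ i \<and> p $ i \<le> pi/2)"
  unfolding piece_C_def mem_vector_3_Collect by (auto simp: forall_3)

lemma slab_iff:
  assumes "0 \<le> q" "q \<le> 1"
  shows "pi/2 \<le> t \<and> t \<le> pi/2 + sqrt \<omega> * arcsin q \<longleftrightarrow> pi/2 \<le> t \<and> t \<le> profile_end \<omega> \<and> 0 \<le> sqrt \<omega> * q + F t"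
  using le_arcsin_scaled_iff[OF \<omega>_pos _ _ assms, of t] arcsin_scaled_le_end[OF \<omega>_pos assms, of t] by auto

lemma piece_Z_iff: "p \<in> piece_Z \<omega> \<gamma> \<longleftrightarrow> 0 \<le> p $ 1 \<and> p $ 1 \<le> pi/2 \<and> 0 \<le> p $ 2 \<and> p $ 2 \<le> pi/2 \<and>
    pi/2 \<le> p $ 3 \<and> p $ 3 \<le> profile_end \<omega> \<and> 0 \<le> profile_sum \<omega> \<gamma> p"
proof (cases "0 \<le> p $ 1 \<and> p $ 1 \<le> pi/2 \<and> 0 \<le> p $ 2 \<and> p $ 2 \<le> pi/2")
  case True
  note b = inner_bounds[of "p $ 1"] inner_bounds[of "p $ 2"]
  let ?q = "\<gamma> / sqrt \<omega> * (cos (p $ 1) + cos (p $ 2))"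
  have "0 \<le> ?q" using \<gamma>_bounds True b by (intro mult_nonneg_nonneg) auto
  moreover have "?q \<le> 1/2 * 2" using \<gamma>_bounds True b add_mono[OF cos_le_one cos_le_one, of "p $ 1" "p $ 2"] by (intro mult_mono) auto
  ultimately show ?thesis unfolding piece_Z_def mem_vector_3_Collect
    using slab_iff[of ?q "p $ 3"] True b \<omega>_pos by (simp add: profile_sum_def algebra_simps)
next
  case False
  then show ?thesis unfolding piece_Z_def mem_vector_3_Collect by auto
qed

lemma XY_arg:
  assumes "0 \<le> s" "s \<le> 1" "0 \<le> t" "t \<le> 1"
  shows "0 \<le> (\<gamma> * s + t) / (\<gamma> * sqrt \<omega>)" "(\<gamma> * s + t) / (\<gamma> * sqrt \<omega>) \<le> 1"
    "sqrt \<omega> * ((\<gamma> * s + t) / (\<gamma> * sqrt \<omega>)) = s + t / \<gamma>"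
proof -
  note r = sqrt_\<omega>_pos
  show "0 \<le> (\<gamma> * s + t) / (\<gamma> * sqrt \<omega>)"
    using assms \<gamma>_pos r by (intro divide_nonneg_pos add_nonneg_nonneg mult_nonneg_nonneg mult_pos_pos) auto
  have "(\<gamma> * s + t) / (\<gamma> * sqrt \<omega>) = s * (1 / sqrt \<omega>) + t * (1 / (\<gamma> * sqrt \<omega>))"
    using \<gamma>_pos r by (simp add: add_divide_distrib)
  also have "\<dots> \<le> 1 * (1/2) + 1 * (1/2)"
    using assms \<gamma>_bounds by (intro add_mono mult_mono) auto
  finally show "(\<gamma> * s + t) / (\<gamma> * sqrt \<omega>) \<le> 1" by simp
  show "sqrt \<omega> * ((\<gamma> * s + t) / (\<gamma> * sqrt \<omega>)) = s + t / \<gamma>"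
    using \<gamma>_pos r by (simp add: add_divide_distrib distrib_left)
qed

lemma piece_X_iff: "p \<in> piece_X \<omega> \<gamma> \<longleftrightarrow> 0 \<le> p $ 2 \<and> p $ 2 \<le> pi/2 \<and> 0 \<le> p $ 3 \<and> p $ 3 \<le> pi/2 \<and>
    pi/2 \<le> p $ 1 \<and> p $ 1 \<le> profile_end \<omega> \<and> 0 \<le> profile_sum \<omega> \<gamma> p"
proof (cases "0 \<le> p $ 2 \<and> p $ 2 \<le> pi/2 \<and> 0 \<le> p $ 3 \<and> p $ 3 \<le> pi/2")
  case True
  note b = inner_bounds[of "p $ 2"] inner_bounds[of "p $ 3"]
  note q = XY_arg[of "cos (p $ 2)" "cos (p $ 3)"]
  have "0 \<le> cos (p $ 2) + cos (p $ 3) / \<gamma> + F (p $ 1) \<longleftrightarrow> 0 \<le> \<gamma> * (cos (p $ 2) + cos (p $ 3) / \<gamma> + F (p $ 1))"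
    using \<gamma>_pos by (simp add: zero_le_mult_iff)
  also have "\<gamma> * (cos (p $ 2) + cos (p $ 3) / \<gamma> + F (p $ 1)) = profile_sum \<omega> \<gamma> p"
    using True b \<gamma>_pos by (simp add: profile_sum_def field_simps)
  finally show ?thesis unfolding piece_X_def mem_vector_3_Collect
    using slab_iff[OF q(1,2), of "p $ 1"] q(3) True b by simp
next
  case False
  then show ?thesis unfolding piece_X_def mem_vector_3_Collect by auto
qed

lemma piece_Y_iff: "p \<in> piece_Y \<omega> \<gamma> \<longleftrightarrow> 0 \<le> p $ 1 \<and> p $ 1 \<le> pi/2 \<and> 0 \<le> p $ 3 \<and> p $ 3 \<le> pi/2 \<and>
    pi/2 \<le> p $ 2 \<and> p $ 2 \<le> profile_end \<omega> \<and> 0 \<le> profile_sum \<omega> \<gamma> p"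
proof (cases "0 \<le> p $ 1 \<and> p $ 1 \<le> pi/2 \<and> 0 \<le> p $ 3 \<and> p $ 3 \<le> pi/2")
  case True
  note b = inner_bounds[of "p $ 1"] inner_bounds[of "p $ 3"]
  note q = XY_arg[of "cos (p $ 1)" "cos (p $ 3)"]
  have "0 \<le> cos (p $ 1) + cos (p $ 3) / \<gamma> + F (p $ 2) \<longleftrightarrow> 0 \<le> \<gamma> * (cos (p $ 1) + cos (p $ 3) / \<gamma> + F (p $ 2))"
    using \<gamma>_pos by (simp add: zero_le_mult_iff)
  also have "\<gamma> * (cos (p $ 1) + cos (p $ 3) / \<gamma> + F (p $ 2)) = profile_sum \<omega> \<gamma> p"
    using True b \<gamma>_pos by (simp add: profile_sum_def field_simps)
  finally show ?thesis unfolding piece_Y_def mem_vector_3_Collect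
    using slab_iff[OF q(1,2), of "p $ 2"] q(3) True b by simp
next
  case False
  then show ?thesis unfolding piece_Y_def mem_vector_3_Collect by auto
qed

text \<open>Common form of the three edge pieces, with the weight of the inner coordinate x
  normalised to 1. There \<theta> = - c F(s) - d F(t), and x \<le> arccos \<theta> means \<theta>
  \<le> cos x, that is, a nonnegative weighted sum.\<close>

lemma edge_iff:
  assumes c: "0 < c" "0 < d" "1 / (c * sqrt \<omega>) \<le> 1" "1 / (d * sqrt \<omega>) \<le> 1"
  shows "(pi/2 \<le> s \<and> s \<le> pi/2 + sqrt \<omega> * arcsin (1 / (c * sqrt \<omega>)) \<and>
      pi/2 \<le> t \<and> t \<le> pi/2 + sqrt \<omega> * arcsin (1 / (d * sqrt \<omega>)) \<and>
      (let \<theta> = c * sqrt \<omega> * sin ((s - pi/2) / sqrt \<omega>) + d * sqrt \<omega> * sin ((t - pi/2) / sqrt \<omega>)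
       in 0 \<le> \<theta> \<and> \<theta> \<le> 1 \<and> 0 \<le> x \<and> x \<le> arccos \<theta>)) \<longleftrightarrow>
    pi/2 \<le> s \<and> s \<le> profile_end \<omega> \<and> pi/2 \<le> t \<and> t \<le> profile_end \<omega> \<and> 0 \<le> x \<and> x \<le> pi/2 \<and>
      0 \<le> c * F s + d * F t + F x" (is "?L \<longleftrightarrow> ?R")
proof (cases "pi/2 \<le> s \<and> s \<le> profile_end \<omega> \<and> pi/2 \<le> t \<and> t \<le> profile_end \<omega>")
  case True
  define \<theta> where "\<theta> = - c * F s - d * F t"
  have \<theta>: "c * sqrt \<omega> * sin ((s - pi/2) / sqrt \<omega>) + d * sqrt \<omega> * sin ((t - pi/2) / sqrt \<omega>) = \<theta>"
    using True by (simp add: \<theta>_def profile_outer)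
  have F: "F s \<le> 0" "F t \<le> 0" using outer_bounds True by auto
  then have nn: "c * F s \<le> 0" "d * F t \<le> 0" using c by (auto simp: mult_nonneg_nonpos)
  then have "\<theta> \<ge> 0" by (simp add: \<theta>_def)
  \<comment> \<open>Both terms of \<theta> are nonnegative, so \<theta> \<le> 1 bounds - F s by 1/c
    and - F t by 1/d, and the arcsine bounds follow.\<close>
  have st: "\<theta> \<le> 1 \<Longrightarrow> s \<le> pi/2 + sqrt \<omega> * arcsin (1 / (c * sqrt \<omega>))"
    "\<theta> \<le> 1 \<Longrightarrow> t \<le> pi/2 + sqrt \<omega> * arcsin (1 / (d * sqrt \<omega>))"
  proof -
    note r = sqrt_\<omega>_pos
    have q: "0 \<le> 1 / (c * sqrt \<omega>)" "0 \<le> 1 / (d * sqrt \<omega>)"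
      "sqrt \<omega> * (1 / (c * sqrt \<omega>)) = 1 / c" "sqrt \<omega> * (1 / (d * sqrt \<omega>)) = 1 / d"
      using c r by auto
    assume "\<theta> \<le> 1"
    then have "- F s \<le> 1 / c" "- F t \<le> 1 / d"
      using nn c by (auto simp: \<theta>_def pos_le_divide_eq mult.commute)
    then show "s \<le> pi/2 + sqrt \<omega> * arcsin (1 / (c * sqrt \<omega>))" "t \<le> pi/2 + sqrt \<omega> * arcsin (1 / (d * sqrt \<omega>))"
      using le_arcsin_scaled_iff[OF \<omega>_pos, of s "1 / (c * sqrt \<omega>)"] le_arcsin_scaled_iff[OF \<omega>_pos, of t "1 / (d * sqrt \<omega>)"]
        True c q by metis+
  qed
  have "\<theta> \<le> 1 \<and> 0 \<le> x \<and> x \<le> arccos \<theta> \<longleftrightarrow> 0 \<le> x \<and> x \<le> pi/2 \<and> \<theta> \<le> F x"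
  proof (cases "\<theta> \<le> 1 \<and> 0 \<le> x")
    case T: True
    have "arccos \<theta> \<le> pi/2" using T \<open>\<theta> \<ge> 0\<close> by (intro arccos_le_pi2) auto
    moreover have "x \<le> arccos \<theta> \<longleftrightarrow> \<theta> \<le> cos x" if "x \<le> pi/2"
      using arccos_le_arccos[of \<theta> "cos x"] cos_monotone_0_pi_le[of x "arccos \<theta>"] that T \<open>\<theta> \<ge> 0\<close>
      by (auto simp: arccos_cos arccos_lbound arccos_ubound cos_arccos)
    ultimately show ?thesis using T inner_bounds(3)[of x] by auto
  next
    case False
    moreover have "cos x \<le> 1" by simp
    ultimately show ?thesis using inner_bounds(3)[of x] by (metis order_trans)
  qed
  then show ?thesis using True st \<open>\<theta> \<ge> 0\<close> unfolding \<theta> Let_def by (auto simp: \<theta>_def)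
next
  case False
  have "0 \<le> 1 / (c * sqrt \<omega>)" "0 \<le> 1 / (d * sqrt \<omega>)" using c sqrt_\<omega>_pos by simp_all
  then show ?thesis using False arcsin_scaled_le_end[OF \<omega>_pos _ c(3), of s]
      arcsin_scaled_le_end[OF \<omega>_pos _ c(4), of t] by blast
qed

lemma piece_XY_iff: "p \<in> piece_XY \<omega> \<gamma> \<longleftrightarrow> pi/2 \<le> p $ 1 \<and> p $ 1 \<le> profile_end \<omega> \<and>
    pi/2 \<le> p $ 2 \<and> p $ 2 \<le> profile_end \<omega> \<and> 0 \<le> p $ 3 \<and> p $ 3 \<le> pi/2 \<and> 0 \<le> profile_sum \<omega> \<gamma> p"
  unfolding piece_XY_def mem_vector_3_Collect profile_sum_def
  by (subst edge_iff) (use \<gamma>_pos \<gamma>_bounds in auto)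

lemma ZX_scale:
  "1 / (1 / \<gamma> * sqrt \<omega>) = \<gamma> / sqrt \<omega>" "1 / (sqrt \<omega> / \<gamma>) = \<gamma> / sqrt \<omega>" "1 / \<gamma> * sqrt \<omega> = sqrt \<omega> / \<gamma>" "1 * x = x"
  "0 \<le> F s + 1 / \<gamma> * F t + F x \<longleftrightarrow> 0 \<le> \<gamma> * F s + \<gamma> * F x + F t"
proof -
  have "\<gamma> * (F s + 1 / \<gamma> * F t + F x) = \<gamma> * F s + \<gamma> * F x + F t"
    using \<gamma>_pos by (simp add: field_simps)
  then show "0 \<le> F s + 1 / \<gamma> * F t + F x \<longleftrightarrow> 0 \<le> \<gamma> * F s + \<gamma> * F x + F t"
    using \<gamma>_pos zero_le_mult_iff[of \<gamma> "F s + 1 / \<gamma> * F t + F x"] by auto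
qed auto

text \<open>The case c = 1, d = 1/\<gamma> of \<open>edge_iff\<close>, multiplied by
  \<gamma>.\<close>

lemma edge_Z_iff:
  "(pi/2 \<le> s \<and> s \<le> pi/2 + sqrt \<omega> * arcsin (1 / sqrt \<omega>) \<and>
      pi/2 \<le> t \<and> t \<le> pi/2 + sqrt \<omega> * arcsin (\<gamma> / sqrt \<omega>) \<and>
      (let \<theta> = sqrt \<omega> * sin ((s - pi/2) / sqrt \<omega>) + sqrt \<omega> / \<gamma> * sin ((t - pi/2) / sqrt \<omega>)
       in 0 \<le> \<theta> \<and> \<theta> \<le> 1 \<and> 0 \<le> x \<and> x \<le> arccos \<theta>)) \<longleftrightarrow>
    pi/2 \<le> s \<and> s \<le> profile_end \<omega> \<and> pi/2 \<le> t \<and> t \<le> profile_end \<omega> \<and> 0 \<le> x \<and> x \<le> pi/2 \<and>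
      0 \<le> \<gamma> * F s + \<gamma> * F x + F t"
proof -
  have "1 / (1 * sqrt \<omega>) \<le> 1" unfolding ZX_scale using \<gamma>_bounds(5) by linarith
  moreover have "1 / (1 / \<gamma> * sqrt \<omega>) \<le> 1" unfolding ZX_scale(1) using \<gamma>_bounds(1) by linarith
  moreover have "0 < 1 / \<gamma>" using \<gamma>_pos by simp
  ultimately show ?thesis using edge_iff[OF zero_less_one, of "1 / \<gamma>" s t x] unfolding ZX_scale by blast
qed

lemma piece_ZX_iff: "p \<in> piece_ZX \<omega> \<gamma> \<longleftrightarrow> pi/2 \<le> p $ 1 \<and> p $ 1 \<le> profile_end \<omega> \<and>
    pi/2 \<le> p $ 3 \<and> p $ 3 \<le> profile_end \<omega> \<and> 0 \<le> p $ 2 \<and> p $ 2 \<le> pi/2 \<and> 0 \<le> profile_sum \<omega> \<gamma> p"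
  unfolding piece_ZX_def mem_vector_3_Collect profile_sum_def by (rule edge_Z_iff)

lemma piece_YZ_iff: "p \<in> piece_YZ \<omega> \<gamma> \<longleftrightarrow> pi/2 \<le> p $ 2 \<and> p $ 2 \<le> profile_end \<omega> \<and>
    pi/2 \<le> p $ 3 \<and> p $ 3 \<le> profile_end \<omega> \<and> 0 \<le> p $ 1 \<and> p $ 1 \<le> pi/2 \<and> 0 \<le> profile_sum \<omega> \<gamma> p"
  unfolding piece_YZ_def mem_vector_3_Collect profile_sum_def edge_Z_iff by (simp add: add.commute)

lemma octant_union_eq:
  "octant_union \<omega> \<gamma> = {p. \<forall>i. 0 \<le> p $ i} \<inter> closed_domain \<omega> \<gamma>"
proof (intro set_eqI iffI)
  fix p assume "p \<in> octant_union \<omega> \<gamma>"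
  moreover have "0 \<le> profile_sum \<omega> \<gamma> p" "p $ i \<le> profile_end \<omega>" if "p \<in> piece_C" for i
    using that inner_bounds[of "p $ 1"] inner_bounds[of "p $ 2"] inner_bounds[of "p $ 3"] \<gamma>_pos
    by (auto simp: piece_C_iff profile_sum_def inner_bounds)
  ultimately show "p \<in> {p. \<forall>i. 0 \<le> p $ i} \<inter> closed_domain \<omega> \<gamma>"
    unfolding octant_union_def closed_domain_def Un_iff
      piece_Z_iff piece_X_iff piece_Y_iff piece_ZX_iff piece_XY_iff piece_YZ_iff
    using pi_half_ge_zero inner_bounds(4)
    by (elim disjE) (simp add: piece_C_iff, auto simp: forall_3 intro: order_trans[OF pi_half_ge_zero])
next
  fix p assume p: "p \<in> {p. \<forall>i. 0 \<le> p $ i} \<inter> closed_domain \<omega> \<gamma>"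
  \<comment> \<open>There is no piece with all coordinates beyond \<open>pi/2\<close>: all profile
    values are then nonpositive, a nonnegative sum forces them to vanish, and only the corner of the
    cube remains.\<close>
  have "p \<in> piece_C" if "\<forall>i. pi/2 \<le> p $ i"
  proof -
    have F: "F (p $ 1) \<le> 0" "F (p $ 2) \<le> 0" "F (p $ 3) \<le> 0"
      using that p outer_bounds(1) by (auto simp: closed_domain_def)
    then have "\<gamma> * F (p $ 1) \<le> 0" "\<gamma> * F (p $ 2) \<le> 0" using \<gamma>_pos by (auto simp: mult_nonneg_nonpos)
    moreover have "0 \<le> \<gamma> * F (p $ 1) + \<gamma> * F (p $ 2) + F (p $ 3)"
      using p unfolding closed_domain_def profile_sum_def by auto
    ultimately have "\<gamma> * F (p $ 1) = 0" "\<gamma> * F (p $ 2) = 0" "F (p $ 3) = 0"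
      using F by linarith+
    then have "F (p $ i) = 0" for i using \<gamma>_pos exhaust_3[of i] by auto
    moreover have "pi/2 \<le> p $ i" "p $ i \<le> profile_end \<omega>" for i
      using that p by (auto simp: closed_domain_def)
    ultimately have eq: "p $ i = pi/2" for i using outer_bounds(2) by blast
    have "0 \<le> p $ i \<and> p $ i \<le> pi/2" for i unfolding eq by simp
    then show ?thesis by (simp add: piece_C_iff)
  qed
  moreover have b: "0 \<le> p $ i" "p $ i \<le> profile_end \<omega>" "0 \<le> profile_sum \<omega> \<gamma> p" for i
    using p by (auto simp: closed_domain_def)
  moreover have "p \<in> octant_union \<omega> \<gamma>" if "\<not> (\<forall>i. pi/2 \<le> p $ i)"
    using that b unfolding octant_union_def Un_iff forall_3
      piece_Z_iff piece_X_iff piece_Y_iff piece_ZX_iff piece_XY_iff piece_YZ_iff piece_C_iff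
    by (cases "p $ 1 \<le> pi/2"; cases "p $ 2 \<le> pi/2"; cases "p $ 3 \<le> pi/2") simp_all
  ultimately show "p \<in> octant_union \<omega> \<gamma>" by (auto simp: octant_union_def)
qed

lemma reflected_octant_union_eq:
  "{vector [\<sigma>1 * p $ 1, \<sigma>2 * p $ 2, \<sigma>3 * p $ 3] | p \<sigma>1 \<sigma>2 \<sigma>3.
     p \<in> octant_union \<omega> \<gamma> \<and> \<sigma>1 \<in> {-1, 1} \<and> \<sigma>2 \<in> {-1, 1} \<and> \<sigma>3 \<in> {-1, 1}} = closed_domain \<omega> \<gamma>"
  (is "?R = _")
proof
  have s: "F (\<sigma> * t) = F t" "\<bar>\<sigma> * t\<bar> = \<bar>t\<bar>" if "\<sigma> \<in> {-1, 1}" for \<sigma> t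
    using that by (auto simp: profile_minus)
  show "?R \<subseteq> closed_domain \<omega> \<gamma>"
    unfolding octant_union_eq by (auto simp: closed_domain_def profile_sum_def forall_3 profile_minus)
  show "closed_domain \<omega> \<gamma> \<subseteq> ?R"
  proof
    fix q assume q: "q \<in> closed_domain \<omega> \<gamma>"
    define p :: "real^3" where "p = (\<chi> i. \<bar>q $ i\<bar>)"
    define \<sigma> where "\<sigma> i = (if q $ i < 0 then -1 else 1 :: real)" for i
    have "q = vector [\<sigma> 1 * p $ 1, \<sigma> 2 * p $ 2, \<sigma> 3 * p $ 3]"
      by (auto simp: vec_eq_iff forall_3 p_def \<sigma>_def)
    moreover have "p \<in> octant_union \<omega> \<gamma>"
      using q by (auto simp: octant_union_eq closed_domain_def p_def profile_sum_def profile_abs)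
    moreover have "\<sigma> i \<in> {-1, 1}" for i by (simp add: \<sigma>_def)
    ultimately show "q \<in> ?R" by blast
  qed
qed

text \<open>Strict star-shapedness about the origin: it separates the open domain from its boundary,
  and makes every contraction of the closed domain fit inside the open one.\<close>

lemma profile_sum_scaled_less:
  assumes p: "p \<in> closed_domain \<omega> \<gamma>" and "p \<noteq> 0" "0 \<le> t" "t < 1"
  shows "profile_sum \<omega> \<gamma> p < profile_sum \<omega> \<gamma> (t *\<^sub>R p)"
proof -
  have le: "F (p $ i) \<le> F (t * p $ i)" for i
    using p assms(3,4) by (intro profile_decreasing \<omega>_pos)
      (auto simp: closed_domain_def abs_mult mult_left_le_one_le)
  have lt: "F (p $ i) < F (t * p $ i)" if "p $ i \<noteq> 0" for i
  proof -
    have "F \<bar>p $ i\<bar> < F \<bar>t * p $ i\<bar>"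
      using p assms(3,4) that by (intro profile_strict_decreasing \<omega>_pos) (auto simp: closed_domain_def abs_mult)
    then show ?thesis by (simp add: profile_abs)
  qed
  have "p $ 1 \<noteq> 0 \<or> p $ 2 \<noteq> 0 \<or> p $ 3 \<noteq> 0" using \<open>p \<noteq> 0\<close> by (auto simp: vec_eq_iff forall_3)
  moreover have le': "\<gamma> * F (p $ 1) \<le> \<gamma> * F (t * p $ 1)" "\<gamma> * F (p $ 2) \<le> \<gamma> * F (t * p $ 2)" "F (p $ 3) \<le> F (t * p $ 3)"
    using le \<gamma>_pos by auto
  ultimately show ?thesis
  proof (elim disjE)
    assume "p $ 1 \<noteq> 0"
    then have "\<gamma> * F (p $ 1) < \<gamma> * F (t * p $ 1)" using lt \<gamma>_pos by simp
    then show ?thesis using le' unfolding profile_sum_def vector_scaleR_component real_scaleR_def by linarith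
  next
    assume "p $ 2 \<noteq> 0"
    then have "\<gamma> * F (p $ 2) < \<gamma> * F (t * p $ 2)" using lt \<gamma>_pos by simp
    then show ?thesis using le' unfolding profile_sum_def vector_scaleR_component real_scaleR_def by linarith
  next
    assume "p $ 3 \<noteq> 0"
    then show ?thesis using le' lt[of 3] unfolding profile_sum_def vector_scaleR_component real_scaleR_def by linarith
  qed
qed

text \<open>On a face of the box one profile value is \<open>- sqrt \<omega>\<close> and the other
  two are at most 1, so the sum cannot be positive. This is where the range of \<gamma> keeps the
  domain off the faces.\<close>

lemma profile_sum_pos_imp_less_end:
  assumes p: "\<And>i. \<bar>p $ i\<bar> \<le> profile_end \<omega>" and pos: "0 < profile_sum \<omega> \<gamma> p"
  shows "\<bar>p $ i\<bar> < profile_end \<omega>"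
proof (rule ccontr)
  assume "\<not> ?thesis"
  then have i: "F (p $ i) = - sqrt \<omega>" using p[of i] profile_at_end[OF \<omega>_pos] by (metis antisym not_less profile_abs)
  have le1: "F (p $ j) \<le> 1" for j using p profile_le_1 \<omega>_pos by blast
  have "sqrt \<omega> > 0" by (rule sqrt_\<omega>_pos)
  then have g: "2 \<le> \<gamma> * sqrt \<omega>" "2 * \<gamma> \<le> sqrt \<omega>" using \<gamma> by (simp_all add: pos_divide_le_eq)
  \<comment> \<open>The average of \<open>\<gamma> * sqrt \<omega> \<ge> 2\<close> and
    \<open>\<gamma> * sqrt \<omega> \<ge> 2 * \<gamma>\<close>.\<close>
  have g1: "\<gamma> + 1 \<le> \<gamma> * sqrt \<omega>"
    using g(1) mult_left_mono[OF sqrt_\<omega> less_imp_le[OF \<gamma>_pos]] by linarith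
  have "\<gamma> * F (p $ j) \<le> \<gamma>" for j using mult_left_mono[OF le1[of j], of \<gamma>] \<gamma>_pos by simp
  note le2 = this[of 1] this[of 2] le1[of 3]
  have "i = 1 \<or> i = 2 \<or> i = 3" using exhaust_3 by blast
  then have "profile_sum \<omega> \<gamma> p \<le> 0"
    using le2 i g g1 unfolding profile_sum_def by (elim disjE) auto
  then show False using pos by simp
qed

lemma closed_closed_domain: "closed (closed_domain \<omega> \<gamma>)"
proof -
  have "closed_domain \<omega> \<gamma> = (\<Inter>i. {p. \<bar>p $ i\<bar> \<le> profile_end \<omega>}) \<inter> {p. 0 \<le> profile_sum \<omega> \<gamma> p}"
    by (auto simp: closed_domain_def)
  moreover have "closed {p :: real^3. 0 \<le> profile_sum \<omega> \<gamma> p}"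
    unfolding profile_sum_def
    by (intro closed_Collect_le continuous_intros continuous_on_compose2[OF continuous_on_profile[OF \<omega>_pos, of UNIV]]) auto
  ultimately show ?thesis
    by (auto intro!: closed_Int closed_INT closed_Collect_le continuous_intros)
qed

lemma zero_mem: "profile_sum \<omega> \<gamma> 0 > 0" "profile_end \<omega> > 0"
proof -
  show "profile_sum \<omega> \<gamma> 0 > 0" using \<gamma>_pos by (simp add: profile_sum_def profile_zero)
  show "profile_end \<omega> > 0" unfolding profile_end_def
    using sqrt_\<omega>_pos pi_half_gt_zero by (intro add_pos_pos mult_pos_pos)
qed

lemma Omega0_eq: "Omega0 \<omega> \<gamma> = {p. (\<forall>i. \<bar>p $ i\<bar> < profile_end \<omega>) \<and> 0 < profile_sum \<omega> \<gamma> p}"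
proof -
  have "interior (closed_domain \<omega> \<gamma>) = {p. (\<forall>i. \<bar>p $ i\<bar> < profile_end \<omega>) \<and> 0 < profile_sum \<omega> \<gamma> p}" (is "_ = ?O")
  proof
    have "?O = (\<Inter>i. {p. \<bar>p $ i\<bar> < profile_end \<omega>}) \<inter> {p. 0 < profile_sum \<omega> \<gamma> p}" by auto
    moreover have "open {p :: real^3. 0 < profile_sum \<omega> \<gamma> p}"
      unfolding profile_sum_def
      by (intro open_Collect_less continuous_intros continuous_on_compose2[OF continuous_on_profile[OF \<omega>_pos, of UNIV]]) auto
    ultimately have "open ?O"
      by (auto intro!: open_Int open_INT open_Collect_less continuous_intros)
    then show "?O \<subseteq> interior (closed_domain \<omega> \<gamma>)"
      by (rule interior_maximal[rotated]) (auto simp: closed_domain_def less_imp_le)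
    show "interior (closed_domain \<omega> \<gamma>) \<subseteq> ?O"
    proof
      fix p assume p: "p \<in> interior (closed_domain \<omega> \<gamma>)"
      show "p \<in> ?O"
      proof (cases "p = 0")
        case True
        then show ?thesis using zero_mem by simp
      next
        case False
        obtain e where e: "e > 0" "ball p e \<subseteq> closed_domain \<omega> \<gamma>"
          using p by (auto simp: mem_interior)
        \<comment> \<open>A dilation that moves p by e/2, hence stays in the ball around the
          interior point; contracting back by 1/h makes the sum strictly positive at p.\<close>
        define h where "h = 1 + e / (2 * norm p)"
        have h: "h > 1" using e False by (simp add: h_def)
        have "dist p (h *\<^sub>R p) = norm ((h - 1) *\<^sub>R p)"
          by (simp add: dist_norm norm_minus_commute scaleR_left_diff_distrib)
        also have "\<dots> < e" using e False by (simp add: h_def)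
        finally have q: "h *\<^sub>R p \<in> closed_domain \<omega> \<gamma>" using e by auto
        from profile_sum_scaled_less[OF q, of "1/h"] q h False
        have pos: "0 < profile_sum \<omega> \<gamma> p" by (auto simp: closed_domain_def)
        moreover have "p \<in> closed_domain \<omega> \<gamma>" using p interior_subset by blast
        ultimately show ?thesis using profile_sum_pos_imp_less_end by (auto simp: closed_domain_def)
      qed
    qed
  qed
  then show ?thesis unfolding Omega0_def reflected_octant_union_eq .
qed

end

section \<open>Bounds for the half-eigenvalue\<close>

definition weight_vector :: "real \<Rightarrow> real^3" where
  "weight_vector \<gamma> = vector [\<gamma>, \<gamma>, 1]"

lemma profile_sum_eq_sum:
  "profile_sum \<omega> \<gamma> p = (\<Sum>k\<in>UNIV. weight_vector \<gamma> $ k * profile \<omega> (p $ k))"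
  by (simp add: profile_sum_def weight_vector_def sum_3)

text \<open>The rows of the inverse of \<open>t\<close> times the shear matrix.\<close>

definition dual_row :: "real \<Rightarrow> real \<Rightarrow> 3 \<Rightarrow> real^3" where
  "dual_row t a k = vector
     [vector [1 / (t * shear_factor a), 0, 0],
      vector [- (a / pi) / (t * shear_factor a), 1 / t, 0],
      vector [0, 0, 1 / (t * shear_factor a)]] $ k"

lemma shear_factor_bounds:
  assumes "\<bar>a\<bar> < pi"
  shows "0 < shear_factor a" "shear_factor a \<le> 1" "(a / pi)\<^sup>2 + (shear_factor a)\<^sup>2 = 1"
proof -
  have "\<bar>a / pi\<bar> < 1" using assms by simp
  then have "(a / pi)\<^sup>2 < 1" by (simp add: abs_square_less_1)
  then show "0 < shear_factor a" "shear_factor a \<le> 1" "(a / pi)\<^sup>2 + (shear_factor a)\<^sup>2 = 1"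
    by (auto simp: shear_factor_def)
qed

lemma shear_factor_less_1:
  assumes "\<bar>a\<bar> < pi" "a \<noteq> 0"
  shows "shear_factor a < 1"
proof -
  have "(a / pi)\<^sup>2 > 0" using assms(2) by simp
  then show ?thesis by (simp add: shear_factor_def)
qed

text \<open>The second row has squared length ((a/pi)^2 + s^2) / (t s)^2, and the shear factor s is
  chosen so that this numerator is 1.\<close>

lemma dual_row_norm:
  assumes "\<bar>a\<bar> < pi" "t > 0"
  shows "dual_row t a k \<bullet> dual_row t a k = 1 / (t * shear_factor a)\<^sup>2"
proof -
  note s = shear_factor_bounds[OF assms(1)]
  have "(a / pi)\<^sup>2 / (t * shear_factor a)\<^sup>2 + 1 / t\<^sup>2 = ((a / pi)\<^sup>2 + (shear_factor a)\<^sup>2) / (t * shear_factor a)\<^sup>2"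
    using assms s(1) by (simp add: add_divide_distrib power_mult_distrib)
  then show ?thesis using s(3) exhaust_3[of k]
    by (auto simp: dual_row_def inner_vec_def sum_3 power2_eq_square mult_ac)
qed

lemma dual_row_inverse:
  assumes "\<bar>a\<bar> < pi" "t > 0"
  shows "dual_row t a k \<bullet> (t *\<^sub>R (shear_matrix a *v p)) = p $ k"
    "t *\<^sub>R (shear_matrix a *v (\<chi> k. dual_row t a k \<bullet> x)) = x"
proof -
  note s = shear_factor_bounds[OF assms(1)]
  show "dual_row t a k \<bullet> (t *\<^sub>R (shear_matrix a *v p)) = p $ k"
    using assms s(1) exhaust_3[of k]
    by (auto simp: dual_row_def inner_vec_def sum_3 matrix_vector_mult_def shear_matrix_def algebra_simps)
  show "t *\<^sub>R (shear_matrix a *v (\<chi> k. dual_row t a k \<bullet> x)) = x"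
    using assms s(1)
    by (simp add: vec_eq_iff forall_3 dual_row_def inner_vec_def sum_3 matrix_vector_mult_def shear_matrix_def algebra_simps)
qed

context gamma_range
begin

lemma scaled_Omega_eq:
  assumes "\<bar>a\<bar> < pi" "t > 0"
  shows "(\<lambda>p. t *\<^sub>R p) ` Omega \<omega> \<gamma> a = {x. (\<forall>k. \<bar>dual_row t a k \<bullet> x\<bar> < profile_end \<omega>) \<and>
    0 < profile_sum \<omega> \<gamma> (\<chi> k. dual_row t a k \<bullet> x)}" (is "_ = ?R")
proof
  show "(\<lambda>p. t *\<^sub>R p) ` Omega \<omega> \<gamma> a \<subseteq> ?R"
    unfolding Omega_def Omega0_eq by (auto simp: dual_row_inverse[OF assms] simp del: inner_scaleR_right)
  show "?R \<subseteq> (\<lambda>p. t *\<^sub>R p) ` Omega \<omega> \<gamma> a"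
  proof
    fix x assume "x \<in> ?R"
    then have "(\<chi> k. dual_row t a k \<bullet> x) \<in> Omega0 \<omega> \<gamma>" by (simp add: Omega0_eq)
    then show "x \<in> (\<lambda>p. t *\<^sub>R p) ` Omega \<omega> \<gamma> a"
      unfolding Omega_def using dual_row_inverse(2)[OF assms, of x] by (metis image_eqI)
  qed
qed

lemma open_scaled_Omega:
  assumes "\<bar>a\<bar> < pi" "t > 0"
  shows "open ((\<lambda>p. t *\<^sub>R p) ` Omega \<omega> \<gamma> a)"
proof -
  have "(\<lambda>p. t *\<^sub>R p) ` Omega \<omega> \<gamma> a = (\<Inter>k. {x. \<bar>dual_row t a k \<bullet> x\<bar> < profile_end \<omega>}) \<inter>
    {x. 0 < profile_sum \<omega> \<gamma> (\<chi> k. dual_row t a k \<bullet> x)}"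
    unfolding scaled_Omega_eq[OF assms] by auto
  moreover have "open {x. 0 < profile_sum \<omega> \<gamma> (\<chi> k. dual_row t a k \<bullet> x)}"
    unfolding profile_sum_def
    by (intro open_Collect_less continuous_intros continuous_on_compose2[OF continuous_on_profile[OF \<omega>_pos, of UNIV]]) auto
  ultimately show ?thesis
    by (auto intro!: open_Int open_INT open_Collect_less continuous_intros)
qed

text \<open>Because all rows have the same length, \<open>pucci_weight_profile\<close> turns the
  required inequality of \<open>ridge_sum_supersolution\<close> into an equality, with the common
  factor 1/(t s)^2 pulled out.\<close>

lemma scaled_Omega_supersolution:
  assumes a: "\<bar>a\<bar> < pi" "t > 0" and lam: "0 < lam" "lam \<le> Lam" "Lam = \<omega> * lam"
  shows "\<exists>\<phi>. continuous_on ((\<lambda>p. t *\<^sub>R p) ` Omega \<omega> \<gamma> a) \<phi> \<and> (\<forall>x\<in>(\<lambda>p. t *\<^sub>R p) ` Omega \<omega> \<gamma> a. \<phi> x > 0) \<and>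
    pucci_supersolution lam Lam (lam / (t * shear_factor a)\<^sup>2) ((\<lambda>p. t *\<^sub>R p) ` Omega \<omega> \<gamma> a) \<phi>"
proof -
  define v where "v x = (\<Sum>k\<in>UNIV. weight_vector \<gamma> $ k * profile \<omega> (dual_row t a k \<bullet> x))" for x
  have v: "v x = profile_sum \<omega> \<gamma> (\<chi> k. dual_row t a k \<bullet> x)" for x
    by (simp add: v_def profile_sum_eq_sum)
  have wpos: "weight_vector \<gamma> $ k > 0" for k
    using exhaust_3[of k] \<gamma>_pos by (auto simp: weight_vector_def)
  have "pucci_supersolution lam Lam (lam / (t * shear_factor a)\<^sup>2) ((\<lambda>p. t *\<^sub>R p) ` Omega \<omega> \<gamma> a) v"
    unfolding v_def[abs_def]
  proof (rule ridge_sum_supersolution[OF DERIV_profile[OF \<omega>_pos] DERIV_profile'[OF \<omega>_pos] continuous_on_profile''[OF \<omega>_pos]])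
    fix x assume "x \<in> (\<lambda>p. t *\<^sub>R p) ` Omega \<omega> \<gamma> a"
    then have E: "\<bar>dual_row t a k \<bullet> x\<bar> \<le> profile_end \<omega>" for k
      unfolding scaled_Omega_eq[OF a] by (auto simp: less_imp_le)
    have "(\<Sum>k\<in>UNIV. (dual_row t a k \<bullet> dual_row t a k) *
          pucci_weight lam Lam (weight_vector \<gamma> $ k * profile'' \<omega> (dual_row t a k \<bullet> x)))
      = - (lam / (t * shear_factor a)\<^sup>2) * (\<Sum>k\<in>UNIV. weight_vector \<gamma> $ k * profile \<omega> (dual_row t a k \<bullet> x))"
      unfolding sum_distrib_left
      by (rule sum.cong) (simp_all add: pucci_weight_profile[OF \<omega>_pos lam(3) wpos E] dual_row_norm[OF a])
    then show "(\<Sum>k\<in>UNIV. (dual_row t a k \<bullet> dual_row t a k) *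
          pucci_weight lam Lam (weight_vector \<gamma> $ k * profile'' \<omega> (dual_row t a k \<bullet> x)))
        + lam / (t * shear_factor a)\<^sup>2 * (\<Sum>k\<in>UNIV. weight_vector \<gamma> $ k * profile \<omega> (dual_row t a k \<bullet> x)) \<le> 0"
      by simp
  qed (use lam in auto)
  moreover have "continuous_on X v" for X
    unfolding v_def[abs_def]
    by (intro continuous_intros continuous_on_compose2[OF continuous_on_profile[OF \<omega>_pos, of UNIV]]) auto
  moreover have "\<forall>x\<in>(\<lambda>p. t *\<^sub>R p) ` Omega \<omega> \<gamma> a. v x > 0"
    unfolding scaled_Omega_eq[OF a] v by auto
  ultimately show ?thesis by blast
qed

lemma compact_closed_domain: "compact (closed_domain \<omega> \<gamma>)"
proof -
  have "bounded (closed_domain \<omega> \<gamma>)"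
  proof (rule boundedI)
    fix p assume "p \<in> closed_domain \<omega> \<gamma>"
    then have "(\<Sum>i\<in>UNIV. \<bar>p $ i\<bar>) \<le> (\<Sum>i\<in>(UNIV :: 3 set). profile_end \<omega>)"
      by (intro sum_mono) (auto simp: closed_domain_def)
    then show "norm p \<le> 3 * profile_end \<omega>" using norm_le_l1_cart[of p] by simp
  qed
  then show ?thesis using closed_closed_domain by (simp add: compact_eq_bounded_closed)
qed

text \<open>The profile sum of a homothetic copy, strictly inside, touches \<open>\<phi>\<close> from below after scaling.\<close>

lemma supersolution_upper_bound:
  assumes sub: "\<And>p. p \<in> closed_domain \<omega> \<gamma> \<Longrightarrow> x0 + \<tau> *\<^sub>R p \<in> \<Omega>" and \<tau>: "\<tau> > 0"
    and lam: "0 < lam" "lam \<le> Lam" "Lam = \<omega> * lam"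
    and \<phi>: "continuous_on \<Omega> \<phi>" "\<And>x. x \<in> \<Omega> \<Longrightarrow> \<phi> x > 0" and super: "pucci_supersolution lam Lam \<mu> \<Omega> \<phi>"
  shows "\<mu> \<le> lam / \<tau>\<^sup>2"
proof -
  define w where "w x = profile_sum \<omega> \<gamma> ((1 / \<tau>) *\<^sub>R (x - x0))" for x
  define K where "K = (\<lambda>p. x0 + \<tau> *\<^sub>R p) ` closed_domain \<omega> \<gamma>"
  define U where "U = {x. (1 / \<tau>) *\<^sub>R (x - x0) \<in> Omega0 \<omega> \<gamma>}"
  define n :: "3 \<Rightarrow> real^3" where "n k = axis k (1 / \<tau>)" for k
  have unscale: "x = x0 + \<tau> *\<^sub>R ((1 / \<tau>) *\<^sub>R (x - x0))" for x using \<tau> by simp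
  have "K \<subseteq> \<Omega>" using sub by (auto simp: K_def)
  have "Omega0 \<omega> \<gamma> \<subseteq> closed_domain \<omega> \<gamma>" unfolding Omega0_eq closed_domain_def by (auto simp: less_imp_le)
  then have "U \<subseteq> K" unfolding U_def K_def using unscale by blast
  have "open (Omega0 \<omega> \<gamma>)" by (simp add: Omega0_def)
  then have "open ((\<lambda>x. (1 / \<tau>) *\<^sub>R (x - x0)) -` Omega0 \<omega> \<gamma>)"
    by (intro open_vimage continuous_intros)
  then have "open U" by (simp add: U_def vimage_def)
  have "compact K" unfolding K_def
    by (intro compact_continuous_image continuous_intros compact_closed_domain)
  have x0: "x0 \<in> K" "w x0 > 0"
    using zero_mem by (auto simp: K_def w_def closed_domain_def intro!: image_eqI[of _ _ 0])
  have "continuous_on K w" unfolding w_def[abs_def] profile_sum_def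
    by (intro continuous_intros continuous_on_compose2[OF continuous_on_profile[OF \<omega>_pos, of UNIV]]) auto
  moreover have "continuous_on K \<phi>" using \<phi>(1) \<open>K \<subseteq> \<Omega>\<close> continuous_on_subset by blast
  moreover have "\<forall>x\<in>K. \<phi> x \<noteq> 0" using \<phi>(2) \<open>K \<subseteq> \<Omega>\<close> by (metis less_irrefl subsetD)
  ultimately have "continuous_on K (\<lambda>x. w x / \<phi> x)" by (rule continuous_on_divide)
  \<comment> \<open>At a maximum point of w / \<phi> with value m, the function w / m lies below
    \<phi> on \<open>K\<close> and meets it at z.\<close>
  then obtain z where z: "z \<in> K" "\<And>x. x \<in> K \<Longrightarrow> w x / \<phi> x \<le> w z / \<phi> z"
    using continuous_attains_sup[OF \<open>compact K\<close>] x0(1) by blast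
  define m where "m = w z / \<phi> z"
  have "m > 0" using z(2)[OF x0(1)] x0 \<phi>(2) \<open>K \<subseteq> \<Omega>\<close> unfolding m_def
    by (meson divide_pos_pos less_le_trans subsetD)
  have \<phi>z: "\<phi> z > 0" using z \<phi>(2) \<open>K \<subseteq> \<Omega>\<close> by blast
  have wz: "w z = m * \<phi> z" using \<phi>z by (simp add: m_def)
  then have "w z > 0" using \<open>m > 0\<close> \<phi>z by simp
  moreover have zc: "(1 / \<tau>) *\<^sub>R (z - x0) \<in> closed_domain \<omega> \<gamma>" using z(1) \<tau> by (auto simp: K_def)
  \<comment> \<open>Positivity of w at z puts the contact point into the open part of the copy, so w
    / m is an admissible test function there.\<close>
  ultimately have "z \<in> U"
    unfolding U_def Omega0_eq w_def closed_domain_def by (auto intro!: profile_sum_pos_imp_less_end[of "(1 / \<tau>) *\<^sub>R (z - x0)", simplified])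
  define c where "c k = weight_vector \<gamma> $ k / m" for k
  have cpos: "c k > 0" for k
    using exhaust_3[of k] \<gamma>_pos \<open>m > 0\<close> by (auto simp: c_def weight_vector_def)
  have nk: "n k \<bullet> (x - x0) = ((1 / \<tau>) *\<^sub>R (x - x0)) $ k" for k x
    by (simp add: n_def inner_axis' )
  have wsum: "(\<Sum>k\<in>UNIV. c k * profile \<omega> (n k \<bullet> (x - x0))) = w x / m" for x
    unfolding w_def profile_sum_eq_sum nk c_def by (simp add: sum_divide_distrib)
  let ?H = "\<lambda>x. (\<chi> i j. \<Sum>k\<in>UNIV. c k * profile'' \<omega> (n k \<bullet> (x - x0)) * (n k $ i * n k $ j)) :: real^3^3"
  let ?g = "\<lambda>x. \<Sum>k\<in>UNIV. (c k * profile' \<omega> (n k \<bullet> (x - x0))) *\<^sub>R n k"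
  have C2: "C2_with_hessian U (\<lambda>x. w x / m) ?g ?H"
    using C2_with_hessian_subset[OF C2_with_hessian_ridge_sum[OF DERIV_profile[OF \<omega>_pos] DERIV_profile'[OF \<omega>_pos]
          continuous_on_profile''[OF \<omega>_pos], of c n x0] \<open>open U\<close>] unfolding wsum by simp
  have "\<phi> z - w z / m \<le> \<phi> x - w x / m" if "x \<in> U" for x
  proof -
    have "\<phi> x > 0" "w x / \<phi> x \<le> m" using that \<open>U \<subseteq> K\<close> \<open>K \<subseteq> \<Omega>\<close> \<phi>(2) z(2) by (auto simp: m_def)
    then have "w x \<le> m * \<phi> x" by (simp add: divide_le_eq)
    then show ?thesis using wz \<open>m > 0\<close> by (simp add: divide_le_eq mult.commute)
  qed
  then have "pucci_sup lam Lam (?H z) + \<mu> * \<phi> z \<le> 0"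
    using super[unfolded pucci_supersolution_def, rule_format, of z U "\<lambda>x. w x / m" ?g ?H]
      \<open>z \<in> U\<close> C2 \<open>U \<subseteq> K\<close> \<open>K \<subseteq> \<Omega>\<close> by blast
  \<comment> \<open>Without shear the Hessian is diagonal, so the Pucci value is exact rather than
    only bounded above.\<close>
  moreover have "pucci_sup lam Lam (?H z) = - (lam / \<tau>\<^sup>2) * \<phi> z"
  proof -
    have "?H z $ i $ j = (if i = j then c i / \<tau>\<^sup>2 * profile'' \<omega> (n i \<bullet> (z - x0)) else 0)" for i j
      using exhaust_3[of i] exhaust_3[of j]
      by (auto simp: n_def axis_def sum_3 power2_eq_square)
    then have "pucci_sup lam Lam (?H z) = (\<Sum>i\<in>UNIV. pucci_weight lam Lam (c i / \<tau>\<^sup>2 * profile'' \<omega> (n i \<bullet> (z - x0))))"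
      by (rule pucci_sup_diagonal)
    also have "\<dots> = (\<Sum>i\<in>UNIV. - (lam / \<tau>\<^sup>2) * (c i * profile \<omega> (n i \<bullet> (z - x0))))"
    proof (rule sum.cong[OF refl])
      fix i
      have "\<bar>n i \<bullet> (z - x0)\<bar> \<le> profile_end \<omega>" unfolding nk using zc by (auto simp: closed_domain_def)
      then show "pucci_weight lam Lam (c i / \<tau>\<^sup>2 * profile'' \<omega> (n i \<bullet> (z - x0)))
         = - (lam / \<tau>\<^sup>2) * (c i * profile \<omega> (n i \<bullet> (z - x0)))"
        using pucci_weight_profile[OF \<omega>_pos lam(3), of "c i / \<tau>\<^sup>2" "n i \<bullet> (z - x0)"] cpos[of i] \<tau> by simp
    qed
    also have "\<dots> = - (lam / \<tau>\<^sup>2) * \<phi> z"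
      unfolding sum_distrib_left[symmetric] wsum using wz \<open>m > 0\<close> by simp
    finally show ?thesis .
  qed
  ultimately have "(\<mu> - lam / \<tau>\<^sup>2) * \<phi> z \<le> 0" by (simp add: algebra_simps)
  then show ?thesis using \<phi>z by (simp add: mult_le_0_iff)
qed

text \<open>A real supremum dominates its members only if the set is bounded above; a tiny copy of
  the closed unsheared domain inside the open sheared one supplies such a bound.\<close>

lemma half_eigenvalue_ge:
  assumes a: "\<bar>a\<bar> < pi" "t > 0" and lam: "0 < lam" "lam \<le> Lam" "Lam = \<omega> * lam"
  shows "lam / (t * shear_factor a)\<^sup>2 \<le> half_eigenvalue lam Lam ((\<lambda>p. t *\<^sub>R p) ` Omega \<omega> \<gamma> a)"
  unfolding half_eigenvalue_def
proof (rule cSup_upper)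
  let ?\<Omega> = "(\<lambda>p. t *\<^sub>R p) ` Omega \<omega> \<gamma> a"
  have "(\<chi> k. dual_row t a k \<bullet> 0) = (0 :: real^3)" by (simp add: vec_eq_iff)
  then have "0 \<in> ?\<Omega>" using zero_mem unfolding scaled_Omega_eq[OF a] by simp
  then obtain e where e: "e > 0" "ball 0 e \<subseteq> ?\<Omega>" using open_scaled_Omega[OF a] openE by blast
  obtain B where B: "B > 0" "\<And>p. p \<in> closed_domain \<omega> \<gamma> \<Longrightarrow> norm p \<le> B"
    using compact_imp_bounded[OF compact_closed_domain] by (auto simp: bounded_pos)
  \<comment> \<open>Shrinks the closed domain, of radius at most B, into the ball of radius
    e.\<close>
  define \<tau> where "\<tau> = e / (2 * B)"
  have "\<tau> > 0" using e B by (simp add: \<tau>_def)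
  have "0 + \<tau> *\<^sub>R p \<in> ?\<Omega>" if "p \<in> closed_domain \<omega> \<gamma>" for p
  proof -
    have "norm (\<tau> *\<^sub>R p) \<le> \<tau> * B" using B(2)[OF that] \<open>\<tau> > 0\<close> by simp
    also have "\<dots> < e" using e B by (simp add: \<tau>_def)
    finally show ?thesis using e by (auto simp: dist_norm)
  qed
  then show "bdd_above {\<mu>. \<exists>\<phi>. continuous_on ?\<Omega> \<phi> \<and> (\<forall>x\<in>?\<Omega>. \<phi> x > 0) \<and> pucci_supersolution lam Lam \<mu> ?\<Omega> \<phi>}"
    using supersolution_upper_bound[OF _ \<open>\<tau> > 0\<close> lam] by (intro bdd_aboveI[of _ "lam / \<tau>\<^sup>2"]) blast
qed (use scaled_Omega_supersolution[OF a lam] in blast)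

text \<open>The closed domain itself is not contained in the open one, so the sharp constant is the
  limit of the bounds from copies contracted by r < 1.\<close>

lemma half_eigenvalue_le:
  assumes t: "t > 0" and lam: "0 < lam" "lam \<le> Lam" "Lam = \<omega> * lam"
  shows "half_eigenvalue lam Lam ((\<lambda>p. t *\<^sub>R p) ` Omega \<omega> \<gamma> 0) \<le> lam / t\<^sup>2"
  unfolding half_eigenvalue_def
proof (rule cSup_least)
  let ?\<Omega> = "(\<lambda>p. t *\<^sub>R p) ` Omega \<omega> \<gamma> 0"
  show "{\<mu>. \<exists>\<phi>. continuous_on ?\<Omega> \<phi> \<and> (\<forall>x\<in>?\<Omega>. \<phi> x > 0) \<and> pucci_supersolution lam Lam \<mu> ?\<Omega> \<phi>} \<noteq> {}"
    using scaled_Omega_supersolution[OF _ t lam, of 0] by auto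
  fix \<mu> assume "\<mu> \<in> {\<mu>. \<exists>\<phi>. continuous_on ?\<Omega> \<phi> \<and> (\<forall>x\<in>?\<Omega>. \<phi> x > 0) \<and> pucci_supersolution lam Lam \<mu> ?\<Omega> \<phi>}"
  then obtain \<phi> where \<phi>: "continuous_on ?\<Omega> \<phi>" "\<And>x. x \<in> ?\<Omega> \<Longrightarrow> \<phi> x > 0" "pucci_supersolution lam Lam \<mu> ?\<Omega> \<phi>" by blast
  have "shear_matrix 0 *v p = p" for p
    by (simp add: vec_eq_iff forall_3 matrix_vector_mult_def sum_3 shear_matrix_def shear_factor_def)
  then have \<Omega>: "?\<Omega> = (\<lambda>p. t *\<^sub>R p) ` Omega0 \<omega> \<gamma>" by (simp add: Omega_def)
  show "\<mu> \<le> lam / t\<^sup>2"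
  \<comment> \<open>It suffices to prove z \<mu> \<le> lam / t^2 for every z in (0, 1); contraction
    by r = sqrt z gives exactly this.\<close>
  proof (rule field_le_mult_one_interval)
    fix z :: real assume z: "0 < z" "z < 1"
    define r where "r = sqrt z"
    have r: "0 < r" "r < 1" "r\<^sup>2 = z" using z by (auto simp: r_def)
    have "0 + (t * r) *\<^sub>R p \<in> ?\<Omega>" if p: "p \<in> closed_domain \<omega> \<gamma>" for p
    proof -
      have "r *\<^sub>R p \<in> Omega0 \<omega> \<gamma>"
      proof (cases "p = 0")
        case True
        then show ?thesis using zero_mem by (simp add: Omega0_eq)
      next
        case False
        have "0 < profile_sum \<omega> \<gamma> (r *\<^sub>R p)"
          using profile_sum_scaled_less[OF p False, of r] r p by (auto simp: closed_domain_def)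
        moreover have "\<bar>r * p $ i\<bar> < profile_end \<omega>" for i
        proof -
          have "r * \<bar>p $ i\<bar> \<le> r * profile_end \<omega>"
            using p r by (intro mult_left_mono) (auto simp: closed_domain_def)
          also have "\<dots> < profile_end \<omega>" using zero_mem r by simp
          finally show ?thesis using r by (simp add: abs_mult)
        qed
        ultimately show ?thesis by (simp add: Omega0_eq)
      qed
      then show ?thesis unfolding \<Omega> by (auto intro!: image_eqI[of _ _ "r *\<^sub>R p"])
    qed
    from supersolution_upper_bound[OF this _ lam \<phi>] have "\<mu> \<le> lam / (t * r)\<^sup>2" using t r by simp
    then show "z * \<mu> \<le> lam / t\<^sup>2" using t r z by (simp add: power_mult_distrib field_simps)
  qed
qed

end

section \<open>Arcsine measures and elementary inequalities\<close>

lemma sin_concave: "concave_on {0..pi} sin"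
  unfolding concave_on_def
  by (rule f''_ge0_imp_convex[where f' = "\<lambda>x. - cos x" and f'' = sin])
    (auto intro!: derivative_eq_intros sin_ge_zero)

lemma sin_le_tangent:
  assumes "0 \<le> x" "x \<le> pi/2" "0 < m" "m \<le> pi/2"
  shows "sin x \<le> sin m + cos m * (x - m)"
proof -
  have "convex_on {0..pi} (\<lambda>x. - sin x)" using sin_concave by (simp add: concave_on_def)
  moreover have "((\<lambda>x. - sin x) has_real_derivative - cos m) (at m within {0..pi})"
    by (auto intro!: derivative_eq_intros)
  moreover have "m \<in> interior {0..pi}" using assms pi_gt_zero by (auto simp: interior_atLeastAtMost_real)
  ultimately have "- cos m * (x - m) \<le> - sin x - - sin m"
    using assms pi_gt_zero by (intro convex_on_imp_above_tangent[where A = "{0..pi}"]) auto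
  then show ?thesis by simp
qed

text \<open>Jensen's inequality, obtained from the tangent of the concave sine at the mean of the
  three arcsines, so that the infinite slope of arcsin at 1 never appears.\<close>

lemma arcsin_mean_le:
  assumes "\<And>i. i \<in> {x, y, z} \<Longrightarrow> 0 \<le> i \<and> i \<le> 1"
  shows "3 * arcsin ((x + y + z) / 3) \<le> arcsin x + arcsin y + arcsin z"
proof -
  have b: "0 \<le> x" "x \<le> 1" "0 \<le> y" "y \<le> 1" "0 \<le> z" "z \<le> 1" using assms by auto
  define m where "m = (arcsin x + arcsin y + arcsin z) / 3"
  have nn: "0 \<le> arcsin t" "arcsin t \<le> pi/2" if "0 \<le> t" "t \<le> 1" for t :: real
    using that arcsin_le_arcsin[of 0 t] arcsin_ubound[of t] by auto
  note nn' = nn[OF b(1,2)] nn[OF b(3,4)] nn[OF b(5,6)]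
  have m: "0 \<le> m" "m \<le> pi/2" using nn' by (auto simp: m_def)
  have "(x + y + z) / 3 \<le> sin m"
  \<comment> \<open>The tangent bound requires m inside (0, pi); at m = 0 all three arguments
    vanish.\<close>
  proof (cases "m = 0")
    case True
    then have "arcsin x = 0" "arcsin y = 0" "arcsin z = 0" using nn' by (auto simp: m_def)
    then have "x = 0" "y = 0" "z = 0" using b by (metis sin_arcsin sin_zero neg_0_le_iff_le order_trans zero_le_one minus_le_iff le_minus_one_simps(1))+
    then show ?thesis using True by simp
  next
    case False
    then have m0: "0 < m" using m by simp
    have "sin (arcsin x) + sin (arcsin y) + sin (arcsin z) \<le>
        (sin m + cos m * (arcsin x - m)) + (sin m + cos m * (arcsin y - m)) + (sin m + cos m * (arcsin z - m))"
      using nn' m0 m by (intro add_mono sin_le_tangent) auto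
    also have "\<dots> = 3 * sin m + cos m * (arcsin x + arcsin y + arcsin z - 3 * m)" by (simp add: algebra_simps)
    also have "\<dots> = 3 * sin m" by (simp add: m_def)
    finally show ?thesis using b by simp
  qed
  then have "arcsin ((x + y + z) / 3) \<le> arcsin (sin m)"
    using b by (intro arcsin_le_arcsin) auto
  also have "\<dots> = m" using m by (intro arcsin_sin) auto
  finally show ?thesis by (simp add: m_def)
qed

text \<open>Convexity with value 0 at 0, again read off the sine: sin (t/k) \<ge> (sin t)/k.\<close>

lemma arcsin_scale_ge:
  assumes "1 \<le> k" "0 \<le> u" "k * u \<le> 1"
  shows "k * arcsin u \<le> arcsin (k * u)"
proof -
  define t where "t = arcsin (k * u)"
  have ku: "0 \<le> k * u" using assms by simp
  have t: "0 \<le> t" "t \<le> pi/2" "sin t = k * u"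
    using ku assms(3) arcsin_le_arcsin[of 0 "k * u"] arcsin_ubound[of "k * u"] by (auto simp: t_def)
  have "t \<le> pi" using t pi_gt_zero by linarith
  then have "(1 - 1 / k) * sin 0 + 1 / k * sin t \<le> sin ((1 - 1 / k) *\<^sub>R 0 + (1 / k) *\<^sub>R t)"
    using concave_onD[OF sin_concave, of "1/k" 0 t] assms t by auto
  then have "u \<le> sin (t / k)" using assms t by simp
  then have "arcsin u \<le> arcsin (sin (t / k))" using assms by (intro arcsin_le_arcsin) auto
  also have "\<dots> = t / k"
  proof (rule arcsin_sin)
    have "t / k \<le> t" using t assms mult_left_mono[OF assms(1) t(1)] by (simp add: divide_le_eq)
    then show "t / k \<le> pi / 2" using t by linarith
    have "0 \<le> t / k" using t assms by simp
    then show "- (pi / 2) \<le> t / k" using pi_half_ge_zero by linarith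
  qed
  finally show ?thesis using assms by (simp add: t_def field_simps)
qed

text \<open>After division by m, apply ln x \<le> x - 1 to each factor and add.\<close>

lemma amgm3:
  fixes x y z m :: real
  assumes "0 < x" "0 < y" "0 < z" "0 < m" "m ^ 3 \<le> x * y * z"
  shows "3 * m \<le> x + y + z"
proof -
  have "0 \<le> ln (x * y * z / m ^ 3)" using assms by simp
  also have "\<dots> = ln (x / m) + ln (y / m) + ln (z / m)"
    using assms by (simp add: ln_mult ln_div ln_realpow)
  also have "\<dots> \<le> (x / m - 1) + (y / m - 1) + (z / m - 1)"
    using assms by (intro add_mono ln_le_minus_one) auto
  finally have "3 \<le> (x + y + z) / m" by (simp add: add_divide_distrib)
  then show ?thesis using assms by (simp add: le_divide_eq)
qed

section \<open>Arcsine laws\<close>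

text \<open>The derivative of r arcsin (p / r) on (0, r), extended by zero.\<close>

definition arcsine_density :: "real \<Rightarrow> real \<Rightarrow> real" where
  "arcsine_density r p = indicator {0<..<r} p / sqrt (1 - (p / r)\<^sup>2)"

lemma arcsine_density_measurable [measurable]: "arcsine_density r \<in> borel_measurable borel"
  unfolding arcsine_density_def[abs_def] by measurable

lemma arcsine_density_nonneg: "0 \<le> arcsine_density r p"
  by (auto simp: arcsine_density_def indicator_def abs_square_le_1 intro!: divide_nonneg_nonneg)

text \<open>The image of Lebesgue measure on \<open>(0, r pi / 2)\<close> under \<open>\<xi> \<mapsto> r sin (\<xi> / r)\<close>.\<close>

definition arcsine_measure :: "real \<Rightarrow> real measure" where
  "arcsine_measure r = density lborel (\<lambda>p. ennreal (arcsine_density r p))"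

lemma sets_arcsine_measure [measurable_cong, simp]: "sets (arcsine_measure r) = sets borel"
  by (simp add: arcsine_measure_def)

lemma space_arcsine_measure [simp]: "space (arcsine_measure r) = UNIV"
  by (simp add: arcsine_measure_def)

lemma nn_integral_arcsine_measure:
  assumes r: "r > 0" and f [measurable]: "f \<in> borel_measurable borel"
  shows "(\<integral>\<^sup>+p. f p \<partial>arcsine_measure r) = (\<integral>\<^sup>+\<xi>. f (r * sin (\<xi> / r)) * indicator {0<..<r * (pi/2)} \<xi> \<partial>lborel)"
proof -
  have "(\<integral>\<^sup>+p. f p \<partial>arcsine_measure r) = (\<integral>\<^sup>+p. ennreal (arcsine_density r p) * f p \<partial>lborel)"
    unfolding arcsine_measure_def by (rule nn_integral_density) auto
  \<comment> \<open>The density vanishes off (0, r), so the indicator of [0, r] may be inserted; its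
    endpoints are written as sines to match the substitution rule.\<close>
  also have "\<dots> = (\<integral>\<^sup>+p. (ennreal (arcsine_density r p) * f p) * indicator {r * sin (0 / r) .. r * sin (r * (pi/2) / r)} p \<partial>lborel)"
    using r by (intro nn_integral_cong) (auto simp: arcsine_density_def split: split_indicator)
  also have "\<dots> = (\<integral>\<^sup>+\<xi>. (ennreal (arcsine_density r (r * sin (\<xi> / r))) * f (r * sin (\<xi> / r))) * cos (\<xi> / r) * indicator {0..r * (pi/2)} \<xi> \<partial>lborel)"
  proof (rule nn_integral_substitution_aux)
    show "((\<lambda>\<xi>. r * sin (\<xi> / r)) has_real_derivative cos (x / r)) (at x)" for x
      using r by (auto intro!: derivative_eq_intros)
    show "0 \<le> cos (x / r)" if "x \<in> {0..r * (pi/2)}" for x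
    proof (rule cos_ge_zero)
      have "0 \<le> x / r" using that r by simp
      then show "- (pi/2) \<le> x / r" using pi_half_ge_zero by linarith
      show "x / r \<le> pi/2" using that r by (simp add: divide_le_eq mult.commute)
    qed
  qed (use r in \<open>auto intro!: continuous_intros\<close>)
  also have "\<dots> = (\<integral>\<^sup>+\<xi>. f (r * sin (\<xi> / r)) * indicator {0<..<r * (pi/2)} \<xi> \<partial>lborel)"
  \<comment> \<open>Inside the interval the density 1 / cos cancels the derivative cos of the
    substitution; only the two endpoints are discarded.\<close>
  proof (rule nn_integral_cong_AE)
    have "AE x in lborel. x \<notin> {0, r * (pi/2)}"
      by (intro AE_not_in) (simp add: null_sets_def emeasure_lborel_countable)
    then show "AE \<xi> in lborel. (ennreal (arcsine_density r (r * sin (\<xi> / r))) * f (r * sin (\<xi> / r))) * cos (\<xi> / r) * indicator {0..r * (pi/2)} \<xi>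
       = f (r * sin (\<xi> / r)) * indicator {0<..<r * (pi/2)} \<xi>"
    proof eventually_elim
      case (elim \<xi>)
      show ?case
      proof (cases "\<xi> \<in> {0<..<r * (pi/2)}")
        case True
        have b: "0 < \<xi> / r" "\<xi> / r < pi/2" using True r by (auto simp: divide_less_eq mult.commute)
        have c: "cos (\<xi> / r) > 0" using b by (intro cos_gt_zero) auto
        have s: "0 < sin (\<xi> / r)" using b by (intro sin_gt_zero2) auto
        have s1: "sin (\<xi> / r) < 1" using c s by (metis cos_squared_eq less_le not_less one_power2 power2_less_0 sin_le_one diff_self zero_less_power2 less_irrefl)
        have "sqrt (1 - (sin (\<xi> / r))\<^sup>2) = cos (\<xi> / r)" using c by (simp add: cos_squared_eq[symmetric])
        then have "arcsine_density r (r * sin (\<xi> / r)) = 1 / cos (\<xi> / r)"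
          using r s s1 by (simp add: arcsine_density_def)
        then have "ennreal (arcsine_density r (r * sin (\<xi> / r))) * ennreal (cos (\<xi> / r)) = 1"
          using c by (simp add: ennreal_mult[symmetric])
        then have "ennreal (arcsine_density r (r * sin (\<xi> / r))) * f (r * sin (\<xi> / r)) * ennreal (cos (\<xi> / r)) = f (r * sin (\<xi> / r))"
          by (metis mult.commute mult.left_commute mult.right_neutral)
        then show ?thesis using True by (simp add: indicator_def)
      qed (use elim in \<open>auto simp: indicator_def\<close>)
    qed
  qed
  finally show ?thesis .
qed

lemma AE_arcsine_measure: "AE p in arcsine_measure r. 0 < p \<and> p < r"
  unfolding arcsine_measure_def
  by (subst AE_density) (auto simp: arcsine_density_def indicator_def)

lemma emeasure_arcsine_measure_lessThan:
  assumes r: "r > 0" and c: "0 \<le> c" "c \<le> r"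
  shows "emeasure (arcsine_measure r) {..<c} = ennreal (r * arcsin (c / r))"
proof -
  have a: "0 \<le> arcsin (c / r)" "arcsin (c / r) \<le> pi/2"
  proof -
    have "0 \<le> c / r" "c / r \<le> 1" using c r by auto
    then show "0 \<le> arcsin (c / r)" "arcsin (c / r) \<le> pi/2"
      using arcsin_le_arcsin[of 0 "c / r"] arcsin_ubound[of "c / r"] by auto
  qed
  have "emeasure (arcsine_measure r) {..<c} = (\<integral>\<^sup>+p. indicator {..<c} p \<partial>arcsine_measure r)" by simp
  also have "\<dots> = (\<integral>\<^sup>+\<xi>. indicator {..<c} (r * sin (\<xi> / r)) * indicator {0<..<r * (pi/2)} \<xi> \<partial>lborel)"
    by (rule nn_integral_arcsine_measure[OF r]) simp
  also have "\<dots> = (\<integral>\<^sup>+\<xi>. indicator {0<..<r * arcsin (c / r)} \<xi> \<partial>lborel)"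
  proof (rule nn_integral_cong)
    fix \<xi>
    have "r * arcsin (c / r) \<le> r * (pi/2)" using a r by simp
    moreover have "r * sin (\<xi> / r) < c \<longleftrightarrow> \<xi> < r * arcsin (c / r)" if "0 < \<xi>" "\<xi> < r * (pi/2)"
    proof -
      have b: "0 < \<xi> / r" "\<xi> / r < pi/2" using that r by (auto simp: divide_less_eq mult.commute)
      have "r * sin (\<xi> / r) < c \<longleftrightarrow> sin (\<xi> / r) < c / r" using r by (simp add: less_divide_eq mult.commute)
      also have "\<dots> \<longleftrightarrow> \<xi> / r < arcsin (c / r)"
      proof -
        have "arcsin (c / r) \<le> \<xi> / r \<longleftrightarrow> c / r \<le> sin (\<xi> / r)"
        proof (rule arcsin_le_iff)
          have "0 \<le> c / r" using c r by simp
          then show "-1 \<le> c / r" by linarith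
          show "c / r \<le> 1" using c r by simp
          show "- pi / 2 \<le> \<xi> / r" "\<xi> / r \<le> pi / 2" using b pi_half_ge_zero by linarith+
        qed
        then show ?thesis by (simp add: not_le[symmetric])
      qed
      also have "\<dots> \<longleftrightarrow> \<xi> < r * arcsin (c / r)" using r by (simp add: divide_less_eq mult.commute)
      finally show ?thesis .
    qed
    ultimately show "indicator {..<c} (r * sin (\<xi> / r)) * indicator {0<..<r * (pi/2)} \<xi> = (indicator {0<..<r * arcsin (c / r)} \<xi> :: ennreal)"
      by (auto simp: indicator_def)
  qed
  also have "\<dots> = ennreal (r * arcsin (c / r))" using a r by simp
  finally show ?thesis .
qed

lemma finite_arcsine_measure:
  assumes "r > 0" shows "finite_measure (arcsine_measure r)"
proof
  have "emeasure (arcsine_measure r) UNIV = (\<integral>\<^sup>+p. 1 \<partial>arcsine_measure r)" by simp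
  also have "\<dots> = (\<integral>\<^sup>+\<xi>. indicator {0<..<r * (pi/2)} \<xi> \<partial>lborel)"
    by (subst nn_integral_arcsine_measure[OF assms]) auto
  also have "\<dots> < \<infinity>" using assms by simp
  finally show "emeasure (arcsine_measure r) (space (arcsine_measure r)) \<noteq> \<infinity>" by simp
qed

section \<open>Volume as an iterated integral\<close>

lemma emeasure_lborel_Times:
  fixes A :: "'a::euclidean_space set" and B :: "'b::euclidean_space set"
  assumes "A \<in> sets borel" "B \<in> sets borel"
  shows "emeasure lborel (A \<times> B) = emeasure lborel A * emeasure lborel B"
  using assms by (simp add: lborel_prod[symmetric] lborel.emeasure_pair_measure_Times)

text \<open>Moves Lebesgue measure from nested pairs, where Fubini is available, to
  \<open>real^3\<close>; equality of the measures is checked on boxes.\<close>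

lemma emeasure_lborel_real3:
  fixes S :: "(real^3) set"
  assumes [measurable]: "S \<in> sets borel"
  shows "emeasure lborel S = (\<integral>\<^sup>+x. \<integral>\<^sup>+y. \<integral>\<^sup>+z. indicator S (vector [x, y, z]) \<partial>lborel \<partial>lborel \<partial>lborel)"
proof -
  define T :: "real \<times> real \<times> real \<Rightarrow> real^3" where "T = (\<lambda>(x, y, z). vector [x, y, z])"
  have T: "T p = fst p *\<^sub>R axis 1 1 + fst (snd p) *\<^sub>R axis 2 1 + snd (snd p) *\<^sub>R axis 3 1" for p
    by (cases p) (simp add: T_def vec_eq_iff forall_3 axis_def)
  have [measurable]: "T \<in> borel_measurable borel"
    unfolding T[abs_def] by (intro borel_measurable_continuous_onI continuous_intros)
  have "lborel = distr lborel borel T"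
  proof (rule lborel_eqI)
    fix l u :: "real^3" assume le: "\<And>b. b \<in> Basis \<Longrightarrow> l \<bullet> b \<le> u \<bullet> b"
    have le': "l $ i \<le> u $ i" for i using le[of "axis i 1"] by (simp add: inner_axis axis_in_Basis_iff)
    have "T -` box l u = {l $ 1<..<u $ 1} \<times> ({l $ 2<..<u $ 2} \<times> {l $ 3<..<u $ 3})"
      by (auto simp: T_def mem_box_cart forall_3)
    then have "emeasure (distr lborel borel T) (box l u) =
        emeasure lborel ({l $ 1<..<u $ 1} \<times> ({l $ 2<..<u $ 2} \<times> {l $ 3<..<u $ 3}))"
      by (simp add: emeasure_distr)
    also have "\<dots> = ennreal (u $ 1 - l $ 1) * (ennreal (u $ 2 - l $ 2) * ennreal (u $ 3 - l $ 3))"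
      using le' by (simp add: emeasure_lborel_Times open_Times)
    also have "\<dots> = ennreal (\<Prod>i\<in>UNIV. (u - l) $ i)"
    proof -
      have "(\<Prod>i\<in>UNIV. (u - l) $ i) = (u $ 1 - l $ 1) * ((u $ 2 - l $ 2) * (u $ 3 - l $ 3))"
        unfolding UNIV_3 by simp
      then show ?thesis using le' by (simp only: ennreal_mult diff_ge_0_iff_ge mult_nonneg_nonneg)
    qed
    also have "(\<Prod>i\<in>UNIV. (u - l) $ i) = (\<Prod>b\<in>(\<lambda>i. axis i (1::real)) ` UNIV. (u - l) \<bullet> b)"
      by (subst prod.reindex) (auto simp: inj_on_def axis_eq_axis inner_axis)
    also have "(\<lambda>i. axis i (1::real)) ` UNIV = (Basis :: (real^3) set)"
      by (auto simp: Basis_vec_def)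
    finally show "emeasure (distr lborel borel T) (box l u) = ennreal (\<Prod>b\<in>Basis. (u - l) \<bullet> b)" .
  qed simp
  then have "emeasure lborel S = emeasure (distr lborel borel T) S"
    by (rule arg_cong[where f = "\<lambda>M. emeasure M S"])
  also have "\<dots> = (\<integral>\<^sup>+p. indicator S (T p) \<partial>lborel)"
  proof -
    have "emeasure (distr lborel borel T) S = (\<integral>\<^sup>+p. indicator S p \<partial>distr lborel borel T)"
      by (rule nn_integral_indicator[symmetric]) simp
    also have "\<dots> = (\<integral>\<^sup>+p. indicator S (T p) \<partial>lborel)"
      by (rule nn_integral_distr) measurable
    finally show ?thesis .
  qed
  also have "\<dots> = (\<integral>\<^sup>+x. \<integral>\<^sup>+q. indicator S (T (x, q)) \<partial>lborel \<partial>lborel)"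
    unfolding lborel_prod[symmetric, where ?'b = "real \<times> real"]
    by (rule lborel.nn_integral_fst[symmetric]) (simp add: lborel_prod)
  also have "\<dots> = (\<integral>\<^sup>+x. \<integral>\<^sup>+y. \<integral>\<^sup>+z. indicator S (T (x, y, z)) \<partial>lborel \<partial>lborel \<partial>lborel)"
    unfolding lborel_prod[symmetric, where ?'a = real and ?'b = real]
    by (intro nn_integral_cong lborel.nn_integral_fst[symmetric]) (simp add: lborel_prod)
  finally show ?thesis by (simp add: T_def)
qed

lemma nn_integral_lborel_reflect_split:
  assumes [measurable]: "f \<in> borel_measurable borel" and even: "\<And>x. f (- x) = f x"
  shows "(\<integral>\<^sup>+x. f x \<partial>lborel) = 2 * (\<integral>\<^sup>+x. f x * indicator {0<..} x \<partial>(lborel :: real measure))"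
proof -
  have "(\<integral>\<^sup>+x. f x \<partial>lborel) = (\<integral>\<^sup>+x. f x * indicator {0<..} x + f (- x) * indicator {0<..} (- x) \<partial>lborel)"
  proof (rule nn_integral_cong_AE)
    have "AE x in lborel. x \<notin> {0::real}" by (intro AE_not_in) auto
    then show "AE x in lborel. f x = f x * indicator {0<..} x + f (- x) * indicator {0<..} (- x)"
      by eventually_elim (auto simp: even indicator_def)
  qed
  also have "\<dots> = (\<integral>\<^sup>+x. f x * indicator {0<..} x \<partial>lborel) + (\<integral>\<^sup>+x. f (- x) * indicator {0<..} (- x) \<partial>lborel)"
    by (rule nn_integral_add) auto
  also have "(\<integral>\<^sup>+x. f (- x) * indicator {0<..} (- x) \<partial>lborel) = (\<integral>\<^sup>+x. f x * indicator {0<..} x \<partial>lborel)"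
    by (subst (2) nn_integral_real_affine[of _ "-1" 0]) auto
  finally show ?thesis by (simp add: mult_2)
qed

context gamma_range
begin

text \<open>The image of Lebesgue measure under F: sin \<xi> at distance \<xi> inside
  \<open>pi/2\<close>, and \<open>- sqrt \<omega> * sin (\<xi> / sqrt \<omega>)\<close> at distance
  \<xi> beyond it. The factor 2 is evenness.\<close>

lemma nn_integral_profile:
  assumes [measurable]: "g \<in> borel_measurable borel"
  shows "(\<integral>\<^sup>+x. g (F x) * indicator {- profile_end \<omega><..<profile_end \<omega>} x \<partial>lborel)
    = 2 * ((\<integral>\<^sup>+s. g s \<partial>arcsine_measure 1) + (\<integral>\<^sup>+p. g (- p) \<partial>arcsine_measure (sqrt \<omega>)))"
proof -
  have [measurable]: "F \<in> borel_measurable borel"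
    by (intro borel_measurable_continuous_onI continuous_on_profile \<omega>_pos)
  let ?E = "profile_end \<omega>" and ?r = "sqrt \<omega>"
  have E: "pi/2 \<le> ?E" using inner_bounds(4)[of "pi/2"] pi_half_ge_zero by simp
  have "(\<integral>\<^sup>+x. g (F x) * indicator {- ?E<..<?E} x \<partial>lborel)
      = 2 * (\<integral>\<^sup>+x. g (F x) * indicator {- ?E<..<?E} x * indicator {0<..} x \<partial>lborel)"
    by (rule nn_integral_lborel_reflect_split) (auto simp: profile_minus indicator_def)
  also have "(\<integral>\<^sup>+x. g (F x) * indicator {- ?E<..<?E} x * indicator {0<..} x \<partial>lborel)
      = (\<integral>\<^sup>+x. g (F x) * indicator {0<..<pi/2} x + g (F x) * indicator {pi/2<..<?E} x \<partial>lborel)"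
  proof (rule nn_integral_cong_AE)
    have "AE x in lborel. x \<notin> {pi/2}" by (intro AE_not_in) auto
    then show "AE x in lborel. g (F x) * indicator {- ?E<..<?E} x * indicator {0<..} x
        = g (F x) * indicator {0<..<pi/2} x + g (F x) * indicator {pi/2<..<?E} x"
    proof eventually_elim
      case (elim x)
      have "0 < x \<and> - ?E < x" if "pi/2 < x" using that E pi_half_ge_zero by linarith
      moreover have "- ?E < x \<and> x < ?E" if "0 < x" "x < pi/2" using that E by linarith
      ultimately show ?case using elim unfolding indicator_def by auto
    qed
  qed
  also have "\<dots> = (\<integral>\<^sup>+x. g (F x) * indicator {0<..<pi/2} x \<partial>lborel) + (\<integral>\<^sup>+x. g (F x) * indicator {pi/2<..<?E} x \<partial>lborel)"
    by (rule nn_integral_add) auto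
  also have "(\<integral>\<^sup>+x. g (F x) * indicator {0<..<pi/2} x \<partial>lborel) = (\<integral>\<^sup>+s. g s \<partial>arcsine_measure 1)"
  proof -
    have "(\<integral>\<^sup>+x. g (F x) * indicator {0<..<pi/2} x \<partial>lborel)
      = (\<integral>\<^sup>+x. g (F (pi/2 - x)) * indicator {0<..<pi/2} (pi/2 - x) \<partial>lborel)"
      by (subst nn_integral_real_affine[of _ "-1" "pi/2"]) auto
    also have "\<dots> = (\<integral>\<^sup>+\<xi>. g (1 * sin (\<xi> / 1)) * indicator {0<..<1 * (pi/2)} \<xi> \<partial>lborel)"
    proof (rule nn_integral_cong)
      fix x
      show "g (F (pi/2 - x)) * indicator {0<..<pi/2} (pi/2 - x) = g (1 * sin (x / 1)) * indicator {0<..<1 * (pi/2)} x"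
      proof (cases "0 < x \<and> x < pi/2")
        case True
        then have "F (pi/2 - x) = cos (pi/2 - x)" by (intro profile_inner) linarith
        also have "\<dots> = sin x" by (simp add: cos_diff)
        finally show ?thesis using True by (simp add: indicator_def)
      qed (auto simp: indicator_def)
    qed
    also have "\<dots> = (\<integral>\<^sup>+s. g s \<partial>arcsine_measure 1)"
      by (rule nn_integral_arcsine_measure[symmetric]) auto
    finally show ?thesis .
  qed
  also have "(\<integral>\<^sup>+x. g (F x) * indicator {pi/2<..<?E} x \<partial>lborel) = (\<integral>\<^sup>+p. g (- p) \<partial>arcsine_measure ?r)"
  proof -
    have "(\<integral>\<^sup>+x. g (F x) * indicator {pi/2<..<?E} x \<partial>lborel)
      = (\<integral>\<^sup>+x. g (F (pi/2 + x)) * indicator {pi/2<..<?E} (pi/2 + x) \<partial>lborel)"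
      by (subst nn_integral_real_affine[of _ 1 "pi/2"]) auto
    also have "\<dots> = (\<integral>\<^sup>+\<xi>. g (- (?r * sin (\<xi> / ?r))) * indicator {0<..<?r * (pi/2)} \<xi> \<partial>lborel)"
      by (rule nn_integral_cong) (auto simp: indicator_def profile_end_def profile_outer)
    also have "\<dots> = (\<integral>\<^sup>+p. g (- p) \<partial>arcsine_measure ?r)"
      by (rule nn_integral_arcsine_measure[OF sqrt_\<omega>_pos, symmetric]) auto
    finally show ?thesis .
  qed
  finally show ?thesis .
qed

end

section \<open>Comparison of volumes\<close>

definition heaviside :: "real \<Rightarrow> ennreal" where
  "heaviside u = indicator {0<..} u"

lemma heaviside_measurable [measurable]: "heaviside \<in> borel_measurable borel"
  unfolding heaviside_def[abs_def] by measurable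

lemma heaviside_scale: "c > 0 \<Longrightarrow> heaviside (c * u) = heaviside u"
  by (simp add: heaviside_def indicator_def zero_less_mult_iff)

lemma nn_integral_swap:
  assumes "sigma_finite_measure A" "sigma_finite_measure B"
    and [measurable_cong]: "sets A = sets borel" "sets B = sets borel"
    and [measurable]: "(\<lambda>(x, y). f x y) \<in> borel_measurable (borel \<Otimes>\<^sub>M borel)"
  shows "(\<integral>\<^sup>+x. \<integral>\<^sup>+y. f x y \<partial>(B :: real measure) \<partial>(A :: real measure)) = (\<integral>\<^sup>+y. \<integral>\<^sup>+x. f x y \<partial>A \<partial>B)"
proof -
  interpret pair_sigma_finite A B using assms by (simp add: pair_sigma_finite_def)
  show ?thesis by (rule Fubini'[symmetric]) measurable
qed

section \<open>Splitting the volume by the number of coordinates beyond \<open>pi/2\<close>\<close>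

text \<open>The octant volume where one given coordinate is beyond \<open>pi/2\<close>, the
  variables being the absolute values of the profiles; a and b are the weights of the inner
  coordinates relative to the outer one.\<close>

definition slab_mass :: "real \<Rightarrow> real \<Rightarrow> real \<Rightarrow> ennreal" where
  "slab_mass \<omega> a b = (\<integral>\<^sup>+s. \<integral>\<^sup>+t. \<integral>\<^sup>+p. heaviside (a * s + b * t - p)
     \<partial>arcsine_measure (sqrt \<omega>) \<partial>arcsine_measure 1 \<partial>arcsine_measure 1)"

text \<open>The counterpart with two coordinates beyond \<open>pi/2\<close>; their weights a and b
  are relative to that of the inner coordinate.\<close>

definition edge_mass :: "real \<Rightarrow> real \<Rightarrow> real \<Rightarrow> ennreal" where
  "edge_mass \<omega> a b = (\<integral>\<^sup>+s. \<integral>\<^sup>+p. \<integral>\<^sup>+q. heaviside (s - a * p - b * q)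
     \<partial>arcsine_measure (sqrt \<omega>) \<partial>arcsine_measure (sqrt \<omega>) \<partial>arcsine_measure 1)"

definition corner_mass :: ennreal where
  "corner_mass = (\<integral>\<^sup>+s. \<integral>\<^sup>+t. \<integral>\<^sup>+q. 1 \<partial>arcsine_measure 1 \<partial>arcsine_measure 1 \<partial>arcsine_measure 1)"

context gamma_range
begin

abbreviation "P \<equiv> arcsine_measure 1"
abbreviation "N \<equiv> arcsine_measure (sqrt \<omega>)"

lemma finite_P: "finite_measure P" and finite_N: "finite_measure N"
  using finite_arcsine_measure sqrt_\<omega>_pos by auto

sublocale P: finite_measure P by (rule finite_P)
sublocale N: finite_measure N by (rule finite_N)

lemmas swap_NP = nn_integral_swap[OF N.sigma_finite_measure_axioms P.sigma_finite_measure_axioms]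
lemmas swap_PP = nn_integral_swap[OF P.sigma_finite_measure_axioms P.sigma_finite_measure_axioms]
lemmas swap_NN = nn_integral_swap[OF N.sigma_finite_measure_axioms N.sigma_finite_measure_axioms]

text \<open>The integral of g (F x) over 0 < x < \<open>profile_end \<omega>\<close>, written with
  the image measures of the two branches.\<close>

definition J :: "(real \<Rightarrow> ennreal) \<Rightarrow> ennreal" where
  "J g = (\<integral>\<^sup>+s. g s \<partial>P) + (\<integral>\<^sup>+p. g (- p) \<partial>N)"

lemma J_measurable [measurable]:
  assumes [measurable]: "(\<lambda>(x, y). g x y) \<in> borel_measurable (M \<Otimes>\<^sub>M borel)"
  shows "(\<lambda>x. J (g x)) \<in> borel_measurable M"
  unfolding J_def by measurable

lemma nn_integral_profile_J:
  assumes [measurable]: "g \<in> borel_measurable borel"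
  shows "(\<integral>\<^sup>+x. c * (g (F x) * indicator {- profile_end \<omega><..<profile_end \<omega>} x) \<partial>lborel) = c * (2 * J g)"
proof -
  have [measurable]: "F \<in> borel_measurable borel"
    by (intro borel_measurable_continuous_onI continuous_on_profile \<omega>_pos)
  show ?thesis by (subst nn_integral_cmult) (auto simp: nn_integral_profile J_def)
qed

lemma emeasure_Omega0_J:
  "emeasure lborel (Omega0 \<omega> \<gamma>) = 8 * J (\<lambda>s. J (\<lambda>t. J (\<lambda>q. heaviside (\<gamma> * s + \<gamma> * t + q))))"
proof -
  let ?i = "indicator {- profile_end \<omega><..<profile_end \<omega>} :: real \<Rightarrow> ennreal"
  let ?h = "\<lambda>s t q. heaviside (\<gamma> * s + \<gamma> * t + q)"
  have "Omega0 \<omega> \<gamma> \<in> sets borel" by (simp add: Omega0_def)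
  then have "emeasure lborel (Omega0 \<omega> \<gamma>)
      = (\<integral>\<^sup>+x. \<integral>\<^sup>+y. \<integral>\<^sup>+z. indicator (Omega0 \<omega> \<gamma>) (vector [x, y, z]) \<partial>lborel \<partial>lborel \<partial>lborel)"
    by (rule emeasure_lborel_real3)
  also have "\<dots> = (\<integral>\<^sup>+x. \<integral>\<^sup>+y. \<integral>\<^sup>+z. (?i x * ?i y) * (?h (F x) (F y) (F z) * ?i z) \<partial>lborel \<partial>lborel \<partial>lborel)"
    by (intro nn_integral_cong)
      (auto simp: Omega0_eq forall_3 profile_sum_def heaviside_def indicator_def abs_less_iff)
  also have "\<dots> = (\<integral>\<^sup>+x. \<integral>\<^sup>+y. (?i x * ?i y) * (2 * J (?h (F x) (F y))) \<partial>lborel \<partial>lborel)"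
    by (subst nn_integral_profile_J) auto
  also have "\<dots> = (\<integral>\<^sup>+x. \<integral>\<^sup>+y. (2 * ?i x) * (J (?h (F x) (F y)) * ?i y) \<partial>lborel \<partial>lborel)"
    by (simp add: mult_ac)
  also have "\<dots> = (\<integral>\<^sup>+x. (2 * ?i x) * (2 * J (\<lambda>t. J (?h (F x) t))) \<partial>lborel)"
    by (subst nn_integral_profile_J) auto
  also have "\<dots> = (\<integral>\<^sup>+x. 4 * (J (\<lambda>t. J (?h (F x) t)) * ?i x) \<partial>lborel)"
    by (intro nn_integral_cong) (simp add: mult_ac flip: mult.assoc)
  also have "\<dots> = 4 * (2 * J (\<lambda>s. J (\<lambda>t. J (?h s t))))"
    by (subst nn_integral_profile_J) auto
  finally show ?thesis by (simp add: mult.assoc[symmetric])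
qed

lemma heaviside_scaled:
  "heaviside (\<gamma> * s + - (\<gamma> * p) + q) = heaviside (1 * s + 1 / \<gamma> * q - p)"
  "heaviside (\<gamma> * s + - (\<gamma> * p) + - q) = heaviside (s - 1 * p - 1 / \<gamma> * q)"
proof -
  have "\<gamma> * s + - (\<gamma> * p) + q = \<gamma> * (1 * s + 1 / \<gamma> * q - p)"
    "\<gamma> * s + - (\<gamma> * p) + - q = \<gamma> * (s - 1 * p - 1 / \<gamma> * q)"
    using \<gamma>_pos by (simp_all add: algebra_simps)
  then show "heaviside (\<gamma> * s + - (\<gamma> * p) + q) = heaviside (1 * s + 1 / \<gamma> * q - p)"
    "heaviside (\<gamma> * s + - (\<gamma> * p) + - q) = heaviside (s - 1 * p - 1 / \<gamma> * q)"
    using heaviside_scale[OF \<gamma>_pos] by simp_all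
qed

text \<open>Each coordinate is on the inner or outer branch, giving eight terms: the all-inner one
  is independent of \<gamma>, the all-outer one vanishes. In the others, Fubini and division by the
  weight of the coordinate alone on its branch give the standard form.\<close>

lemma emeasure_Omega0_eq:
  "emeasure lborel (Omega0 \<omega> \<gamma>) = 8 * (corner_mass +
     (slab_mass \<omega> \<gamma> \<gamma> + slab_mass \<omega> 1 (1/\<gamma>) + slab_mass \<omega> (1/\<gamma>) 1) +
     (edge_mass \<omega> \<gamma> \<gamma> + edge_mass \<omega> 1 (1/\<gamma>) + edge_mass \<omega> (1/\<gamma>) 1))"
proof -
  let ?h = "\<lambda>s t q. heaviside (\<gamma> * s + \<gamma> * t + q)"
  note hs = heaviside_scaled
  have expand: "J (\<lambda>s. J (\<lambda>t. J (\<lambda>q. ?h s t q))) =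
      ((\<integral>\<^sup>+s. \<integral>\<^sup>+t. \<integral>\<^sup>+q. ?h s t q \<partial>P \<partial>P \<partial>P) + (\<integral>\<^sup>+s. \<integral>\<^sup>+t. \<integral>\<^sup>+q. ?h s t (- q) \<partial>N \<partial>P \<partial>P)) +
      ((\<integral>\<^sup>+s. \<integral>\<^sup>+t. \<integral>\<^sup>+q. ?h s (- t) q \<partial>P \<partial>N \<partial>P) + (\<integral>\<^sup>+s. \<integral>\<^sup>+t. \<integral>\<^sup>+q. ?h s (- t) (- q) \<partial>N \<partial>N \<partial>P)) +
      (((\<integral>\<^sup>+s. \<integral>\<^sup>+t. \<integral>\<^sup>+q. ?h (- s) t q \<partial>P \<partial>P \<partial>N) + (\<integral>\<^sup>+s. \<integral>\<^sup>+t. \<integral>\<^sup>+q. ?h (- s) t (- q) \<partial>N \<partial>P \<partial>N)) +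
      ((\<integral>\<^sup>+s. \<integral>\<^sup>+t. \<integral>\<^sup>+q. ?h (- s) (- t) q \<partial>P \<partial>N \<partial>N) + (\<integral>\<^sup>+s. \<integral>\<^sup>+t. \<integral>\<^sup>+q. ?h (- s) (- t) (- q) \<partial>N \<partial>N \<partial>N)))"
    unfolding J_def by (simp add: nn_integral_add)
  have AEP: "AE s in P. 0 < s" and AEN: "AE p in N. 0 < p"
    using AE_arcsine_measure by (auto elim: eventually_mono)
  have PPP: "(\<integral>\<^sup>+s. \<integral>\<^sup>+t. \<integral>\<^sup>+q. ?h s t q \<partial>P \<partial>P \<partial>P) = corner_mass"
    unfolding corner_mass_def
  proof (rule nn_integral_cong_AE, use AEP in eventually_elim, rule nn_integral_cong_AE,
      use AEP in eventually_elim, rule nn_integral_cong_AE, use AEP in eventually_elim)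
    fix s t q :: real assume "0 < s" "0 < t" "0 < q"
    then have "0 < \<gamma> * s + \<gamma> * t + q" using \<gamma>_pos by (simp add: add_pos_pos)
    then show "?h s t q = 1" by (simp add: heaviside_def)
  qed
  have NNN: "(\<integral>\<^sup>+s. \<integral>\<^sup>+t. \<integral>\<^sup>+q. ?h (- s) (- t) (- q) \<partial>N \<partial>N \<partial>N) = (\<integral>\<^sup>+s. \<integral>\<^sup>+t. \<integral>\<^sup>+q. 0 \<partial>N \<partial>N \<partial>N)"
  proof (rule nn_integral_cong_AE, use AEN in eventually_elim, rule nn_integral_cong_AE,
      use AEN in eventually_elim, rule nn_integral_cong_AE, use AEN in eventually_elim)
    fix s t q :: real assume "0 < s" "0 < t" "0 < q"
    then have "0 < \<gamma> * s + \<gamma> * t + q" using \<gamma>_pos by (simp add: add_pos_pos)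
    then show "?h (- s) (- t) (- q) = 0" by (simp add: heaviside_def)
  qed
  have PPN: "(\<integral>\<^sup>+s. \<integral>\<^sup>+t. \<integral>\<^sup>+q. ?h s t (- q) \<partial>N \<partial>P \<partial>P) = slab_mass \<omega> \<gamma> \<gamma>"
    by (simp add: slab_mass_def)
  have PNP: "(\<integral>\<^sup>+s. \<integral>\<^sup>+t. \<integral>\<^sup>+q. ?h s (- t) q \<partial>P \<partial>N \<partial>P) = slab_mass \<omega> 1 (1/\<gamma>)"
    unfolding slab_mass_def mult_minus_right hs by (subst swap_NP) auto
  have NPP: "(\<integral>\<^sup>+s. \<integral>\<^sup>+t. \<integral>\<^sup>+q. ?h (- s) t q \<partial>P \<partial>P \<partial>N) = slab_mass \<omega> (1/\<gamma>) 1"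
  proof -
    have "(\<integral>\<^sup>+s. \<integral>\<^sup>+t. \<integral>\<^sup>+q. ?h (- s) t q \<partial>P \<partial>P \<partial>N)
      = (\<integral>\<^sup>+s. \<integral>\<^sup>+t. \<integral>\<^sup>+q. heaviside (1 * t + 1 / \<gamma> * q - s) \<partial>P \<partial>P \<partial>N)"
      unfolding hs[symmetric] by (simp add: add.commute)
    also have "\<dots> = (\<integral>\<^sup>+t. \<integral>\<^sup>+s. \<integral>\<^sup>+q. heaviside (1 * t + 1 / \<gamma> * q - s) \<partial>P \<partial>N \<partial>P)"
      by (rule swap_NP) auto
    also have "\<dots> = (\<integral>\<^sup>+t. \<integral>\<^sup>+q. \<integral>\<^sup>+s. heaviside (1 * t + 1 / \<gamma> * q - s) \<partial>N \<partial>P \<partial>P)"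
      by (intro nn_integral_cong swap_NP) auto
    also have "\<dots> = (\<integral>\<^sup>+q. \<integral>\<^sup>+t. \<integral>\<^sup>+s. heaviside (1 * t + 1 / \<gamma> * q - s) \<partial>N \<partial>P \<partial>P)"
      by (rule swap_PP) auto
    finally show ?thesis by (simp add: slab_mass_def add.commute)
  qed
  have PNN: "(\<integral>\<^sup>+s. \<integral>\<^sup>+t. \<integral>\<^sup>+q. ?h s (- t) (- q) \<partial>N \<partial>N \<partial>P) = edge_mass \<omega> 1 (1/\<gamma>)"
    unfolding edge_mass_def mult_minus_right hs(2) ..
  have NPN: "(\<integral>\<^sup>+s. \<integral>\<^sup>+t. \<integral>\<^sup>+q. ?h (- s) t (- q) \<partial>N \<partial>P \<partial>N) = edge_mass \<omega> (1/\<gamma>) 1"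
  proof -
    have "(\<integral>\<^sup>+s. \<integral>\<^sup>+t. \<integral>\<^sup>+q. ?h (- s) t (- q) \<partial>N \<partial>P \<partial>N)
      = (\<integral>\<^sup>+s. \<integral>\<^sup>+t. \<integral>\<^sup>+q. heaviside (t - 1 * s - 1 / \<gamma> * q) \<partial>N \<partial>P \<partial>N)"
      unfolding hs[symmetric] by (simp add: add.commute)
    also have "\<dots> = (\<integral>\<^sup>+t. \<integral>\<^sup>+s. \<integral>\<^sup>+q. heaviside (t - 1 * s - 1 / \<gamma> * q) \<partial>N \<partial>N \<partial>P)"
      by (rule swap_NP) auto
    also have "\<dots> = (\<integral>\<^sup>+t. \<integral>\<^sup>+q. \<integral>\<^sup>+s. heaviside (t - 1 * s - 1 / \<gamma> * q) \<partial>N \<partial>N \<partial>P)"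
      by (intro nn_integral_cong swap_NN) auto
    finally show ?thesis by (simp add: edge_mass_def algebra_simps)
  qed
  have NNP: "(\<integral>\<^sup>+s. \<integral>\<^sup>+t. \<integral>\<^sup>+q. ?h (- s) (- t) q \<partial>P \<partial>N \<partial>N) = edge_mass \<omega> \<gamma> \<gamma>"
  proof -
    have "(\<integral>\<^sup>+s. \<integral>\<^sup>+t. \<integral>\<^sup>+q. ?h (- s) (- t) q \<partial>P \<partial>N \<partial>N)
      = (\<integral>\<^sup>+s. \<integral>\<^sup>+t. \<integral>\<^sup>+q. heaviside (q - \<gamma> * s - \<gamma> * t) \<partial>P \<partial>N \<partial>N)"
      by (simp add: algebra_simps)
    also have "\<dots> = (\<integral>\<^sup>+s. \<integral>\<^sup>+q. \<integral>\<^sup>+t. heaviside (q - \<gamma> * s - \<gamma> * t) \<partial>N \<partial>P \<partial>N)"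
      by (intro nn_integral_cong swap_NP) auto
    also have "\<dots> = (\<integral>\<^sup>+q. \<integral>\<^sup>+s. \<integral>\<^sup>+t. heaviside (q - \<gamma> * s - \<gamma> * t) \<partial>N \<partial>N \<partial>P)"
      by (rule swap_NP) auto
    finally show ?thesis by (simp add: edge_mass_def)
  qed
  show ?thesis
    unfolding emeasure_Omega0_J expand PPP PPN PNP PNN NPP NPN NNP NNN by (simp add: add_ac)
qed

text \<open>For fixed s and t the innermost integral is an arcsine, and the three arguments have
  mean k (s + t) / \<open>sqrt \<omega>\<close>, since s and t each receive the coefficients
  \<gamma>, 1 and 1/\<gamma>. Jensen and \<open>arcsin_scale_ge\<close> extract the factor 3 k,
  which exceeds 3 unless \<gamma> = 1.\<close>

lemma slab_mass_ge:
  defines "k \<equiv> (1 + \<gamma> + 1/\<gamma>) / 3"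
  shows "ennreal (3 * k) * slab_mass \<omega> 1 1 \<le> slab_mass \<omega> \<gamma> \<gamma> + slab_mass \<omega> 1 (1/\<gamma>) + slab_mass \<omega> (1/\<gamma>) 1"
proof -
  let ?r = "sqrt \<omega>"
  let ?W = "\<lambda>a b s t. \<integral>\<^sup>+p. heaviside (a * s + b * t - p) \<partial>N"
  have W: "?W a b s t = ennreal (?r * arcsin ((a * s + b * t) / ?r))" if "0 \<le> a * s + b * t" "a * s + b * t \<le> ?r" for a b s t
  proof -
    have "?W a b s t = (\<integral>\<^sup>+p. indicator {..<a * s + b * t} p \<partial>N)"
      by (intro nn_integral_cong) (auto simp: heaviside_def indicator_def)
    then show ?thesis using emeasure_arcsine_measure_lessThan[OF sqrt_\<omega>_pos that] by simp
  qed
  have k: "1 \<le> k"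
  proof -
    have "0 \<le> (\<gamma> - 1)\<^sup>2 / \<gamma>" using \<gamma>_pos by simp
    also have "\<dots> = \<gamma> + 1/\<gamma> - 2" using \<gamma>_pos by (simp add: power2_eq_square field_simps)
    finally show ?thesis by (simp add: k_def)
  qed
  have pt: "ennreal (3 * k) * ?W 1 1 s t \<le> ?W \<gamma> \<gamma> s t + ?W 1 (1/\<gamma>) s t + ?W (1/\<gamma>) 1 s t"
    if st: "0 < s \<and> s < 1" "0 < t \<and> t < 1" for s t
  proof -
    have g: "1/\<gamma> \<le> ?r / 2" "\<gamma> \<le> ?r / 2" "1 \<le> ?r / 2"
      using \<gamma> \<gamma>_pos sqrt_\<omega> sqrt_\<omega>_pos by (simp_all add: field_simps)
    have b: "0 \<le> a * s + b * t \<and> a * s + b * t \<le> ?r" if "0 \<le> a" "a \<le> ?r / 2" "0 \<le> b" "b \<le> ?r / 2" for a b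
    proof -
      have "a * s \<le> a * 1" "b * t \<le> b * 1" using that st by (auto intro!: mult_left_mono simp del: mult_1_right)
      moreover have "0 \<le> a * s" "0 \<le> b * t" using that st by auto
      ultimately show ?thesis using that by linarith
    qed
    define x where "x = (\<gamma> * s + \<gamma> * t) / ?r"
    define y where "y = (1 * s + 1/\<gamma> * t) / ?r"
    define z where "z = (1/\<gamma> * s + 1 * t) / ?r"
    have bx: "0 \<le> \<gamma> * s + \<gamma> * t" "\<gamma> * s + \<gamma> * t \<le> ?r" and by': "0 \<le> 1 * s + 1/\<gamma> * t" "1 * s + 1/\<gamma> * t \<le> ?r"
      and bz: "0 \<le> 1/\<gamma> * s + 1 * t" "1/\<gamma> * s + 1 * t \<le> ?r" and b1: "0 \<le> 1 * s + 1 * t" "1 * s + 1 * t \<le> ?r"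
      using b[of \<gamma> \<gamma>] b[of 1 "1/\<gamma>"] b[of "1/\<gamma>" 1] b[of 1 1] g \<gamma>_pos by auto
    have unit: "0 \<le> x" "x \<le> 1" "0 \<le> y" "y \<le> 1" "0 \<le> z" "z \<le> 1"
      unfolding x_def y_def z_def using bx by' bz sqrt_\<omega>_pos by (auto simp: divide_le_eq)
    have mean: "(x + y + z) / 3 = k * ((1 * s + 1 * t) / ?r)"
    proof -
      have "(\<gamma> * s + \<gamma> * t) + (1 * s + 1/\<gamma> * t) + (1/\<gamma> * s + 1 * t) = 3 * (k * (1 * s + 1 * t))"
        by (simp add: k_def algebra_simps add_divide_distrib)
      then have "x + y + z = 3 * (k * (1 * s + 1 * t)) / ?r"
        unfolding x_def y_def z_def by (simp only: add_divide_distrib[symmetric])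
      then show ?thesis by simp
    qed
    have "k * arcsin ((1 * s + 1 * t) / ?r) \<le> arcsin (k * ((1 * s + 1 * t) / ?r))"
    proof (rule arcsin_scale_ge[OF k])
      show "0 \<le> (1 * s + 1 * t) / ?r" using b1 sqrt_\<omega>_pos by simp
      show "k * ((1 * s + 1 * t) / ?r) \<le> 1" unfolding mean[symmetric] using unit by simp
    qed
    moreover have "3 * arcsin ((x + y + z) / 3) \<le> arcsin x + arcsin y + arcsin z"
      using unit by (intro arcsin_mean_le) auto
    ultimately have "3 * k * arcsin ((1 * s + 1 * t) / ?r) \<le> arcsin x + arcsin y + arcsin z"
      unfolding mean by linarith
    then have "?r * (3 * k * arcsin ((1 * s + 1 * t) / ?r)) \<le> ?r * (arcsin x + arcsin y + arcsin z)"
      using sqrt_\<omega>_pos by (intro mult_left_mono) auto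
    then have "3 * k * (?r * arcsin ((1 * s + 1 * t) / ?r)) \<le> ?r * arcsin x + ?r * arcsin y + ?r * arcsin z"
      by (simp add: algebra_simps)
    moreover have "0 \<le> arcsin u" if "0 \<le> u" "u \<le> 1" for u
      using arcsin_le_arcsin[of 0 u] that by simp
    ultimately show ?thesis
      unfolding W[OF bx] W[OF by'] W[OF bz] W[OF b1] x_def[symmetric] y_def[symmetric] z_def[symmetric]
      using unit sqrt_\<omega>_pos k by (simp add: ennreal_mult'[symmetric] ennreal_plus[symmetric] ennreal_leI del: ennreal_plus)
  qed
  have "ennreal (3 * k) * slab_mass \<omega> 1 1 = (\<integral>\<^sup>+s. \<integral>\<^sup>+t. ennreal (3 * k) * ?W 1 1 s t \<partial>P \<partial>P)"
    unfolding slab_mass_def by (simp add: nn_integral_cmult)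
  also have "\<dots> \<le> (\<integral>\<^sup>+s. \<integral>\<^sup>+t. ?W \<gamma> \<gamma> s t + ?W 1 (1/\<gamma>) s t + ?W (1/\<gamma>) 1 s t \<partial>P \<partial>P)"
  proof (rule nn_integral_mono_AE, use AE_arcsine_measure[of 1] in eventually_elim,
      rule nn_integral_mono_AE, use AE_arcsine_measure[of 1] in eventually_elim)
    fix s t :: real assume "0 < s \<and> s < 1" "0 < t \<and> t < 1"
    then show "ennreal (3 * k) * ?W 1 1 s t \<le> ?W \<gamma> \<gamma> s t + ?W 1 (1/\<gamma>) s t + ?W (1/\<gamma>) 1 s t" by (rule pt)
  qed
  also have "\<dots> = slab_mass \<omega> \<gamma> \<gamma> + slab_mass \<omega> 1 (1/\<gamma>) + slab_mass \<omega> (1/\<gamma>) 1"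
    unfolding slab_mass_def by (simp add: nn_integral_add)
  finally show ?thesis .
qed

section \<open>Comparison of the edge terms\<close>

text \<open>The Lebesgue density of the image of \<open>N\<close> under p \<mapsto> a p. It moves
  the weights out of the Heaviside factor, so that the three edge terms are integrals over the same
  region.\<close>

definition scaled_density :: "real \<Rightarrow> real \<Rightarrow> real" where
  "scaled_density a \<sigma> = arcsine_density (sqrt \<omega>) (\<sigma> / a) / a"

lemma scaled_density_measurable [measurable]: "scaled_density a \<in> borel_measurable borel"
  unfolding scaled_density_def[abs_def] by measurable

lemma nn_integral_N_scale:
  assumes "a > 0" and [measurable]: "G \<in> borel_measurable borel"
  shows "(\<integral>\<^sup>+p. G (a * p) \<partial>N) = (\<integral>\<^sup>+\<sigma>. ennreal (scaled_density a \<sigma>) * G \<sigma> \<partial>lborel)"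
proof -
  have "(\<integral>\<^sup>+p. G (a * p) \<partial>N) = (\<integral>\<^sup>+p. ennreal (arcsine_density (sqrt \<omega>) p) * G (a * p) \<partial>lborel)"
    unfolding arcsine_measure_def by (rule nn_integral_density) auto
  also have "\<dots> = ennreal (1 / a) * (\<integral>\<^sup>+\<sigma>. ennreal (arcsine_density (sqrt \<omega>) (\<sigma> / a)) * G \<sigma> \<partial>lborel)"
    by (subst nn_integral_real_affine[of _ "1 / a" 0]) (use assms in auto)
  also have "\<dots> = (\<integral>\<^sup>+\<sigma>. ennreal (1 / a) * (ennreal (arcsine_density (sqrt \<omega>) (\<sigma> / a)) * G \<sigma>) \<partial>lborel)"
    by (rule nn_integral_cmult[symmetric]) auto
  also have "\<dots> = (\<integral>\<^sup>+\<sigma>. ennreal (scaled_density a \<sigma>) * G \<sigma> \<partial>lborel)"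
    using assms(1) by (intro nn_integral_cong)
      (simp add: scaled_density_def mult.assoc[symmetric] ennreal_mult'[symmetric])
  finally show ?thesis .
qed

text \<open>In the product of the three summands each variable meets the densities for \<gamma>, 1
  and 1/\<gamma> once, and the Jacobian factors cancel; \<open>amgm3\<close> reduces the claim to
  the one-variable inequality \<open>key\<close>.\<close>

lemma scaled_density_product_ge:
  assumes "0 < \<sigma>" "\<sigma> < 1" "0 < \<tau>" "\<tau> < 1"
  shows "3 * (scaled_density 1 \<sigma> * scaled_density 1 \<tau>) \<le> scaled_density \<gamma> \<sigma> * scaled_density \<gamma> \<tau> +
    scaled_density 1 \<sigma> * scaled_density (1/\<gamma>) \<tau> + scaled_density (1/\<gamma>) \<sigma> * scaled_density 1 \<tau>"
proof -
  let ?r = "sqrt \<omega>"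
  have g: "1/\<gamma> \<le> ?r / 2" "\<gamma> \<le> ?r / 2" "1 \<le> ?r / 2"
    using \<gamma> \<gamma>_pos sqrt_\<omega> sqrt_\<omega>_pos by (simp_all add: field_simps)
  define d where "d c x = 1 / sqrt (1 - (c * x / ?r)\<^sup>2)" for c x
  have sq: "0 < 1 - (c * x / ?r)\<^sup>2" and dens: "arcsine_density ?r (c * x) = d c x"
    if "0 < c" "c \<le> ?r / 2" "0 < x" "x < 1" for c x
  proof -
    have "c * x < c * 1" using that by (intro mult_strict_left_mono) auto
    then have lt: "c * x < ?r" using that sqrt_\<omega>_pos by linarith
    then have "0 < c * x / ?r" "c * x / ?r < 1" using that sqrt_\<omega>_pos by auto
    then show "0 < 1 - (c * x / ?r)\<^sup>2" by (simp add: power_less_one_iff abs_square_less_1)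
    show "arcsine_density ?r (c * x) = d c x" using lt that by (simp add: arcsine_density_def d_def)
  qed
  have dpos: "0 < d c x" if "0 < c" "c \<le> ?r / 2" "0 < x" "x < 1" for c x
    using sq[OF that] by (simp add: d_def)
  have key: "(d 1 x)\<^sup>2 \<le> d (1/\<gamma>) x * d \<gamma> x" if x: "0 < x" "x < 1" for x
  proof -
    define v where "v = (x / ?r)\<^sup>2"
    have v: "0 \<le> v" by (simp add: v_def)
    have e: "(1 * x / ?r)\<^sup>2 = v" "(1/\<gamma> * x / ?r)\<^sup>2 = v / \<gamma>\<^sup>2" "(\<gamma> * x / ?r)\<^sup>2 = \<gamma>\<^sup>2 * v"
      by (simp_all add: v_def power_mult_distrib power_divide)
    have p: "0 < 1 - v" "0 < 1 - v / \<gamma>\<^sup>2" "0 < 1 - \<gamma>\<^sup>2 * v"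
      using sq[of 1 x] sq[of "1/\<gamma>" x] sq[of \<gamma> x] x g \<gamma>_pos unfolding e by auto
    have "2 \<le> \<gamma>\<^sup>2 + 1 / \<gamma>\<^sup>2"
    proof -
      have "0 \<le> (\<gamma> - 1 / \<gamma>)\<^sup>2" by simp
      then show ?thesis using \<gamma>_pos by (simp add: power2_diff power_one_over)
    qed
    then have "2 * v \<le> (\<gamma>\<^sup>2 + 1 / \<gamma>\<^sup>2) * v" using v by (intro mult_right_mono)
    \<comment> \<open>The two sides differ only in the linear terms, (\<gamma>^2 + 1/\<gamma>^2) v
      against 2 v.\<close>
    then have "(1 - v / \<gamma>\<^sup>2) * (1 - \<gamma>\<^sup>2 * v) \<le> (1 - v)\<^sup>2"
      using \<gamma>_pos by (simp add: power2_eq_square algebra_simps)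
    then have "sqrt ((1 - v / \<gamma>\<^sup>2) * (1 - \<gamma>\<^sup>2 * v)) \<le> 1 - v"
      using p by (intro real_le_lsqrt) auto
    then have "1 / (1 - v) \<le> 1 / sqrt ((1 - v / \<gamma>\<^sup>2) * (1 - \<gamma>\<^sup>2 * v))"
      using p by (intro divide_left_mono) auto
    then show ?thesis unfolding d_def e using p by (simp add: power_divide real_sqrt_mult)
  qed
  \<comment> \<open>The index inverts: the image under multiplication by a involves d at
    1/a.\<close>
  have s: "scaled_density 1 x = d 1 x" "scaled_density \<gamma> x = d (1/\<gamma>) x / \<gamma>" "scaled_density (1/\<gamma>) x = \<gamma> * d \<gamma> x"
    if "0 < x" "x < 1" for x
    using dens[of 1 x] dens[of "1/\<gamma>" x] dens[of \<gamma> x] that g \<gamma>_pos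
    by (auto simp: scaled_density_def mult.commute)
  have pos: "0 < d c \<sigma>" "0 < d c \<tau>" if "c \<in> {1, \<gamma>, 1/\<gamma>}" for c
    using that dpos g \<gamma>_pos assms by auto
  show ?thesis unfolding s[OF assms(1,2)] s[OF assms(3,4)]
  proof (rule amgm3)
    \<comment> \<open>Two of the three factors are exchanged by means of \<open>key\<close>, the
      third is kept as it stands.\<close>
    have "(d 1 \<sigma> * d 1 \<tau>) ^ 3 = ((d 1 \<sigma>)\<^sup>2 * (d 1 \<tau>)\<^sup>2) * (d 1 \<sigma> * d 1 \<tau>)"
      by (simp add: power2_eq_square power3_eq_cube)
    also have "\<dots> \<le> ((d (1/\<gamma>) \<sigma> * d \<gamma> \<sigma>) * (d (1/\<gamma>) \<tau> * d \<gamma> \<tau>)) * (d 1 \<sigma> * d 1 \<tau>)"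
      using key[OF assms(1,2)] key[OF assms(3,4)] pos
      by (intro mult_right_mono mult_mono) (auto intro!: mult_nonneg_nonneg less_imp_le)
    also have "\<dots> = d (1/\<gamma>) \<sigma> / \<gamma> * (d (1/\<gamma>) \<tau> / \<gamma>) * (d 1 \<sigma> * (\<gamma> * d \<gamma> \<tau>)) * (\<gamma> * d \<gamma> \<sigma> * d 1 \<tau>)"
      using \<gamma>_pos by simp
    finally show "(d 1 \<sigma> * d 1 \<tau>) ^ 3 \<le> d (1/\<gamma>) \<sigma> / \<gamma> * (d (1/\<gamma>) \<tau> / \<gamma>) * (d 1 \<sigma> * (\<gamma> * d \<gamma> \<tau>)) * (\<gamma> * d \<gamma> \<sigma> * d 1 \<tau>)" .
  qed (use pos \<gamma>_pos in auto)
qed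

lemma edge_mass_ge:
  "3 * edge_mass \<omega> 1 1 \<le> edge_mass \<omega> \<gamma> \<gamma> + edge_mass \<omega> 1 (1/\<gamma>) + edge_mass \<omega> (1/\<gamma>) 1"
proof -
  let ?w = "\<lambda>a \<sigma>. ennreal (scaled_density a \<sigma>)"
  let ?Y = "\<lambda>a b s. \<integral>\<^sup>+p. \<integral>\<^sup>+q. heaviside (s - a * p - b * q) \<partial>N \<partial>N"
  let ?D = "\<lambda>a b s \<sigma> \<tau>. (?w a \<sigma> * ?w b \<tau>) * heaviside (s - \<sigma> - \<tau>)"
  have Y: "?Y a b s = (\<integral>\<^sup>+\<sigma>. \<integral>\<^sup>+\<tau>. ?D a b s \<sigma> \<tau> \<partial>lborel \<partial>lborel)" if "a > 0" "b > 0" for a b s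
  proof -
    have "?Y a b s = (\<integral>\<^sup>+p. \<integral>\<^sup>+\<tau>. ?w b \<tau> * heaviside (s - a * p - \<tau>) \<partial>lborel \<partial>N)"
      by (intro nn_integral_cong nn_integral_N_scale that) auto
    also have "\<dots> = (\<integral>\<^sup>+\<sigma>. ?w a \<sigma> * (\<integral>\<^sup>+\<tau>. ?w b \<tau> * heaviside (s - \<sigma> - \<tau>) \<partial>lborel) \<partial>lborel)"
      by (rule nn_integral_N_scale[OF that(1)]) auto
    also have "\<dots> = (\<integral>\<^sup>+\<sigma>. \<integral>\<^sup>+\<tau>. ?D a b s \<sigma> \<tau> \<partial>lborel \<partial>lborel)"
      by (simp add: nn_integral_cmult[symmetric] mult.assoc)
    finally show ?thesis .
  qed
  have nn: "0 \<le> scaled_density a \<sigma>" if "a > 0" for a \<sigma>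
    using that by (simp add: scaled_density_def arcsine_density_nonneg)
  have pt: "3 * ?D 1 1 s \<sigma> \<tau> \<le> ?D \<gamma> \<gamma> s \<sigma> \<tau> + ?D 1 (1/\<gamma>) s \<sigma> \<tau> + ?D (1/\<gamma>) 1 s \<sigma> \<tau>" if "s < 1" for s \<sigma> \<tau>
  proof (cases "0 < \<sigma> \<and> 0 < \<tau> \<and> 0 < s - \<sigma> - \<tau>")
    case True
    \<comment> \<open>From \<sigma> + \<tau> < s < 1; below 1 all the scaled densities are inside
      their supports.\<close>
    then have "0 < \<sigma>" "\<sigma> < 1" "0 < \<tau>" "\<tau> < 1" using that by auto
    from scaled_density_product_ge[OF this] True show ?thesis
      using nn \<gamma>_pos by (simp add: heaviside_def ennreal_mult[symmetric] ennreal_plus[symmetric] ennreal_leI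
          ennreal_numeral[symmetric] del: ennreal_plus ennreal_numeral)
  next
    case False
    then have "?D 1 1 s \<sigma> \<tau> = 0" by (auto simp: heaviside_def scaled_density_def arcsine_density_def)
    then show ?thesis by (simp only: mult_zero_right zero_le)
  qed
  have "3 * edge_mass \<omega> 1 1 = (\<integral>\<^sup>+s. 3 * ?Y 1 1 s \<partial>P)"
    unfolding edge_mass_def by (simp add: nn_integral_cmult)
  also have "\<dots> \<le> (\<integral>\<^sup>+s. ?Y \<gamma> \<gamma> s + ?Y 1 (1/\<gamma>) s + ?Y (1/\<gamma>) 1 s \<partial>P)"
  proof (rule nn_integral_mono_AE, use AE_arcsine_measure[of 1] in eventually_elim)
    fix s :: real assume s: "0 < s \<and> s < 1"
    have "3 * ?Y 1 1 s = (\<integral>\<^sup>+\<sigma>. \<integral>\<^sup>+\<tau>. 3 * ?D 1 1 s \<sigma> \<tau> \<partial>lborel \<partial>lborel)"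
      by (subst Y) (simp_all add: nn_integral_cmult)
    also have "\<dots> \<le> (\<integral>\<^sup>+\<sigma>. \<integral>\<^sup>+\<tau>. ?D \<gamma> \<gamma> s \<sigma> \<tau> + ?D 1 (1/\<gamma>) s \<sigma> \<tau> + ?D (1/\<gamma>) 1 s \<sigma> \<tau> \<partial>lborel \<partial>lborel)"
      using s by (intro nn_integral_mono pt) auto
    also have "\<dots> = ?Y \<gamma> \<gamma> s + ?Y 1 (1/\<gamma>) s + ?Y (1/\<gamma>) 1 s"
      using \<gamma>_pos by (subst (1 2 3) Y) (simp_all add: nn_integral_add)
    finally show "3 * ?Y 1 1 s \<le> ?Y \<gamma> \<gamma> s + ?Y 1 (1/\<gamma>) s + ?Y (1/\<gamma>) 1 s" .
  qed
  also have "\<dots> = edge_mass \<omega> \<gamma> \<gamma> + edge_mass \<omega> 1 (1/\<gamma>) + edge_mass \<omega> (1/\<gamma>) 1"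
    unfolding edge_mass_def by (simp add: nn_integral_add)
  finally show ?thesis .
qed

end

lemma gamma_range_1:
  assumes "\<omega> \<ge> 4"
  shows "gamma_range \<omega> 1"
proof
  have "sqrt \<omega> \<ge> 2" using assms real_le_rsqrt[of 2 \<omega>] by simp
  moreover from this have "0 < sqrt \<omega>" by linarith
  ultimately show "2 / sqrt \<omega> \<le> 1" "1 \<le> sqrt \<omega> / 2" by (auto simp only: pos_divide_le_eq)
qed (fact assms)

context gamma_range
begin

lemma not_AE_False: "\<not> (AE s in P. False)"
proof
  assume "AE s in P. False"
  then have "emeasure P (space P) = 0" by (simp add: AE_iff_null null_sets_def)
  moreover have "emeasure P {..<1} \<le> emeasure P (space P)" by (intro emeasure_mono) auto
  moreover have "emeasure P {..<1} = ennreal (pi/2)"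
    using emeasure_arcsine_measure_lessThan[of 1 1] by simp
  ultimately show False by simp
qed

text \<open>The source of strictness: enlarging the slab term by a factor k > 1 is a strict gain
  only if that term is nonzero.\<close>

lemma slab_mass_pos: "slab_mass \<omega> 1 1 \<noteq> 0"
proof
  let ?W = "\<lambda>s t. \<integral>\<^sup>+p. heaviside (1 * s + 1 * t - p) \<partial>N"
  assume "slab_mass \<omega> 1 1 = 0"
  then have "AE s in P. (\<integral>\<^sup>+t. ?W s t \<partial>P) = 0"
    unfolding slab_mass_def by (subst (asm) nn_integral_0_iff_AE) auto
  then have "AE s in P. AE t in P. ?W s t = 0"
    by (subst (asm) nn_integral_0_iff_AE) auto
  then have "AE s in P. AE t in P. False"
    using AE_arcsine_measure[of 1]
  proof eventually_elim
    case (elim s)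
    show ?case using elim(1) AE_arcsine_measure[of 1]
    proof eventually_elim
      case (elim t)
      have st: "0 < s + t" "s + t < sqrt \<omega>" using elim(2) \<open>0 < s \<and> s < 1\<close> sqrt_\<omega> by auto
      have "?W s t = (\<integral>\<^sup>+p. indicator {..<s + t} p \<partial>N)"
        by (intro nn_integral_cong) (auto simp: heaviside_def indicator_def)
      also have "\<dots> = ennreal (sqrt \<omega> * arcsin ((s + t) / sqrt \<omega>))"
        using emeasure_arcsine_measure_lessThan[OF sqrt_\<omega>_pos, of "s + t"] st by simp
      finally have W: "ennreal (sqrt \<omega> * arcsin ((s + t) / sqrt \<omega>)) = 0" using elim(1) by simp
      have "0 < (s + t) / sqrt \<omega>" "(s + t) / sqrt \<omega> \<le> 1" using st sqrt_\<omega>_pos by simp_all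
      then have "arcsin 0 < arcsin ((s + t) / sqrt \<omega>)" by (intro arcsin_less_arcsin) auto
      then have "0 < sqrt \<omega> * arcsin ((s + t) / sqrt \<omega>)" using sqrt_\<omega>_pos by simp
      then show False using W by (simp add: ennreal_eq_0_iff)
    qed
  qed
  then show False using not_AE_False by simp
qed

lemma emeasure_Omega0_finite: "emeasure lborel (Omega0 \<omega> \<gamma>) < \<infinity>"
proof -
  have "bounded (Omega0 \<omega> \<gamma>)"
    by (rule bounded_subset[OF compact_imp_bounded[OF compact_closed_domain]])
      (auto simp: Omega0_eq closed_domain_def less_imp_le)
  then show ?thesis by (rule emeasure_bounded_finite)
qed

lemma Omega0_lmeasurable: "Omega0 \<omega> \<gamma> \<in> lmeasurable"
proof (rule bounded_set_imp_lmeasurable)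
  show "bounded (Omega0 \<omega> \<gamma>)"
    by (rule bounded_subset[OF compact_imp_bounded[OF compact_closed_domain]])
      (auto simp: Omega0_eq closed_domain_def less_imp_le)
  have "Omega0 \<omega> \<gamma> \<in> sets borel" by (simp add: Omega0_def)
  then show "Omega0 \<omega> \<gamma> \<in> sets lebesgue" by simp
qed

lemma emeasure_Omega0: "emeasure lborel (Omega0 \<omega> \<gamma>) = ennreal (measure lebesgue (Omega0 \<omega> \<gamma>))"
proof -
  have "Omega0 \<omega> \<gamma> \<in> sets borel" by (simp add: Omega0_def)
  then show ?thesis using emeasure_Omega0_finite
    by (simp add: emeasure_eq_ennreal_measure measure_completion less_top)
qed


text \<open>The corner terms agree and the edge terms satisfy only a weak inequality; the strict one
  comes from the slab terms through k > 1.\<close>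

lemma measure_Omega0_less:
  assumes "\<gamma> \<noteq> 1"
  shows "measure lebesgue (Omega0 \<omega> 1) < measure lebesgue (Omega0 \<omega> \<gamma>)"
proof -
  interpret one: gamma_range \<omega> 1 by (rule gamma_range_1[OF \<omega>])
  define k where "k = (1 + \<gamma> + 1/\<gamma>) / 3"
  have "0 < (\<gamma> - 1)\<^sup>2 / \<gamma>" using \<gamma>_pos assms by simp
  also have "\<dots> = \<gamma> + 1/\<gamma> - 2" using \<gamma>_pos by (simp add: power2_eq_square field_simps)
  finally have k: "1 < k" by (simp add: k_def)
  let ?Z = "slab_mass \<omega> 1 1" and ?D = "edge_mass \<omega> 1 1"
  have V1: "emeasure lborel (Omega0 \<omega> 1) = 8 * (corner_mass + 3 * ?Z + 3 * ?D)"
  proof -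
    have "x + x + x = 3 * x" for x :: ennreal
    proof -
      have "3 * x = (1 + 1 + 1) * x" by simp
      then show ?thesis by (simp only: distrib_right mult_1)
    qed
    then show ?thesis unfolding one.emeasure_Omega0_eq div_by_1 by (simp only:)
  qed
  \<comment> \<open>Strict inequalities in \<open>ennreal\<close> survive the addition of finite
    terms only; finiteness is inherited from the bounded domain at \<gamma> = 1.\<close>
  then have fin: "corner_mass < \<infinity>" "?Z < \<infinity>" "?D < \<infinity>"
    using one.emeasure_Omega0_finite by (auto simp: ennreal_mult_less_top)
  have Z: "?Z = ennreal (enn2real ?Z)" "enn2real ?Z > 0"
    using fin slab_mass_pos by (auto simp: enn2real_positive_iff less_top zero_less_iff_neq_zero)
  have "3 * ?Z < ennreal (3 * k) * ?Z"
  proof -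
    have "3 * enn2real ?Z < 3 * k * enn2real ?Z" using Z(2) k by simp
    then have "ennreal (3 * enn2real ?Z) < ennreal (3 * k * enn2real ?Z)"
      using Z(2) k by (intro ennreal_lessI) auto
    then show ?thesis using k by (subst (1 2) Z(1)) (simp add: ennreal_mult)
  qed
  also have "\<dots> \<le> slab_mass \<omega> \<gamma> \<gamma> + slab_mass \<omega> 1 (1/\<gamma>) + slab_mass \<omega> (1/\<gamma>) 1"
    unfolding k_def by (rule slab_mass_ge)
  finally have "(corner_mass + 3 * ?D) + 3 * ?Z < (corner_mass + 3 * ?D) +
     (slab_mass \<omega> \<gamma> \<gamma> + slab_mass \<omega> 1 (1/\<gamma>) + slab_mass \<omega> (1/\<gamma>) 1)"
    unfolding ennreal_add_left_cancel_less using fin by (auto simp: ennreal_mult_eq_top_iff)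
  then have "corner_mass + 3 * ?Z + 3 * ?D < corner_mass +
     (slab_mass \<omega> \<gamma> \<gamma> + slab_mass \<omega> 1 (1/\<gamma>) + slab_mass \<omega> (1/\<gamma>) 1) + 3 * ?D"
    by (simp only: add_ac)
  also have "\<dots> \<le> corner_mass +
     (slab_mass \<omega> \<gamma> \<gamma> + slab_mass \<omega> 1 (1/\<gamma>) + slab_mass \<omega> (1/\<gamma>) 1) +
     (edge_mass \<omega> \<gamma> \<gamma> + edge_mass \<omega> 1 (1/\<gamma>) + edge_mass \<omega> (1/\<gamma>) 1)"
    by (intro add_left_mono edge_mass_ge)
  finally have "emeasure lborel (Omega0 \<omega> 1) < emeasure lborel (Omega0 \<omega> \<gamma>)"
    unfolding V1 emeasure_Omega0_eq by (intro ennreal_mult_strict_left_mono) auto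
  then show ?thesis unfolding emeasure_Omega0 one.emeasure_Omega0
    by (simp add: ennreal_less_iff)
qed

lemma measure_Omega0_pos: "0 < measure lebesgue (Omega0 \<omega> \<gamma>)"
proof -
  have "ennreal (3 * ((1 + \<gamma> + 1/\<gamma>) / 3)) * slab_mass \<omega> 1 1 \<noteq> 0"
    using slab_mass_pos \<gamma>_pos by (simp add: ennreal_eq_0_iff add_pos_pos not_le)
  then have "slab_mass \<omega> \<gamma> \<gamma> + slab_mass \<omega> 1 (1/\<gamma>) + slab_mass \<omega> (1/\<gamma>) 1 \<noteq> 0"
    using slab_mass_ge by (metis le_zero_eq)
  then have "emeasure lborel (Omega0 \<omega> \<gamma>) \<noteq> 0" unfolding emeasure_Omega0_eq by auto
  then show ?thesis unfolding emeasure_Omega0 by (simp add: ennreal_eq_0_iff)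
qed

lemma measure_Omega:
  assumes "\<bar>a\<bar> < pi"
  shows "measure lebesgue (Omega \<omega> \<gamma> a) = (shear_factor a)\<^sup>2 * measure lebesgue (Omega0 \<omega> \<gamma>)"
proof -
  have "det (shear_matrix a) = (shear_factor a)\<^sup>2"
    by (simp add: det_3 shear_matrix_def power2_eq_square)
  then show ?thesis unfolding Omega_def
    by (subst measure_linear_image[OF matrix_vector_mul_linear Omega0_lmeasurable]) simp
qed

end

section \<open>From volumes to half-eigenvalues\<close>

theorem theorem1p1:
  fixes lam Lam \<omega> V :: real
  assumes "0 < lam" and "lam \<le> Lam"
    and "\<omega> = Lam / lam" and "\<omega> \<ge> 4"
    and "V > 0"
  shows "(1, 0) \<in> admissible \<omega> \<and>
    (\<forall>(\<gamma>, a) \<in> admissible \<omega>. (\<gamma>, a) \<noteq> (1, 0) \<longrightarrow>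
       half_eigenvalue lam Lam (Omega_scaled V \<omega> 1 0)
         < half_eigenvalue lam Lam (Omega_scaled V \<omega> \<gamma> a)) \<and>
    (\<forall>(\<gamma>, a) \<in> admissible \<omega>. (\<gamma>, a) \<noteq> (1, 0) \<longrightarrow>
       measure lebesgue (Omega \<omega> 1 0) powr (2/3) * half_eigenvalue lam Lam (Omega \<omega> 1 0)
         < measure lebesgue (Omega \<omega> \<gamma> a) powr (2/3) * half_eigenvalue lam Lam (Omega \<omega> \<gamma> a))"
proof -
  have Lam: "Lam = \<omega> * lam" using assms by simp
  note lam = assms(1,2) Lam
  interpret one: gamma_range \<omega> 1 by (rule gamma_range_1[OF assms(4)])
  define M where "M \<gamma> = measure lebesgue (Omega0 \<omega> \<gamma>)" for \<gamma>
  have M1: "M 1 > 0" unfolding M_def by (rule one.measure_Omega0_pos)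
  have vol1: "measure lebesgue (Omega \<omega> 1 0) = M 1"
    using one.measure_Omega[of 0] by (simp add: M_def shear_factor_def)
  have main: "half_eigenvalue lam Lam (Omega_scaled V \<omega> 1 0) < half_eigenvalue lam Lam (Omega_scaled V \<omega> \<gamma> a) \<and>
       measure lebesgue (Omega \<omega> 1 0) powr (2/3) * half_eigenvalue lam Lam (Omega \<omega> 1 0)
         < measure lebesgue (Omega \<omega> \<gamma> a) powr (2/3) * half_eigenvalue lam Lam (Omega \<omega> \<gamma> a)"
    if adm: "(\<gamma>, a) \<in> admissible \<omega>" and ne: "(\<gamma>, a) \<noteq> (1, 0)" for \<gamma> a
  proof -
    interpret gamma_range \<omega> \<gamma>
      using adm assms(4) by unfold_locales (auto simp: admissible_def)
    have a: "\<bar>a\<bar> < pi" using adm by (auto simp: admissible_def abs_less_iff)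
    define s where "s = shear_factor a"
    have s: "0 < s" "s \<le> 1" using shear_factor_bounds[OF a] by (auto simp: s_def)
    have M: "M \<gamma> > 0" unfolding M_def by (rule measure_Omega0_pos)
    have vol: "measure lebesgue (Omega \<omega> \<gamma> a) = s\<^sup>2 * M \<gamma>"
      unfolding M_def s_def by (rule measure_Omega[OF a])
    \<comment> \<open>For \<gamma> = 1 strictness comes from the shear, otherwise from the
      volume.\<close>
    have key: "s * M 1 < M \<gamma>"
    proof (cases "\<gamma> = 1")
      case True
      then have "s < 1" using ne shear_factor_less_1[OF a] by (auto simp: s_def)
      then show ?thesis using True M1 by simp
    next
      case False
      have "s * M 1 \<le> 1 * M 1" using s M1 by (intro mult_right_mono) auto
      also have "\<dots> < M \<gamma>" using measure_Omega0_less[OF False] by (simp add: M_def)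
      finally show ?thesis .
    qed
    have cube: "(s ^ 3) powr (1/3) = s" "(s ^ 3) powr (2/3) = s\<^sup>2"
    proof -
      have "s ^ 3 = s powr 3" using s by simp
      then have "(s ^ 3) powr x = s powr (3 * x)" for x by (simp only: powr_powr)
      from this[of "1/3"] this[of "2/3"] show "(s ^ 3) powr (1/3) = s" "(s ^ 3) powr (2/3) = s\<^sup>2" using s by simp_all
    qed
    have "half_eigenvalue lam Lam (Omega_scaled V \<omega> 1 0) < half_eigenvalue lam Lam (Omega_scaled V \<omega> \<gamma> a)"
    proof -
      define t1 where "t1 = (V / M 1) powr (1/3)"
      define t where "t = (V / (s\<^sup>2 * M \<gamma>)) powr (1/3)"
      have pos: "t1 > 0" "t > 0" using assms(5) M M1 s by (auto simp: t1_def t_def)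
      \<comment> \<open>The lower bound involves the effective scale t s, whose cube is V s / M
        \<gamma>; comparison with the cube V / M 1 of t1 is exactly \<open>key\<close>.\<close>
      have "t * s = (V / (s\<^sup>2 * M \<gamma>) * s ^ 3) powr (1/3)"
        unfolding t_def using assms(5) M s by (subst powr_mult) (auto simp: cube)
      also have "V / (s\<^sup>2 * M \<gamma>) * s ^ 3 = V * s / M \<gamma>"
        using s by (simp add: power2_eq_square power3_eq_cube)
      also have "(V * s / M \<gamma>) powr (1/3) < t1"
        unfolding t1_def using assms(5) M M1 s key by (intro powr_less_mono2) (auto simp: field_simps)
      finally have ts: "t * s < t1" .
      have "half_eigenvalue lam Lam (Omega_scaled V \<omega> 1 0) \<le> lam / t1\<^sup>2"
        unfolding Omega_scaled_def vol1 t1_def[symmetric] by (rule one.half_eigenvalue_le[OF pos(1) lam])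
      also have "\<dots> < lam / (t * s)\<^sup>2"
        using ts pos s assms(1) by (intro divide_strict_left_mono power_strict_mono) auto
      also have "\<dots> \<le> half_eigenvalue lam Lam (Omega_scaled V \<omega> \<gamma> a)"
        using half_eigenvalue_ge[OF a pos(2) lam] unfolding Omega_scaled_def vol t_def[symmetric] s_def[symmetric] .
      finally show ?thesis .
    qed
    moreover have "measure lebesgue (Omega \<omega> 1 0) powr (2/3) * half_eigenvalue lam Lam (Omega \<omega> 1 0)
         < measure lebesgue (Omega \<omega> \<gamma> a) powr (2/3) * half_eigenvalue lam Lam (Omega \<omega> \<gamma> a)"
    proof -
      have "M 1 powr (2/3) * half_eigenvalue lam Lam (Omega \<omega> 1 0) \<le> M 1 powr (2/3) * lam"
        using one.half_eigenvalue_le[of 1, OF _ lam] by (intro mult_left_mono) auto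
      \<comment> \<open>This is \<open>key\<close> in the form M 1 < M \<gamma> / s.\<close>
      also have "\<dots> < (M \<gamma> / s) powr (2/3) * lam"
        using key M1 s assms(1) by (intro mult_strict_right_mono powr_less_mono2) (auto simp: field_simps)
      also have "\<dots> = (s\<^sup>2 * M \<gamma>) powr (2/3) * (lam / s\<^sup>2)"
      proof -
        have "(M \<gamma> / s) powr (2/3) * s\<^sup>2 = (M \<gamma> / s * s ^ 3) powr (2/3)"
          using M s by (subst powr_mult) (auto simp: cube)
        also have "M \<gamma> / s * s ^ 3 = s\<^sup>2 * M \<gamma>" using s by (simp add: power2_eq_square power3_eq_cube)
        finally show ?thesis using s by (simp add: field_simps)
      qed
      also have "\<dots> \<le> (s\<^sup>2 * M \<gamma>) powr (2/3) * half_eigenvalue lam Lam (Omega \<omega> \<gamma> a)"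
        using half_eigenvalue_ge[OF a _ lam, of 1] by (intro mult_left_mono) (auto simp: s_def)
      finally show ?thesis unfolding vol vol1 .
    qed
    ultimately show ?thesis by blast
  qed
  have "(1, 0) \<in> admissible \<omega>" using one.\<gamma> by (simp add: admissible_def)
  then show ?thesis using main by auto
qed

end
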